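(* Let $1/3<\beta\le1/2$, $\gamma>1/\beta$, $\mathbf{X}\in\mathscr{C}^\beta(\mathbb{R}^d)$ an $(\omega,\beta)$-H\"older rough path, $\sigma\in\mathrm{Lip}^{\gamma-1}(\mathbb{R}^n,\mathcal{L}(\mathbb{R}^d,\mathbb{R}^n))$, $\xi\in\mathbb{R}^n$, $\bar D=\{(x_1,\dots,x_n):x_n\ge0\}$, $e_n={}^t(0,\dots,0,1)$. Let $C:C([0,T],\mathbb{R}^n)\to C([0,T],\mathbb{R}^n)$ be a continuous mapping whose values are bounded variation paths and such that $(C(x)_s)_{0\le s\le t}$ is measurable with respect to $\sigma(\{x_s\}_{0\le s\le t})$ for all $0\le t\le T$. Suppose: (i) for any $x\in C([0,T],\mathbb{R}^n)$ there is a unique $y\in C([0,T],\mathbb{R}^n)$ with $y=x+C(y)$, and $\tilde C(x):=y-x$ satisfies $(\mathrm{Lip})_{\rho'}$ for some $\rho'$ and $(\mathrm{BV})_{\rho''}$ for some $\rho''>0$; (ii) the $n$-th coordinate $\tilde C^n$ of $\tilde C$ satisfies $(\mathrm{Lip})_\kappa$ with $\kappa<1$ and $(\mathrm{BV})_{\kappa'}$ with $\kappa'<1$; (iii) the solution $\eta$ of $\eta=\xi+C_0(\eta)$ satisfies $\eta\in\bar D$, where $C_0(y_0)=C(y)_0$. Let $\tilde L$ and $\tilde A$ be as in the context. Consider $$\text{(P1)}\quad Y_t=\xi+\int_0^t\sigma(Y_s)d\mathbf{X}_s+C(Y)_t+\Phi_te_n,$$ $$\text{(P2)}\quad Z_t=\xi+\int_0^t\sigma\big(Z_s+\tilde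 C(Z+\tilde L(Z)e_n)_s+\tilde L(Z)_se_n\big)d\mathbf{X}_s,\qquad Z'_t=\sigma(Z_t+\tilde A(Z)_t).$$ (1) There exists a solution $Z\in\mathscr{D}^{2\beta}_X(\mathbb{R}^n)$ to (P2), and $Z$ satisfies $$\|Z\|_\beta+\|Z'\|_\beta+\|\tilde A(Z)\|_{1\text{-}var,\beta}+\|R^Z\|_{2\beta}\le K\left\{1+\big(1+\widetilde{|||\mathbf{X}|||}_\beta\big)^{\kappa_1}\omega(0,T)\right\}^{\kappa_2}\widetilde{|||\mathbf{X}|||}_\beta^{\kappa_3}$$ with positive constants $K,\kappa_1,\kappa_2,\kappa_3$ depending only on $\sigma,\beta,\gamma,\rho'',\kappa'$. Let $Y_t=Z_t+\tilde A(Z)_t$ and $\Phi_t=\tilde L(Z)_t$. Then $$Y_t=Z_t+C(Y)_t+\Phi_te_n,\qquad Z'_t=\sigma(Y_t),\qquad \Phi_t=\ell(Z+C(Y))_t,$$ where $\ell(x)_t=\max_{0\le s\le t}\max(-x^n_s,0)$; that is, $(Y,\Phi)$ is a solution to (P1). (2) Let $(Y,\Phi)$ be a solution to (P1) and let $Z$ be the controlled path appearing in the definition of a solution of (P1). Then $Z$ is a solution to (P2). Moreover, $Z$ is uniquely determined by $Y$ and $\mathbf{X}$. (3) The transformations defined in (1) and (2) are inverse to each other, and uniqueness of the solution of (P1) is equivalent to uniqueness of the solution of (P2).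
   Context: For a mapping $C:C([0,T],\mathbb{R}^n)\to C([0,T],\mathbb{R}^m)$ and $\rho>0$: $(\mathrm{Lip})_\rho$: $\|C(x)-C(y)\|_{\infty,[0,t]}\le\rho\|x-y\|_{\infty,[0,t]}$ for all $x,y$, $0\le t\le T$. $(\mathrm{BV})_\rho$: $\|C(x)\|_{1\text{-}var,[s,t]}\le\rho\|x\|_{\infty\text{-}var,[s,t]}$ for all $x$, $0\le s\le t\le T$. Here $x_{u,v}=x_v-x_u$, $\|x\|_{\infty,[s,t]}=\max_{s\le u\le t}|x_u|$, $\|x\|_{\infty\text{-}var,[s,t]}=\max_{s\le u\le v\le t}|x_{u,v}|$, $\|x\|_{1\text{-}var,[s,t]}$ the total variation; $x^n$ is the $n$-th coordinate of $x$. By adaptedness $C(y)_0$ depends only on $y_0$ and is written $C_0(y_0)$; under (i) the equation $\eta=\xi+C_0(\eta)$ has a unique solution. Definition of $\tilde L$: for $x\in C([0,T],\mathbb{R}^n;x_0=\xi)$, the map $\mathcal{M}_x(\phi)_t=\max_{0\le s\le t}\max\big(-(x^n_s+\tilde C^n(x+\phi e_n)_s),0\big)$ on $C([0,T],\mathbb{R};\phi_0=0)$ is a strict contraction since $\kappa<1$; $\tilde L(x)$ is its unique fixed point. $\tilde A(x)_t=\tilde C(x+\tilde L(x)e_n)_t+\tilde L(x)_te_n$. Solution of (P1): $(Y,\Phi)$ is a solution if (a) $(Y_t,e_n)\ge0$ for all $t$, $\Phi$ is real-valued, continuous, nondecreasing, $\Phi_0=0$ and $\Phi_t=\int_0^t1_{\{0\}}(Y^n_s)d\Phi_s$;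 (b) there is $Z\in\mathscr{D}^{2\beta}_X(\mathbb{R}^n)$ with $Y_t=Z_t+C(Y)_t+\Phi_te_n$ and $Z'_t=\sigma(Y_t)$; (c) $Z_t=\xi+\int_0^t\sigma(Z_s+C(Y)_s+\Phi_se_n)d\mathbf{X}_s$, $0\le t\le T$. Fix $T>0$. A control function is a continuous $\omega(s,t)\ge0$, $0\le s\le t\le T$, with $\omega(s,u)+\omega(u,t)\le\omega(s,t)$. $\|x\|_\theta=\inf\{C>0:|x_{u,v}|\le C\omega(u,v)^\theta,\ 0\le u\le v\le T\}$ (likewise for two-parameter functions); $\|x\|_{q\text{-}var,\theta}=\inf\{C>0:\|x\|_{q\text{-}var,[u,v]}\le C\omega(u,v)^\theta,\ 0\le u\le v\le T\}$. $\mathcal{C}^\theta$ is the space of continuous paths with $\|\cdot\|_\theta<\infty$. For $\gamma=m+\theta$ ($m\in\mathbb{N}\cup\{0\}$, $0<\theta\le1$), $\mathrm{Lip}^\gamma(E,F)$ is the set of bounded $f:E\to F$, $m$ times continuously differentiable with bounded derivatives up to order $m$ and $D^mf$ $\theta$-H\"older. $\mathscr{C}^\beta(\mathbb{R}^d)$ is the set of all $(\omega,\beta)$-H\"older rough paths $\mathbf{X}=(X,\mathbb{X})$ ($\omega$ ranging over control functions): Chen's relation, $|X_{s,t}|\le\|X\|_\beta\omega(s,t)^\beta$, $|\mathbb{X}_{s,t}|\le\|\mathbb{X}\|_{2\beta}\omega(s,t)^{2\beta}$. $|||\mathbf{X}|||_\beta=\|X\|_\beta+\sqrt{\|\mathbb{X}\|_{2\beta}}$,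 $\widetilde{|||\mathbf{X}|||}_\beta=\sum_{i=1}^3|||\mathbf{X}|||_\beta^i$. $\mathscr{D}^{2\beta}_X(\mathbb{R}^n)$: pairs $(Z,Z')\in\mathcal{C}^\beta([0,T],\mathbb{R}^n)\times\mathcal{C}^\beta([0,T],\mathcal{L}(\mathbb{R}^d,\mathbb{R}^n))$ with $R^Z_{s,t}=Z_t-Z_s-Z'_sX_{s,t}$ satisfying $\|R^Z\|_{2\beta}<\infty$. For $(Z,Z')\in\mathscr{D}^{2\beta}_X$ and a continuous bounded variation path $\Psi$, $\int_s^t\sigma(Z_u+\Psi_u)d\mathbf{X}_u$ is the limit, as the mesh of partitions of $[s,t]$ tends to $0$, of $\sum_i\Xi_{t_{i-1},t_i}$, $\Xi_{s,t}=\sigma(Y_s)X_{s,t}+(D\sigma)(Y_s)Z'_s\mathbb{X}_{s,t}+(D\sigma)(Y_s)\int_s^t\Psi_{s,r}\otimes dX_r$ with $Y=Z+\Psi$ (Young integral in the last term). *)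

theory Defs
  imports "HOL-Analysis.Analysis"
begin

(* C([0,T], 'a).  Paths are normalised to vanish off [0,T]: then equality of functions is equality
   of paths, and the pointwise vector space operations stay inside the space. *)
definition paths :: "real \<Rightarrow> (real \<Rightarrow> 'a::real_normed_vector) set" where
  "paths T = {x. continuous_on {0..T} x \<and> (\<forall>t. t \<notin> {0..T} \<longrightarrow> x t = 0)}"

definition const_path :: "real \<Rightarrow> 'a::real_normed_vector \<Rightarrow> real \<Rightarrow> 'a" where
  "const_path T v = (\<lambda>t. if t \<in> {0..T} then v else 0)"

(* s = p 0 < p 1 < ... < p m = t; if s = t this forces m = 0. *)
definition subdivision :: "real \<Rightarrow> real \<Rightarrow> nat \<Rightarrow> (nat \<Rightarrow> real) \<Rightarrow> bool" where
  "subdivision s t m p \<longleftrightarrow> p 0 = s \<and> p m = t \<and> (\<forall>i<m. p i < p (Suc i))"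

definition mesh_limit :: "(real \<Rightarrow> real \<Rightarrow> 'a::real_normed_vector) \<Rightarrow> real \<Rightarrow> real \<Rightarrow> 'a \<Rightarrow> bool" where
  "mesh_limit \<Xi> s t I \<longleftrightarrow>
     (\<forall>\<epsilon>>0. \<exists>\<delta>>0. \<forall>m p. subdivision s t m p \<and> (\<forall>i<m. p (Suc i) - p i < \<delta>) \<longrightarrow>
        norm ((\<Sum>i<m. \<Xi> (p i) (p (Suc i))) - I) < \<epsilon>)"

(* The norms ||x||_{infinity,[s,t]} and ||x||_{infinity-var,[s,t]}; for continuous x the suprema
   are maxima. *)
definition sup_norm :: "(real \<Rightarrow> 'a::real_normed_vector) \<Rightarrow> real \<Rightarrow> real \<Rightarrow> real" where
  "sup_norm x s t = (SUP u\<in>{s..t}. norm (x u))"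

definition sup_var :: "(real \<Rightarrow> 'a::real_normed_vector) \<Rightarrow> real \<Rightarrow> real \<Rightarrow> real" where
  "sup_var x s t = (SUP (u, v)\<in>{(u, v). s \<le> u \<and> u \<le> v \<and> v \<le> t}. norm (x v - x u))"

definition total_var :: "(real \<Rightarrow> 'a::real_normed_vector) \<Rightarrow> real \<Rightarrow> real \<Rightarrow> ennreal" where
  "total_var x s t =
     (SUP (m, p)\<in>{(m, p). subdivision s t m p}. \<Sum>i<m. ennreal (norm (x (p (Suc i)) - x (p i))))"

definition control :: "real \<Rightarrow> (real \<Rightarrow> real \<Rightarrow> real) \<Rightarrow> bool" where
  "control T \<omega> \<longleftrightarrow>
     continuous_on {(s, t). 0 \<le> s \<and> s \<le> t \<and> t \<le> T} (\<lambda>(s, t). \<omega> s t) \<and>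
     (\<forall>s t. 0 \<le> s \<and> s \<le> t \<and> t \<le> T \<longrightarrow> 0 \<le> \<omega> s t) \<and>
     (\<forall>s u t. 0 \<le> s \<and> s \<le> u \<and> u \<le> t \<and> t \<le> T \<longrightarrow> \<omega> s u + \<omega> u t \<le> \<omega> s t)"

(* The norms below take values in [0,\<infinity>], the infimum over the empty set being \<infinity>. *)
definition holder2 ::
    "real \<Rightarrow> (real \<Rightarrow> real \<Rightarrow> real) \<Rightarrow> real \<Rightarrow> (real \<Rightarrow> real \<Rightarrow> 'a::real_normed_vector) \<Rightarrow> ennreal" where
  "holder2 T \<omega> \<theta> f =
     Inf {ennreal c |c. 0 < c \<and>
       (\<forall>u v. 0 \<le> u \<and> u \<le> v \<and> v \<le> T \<longrightarrow> norm (f u v) \<le> c * \<omega> u v powr \<theta>)}"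

definition holder ::
    "real \<Rightarrow> (real \<Rightarrow> real \<Rightarrow> real) \<Rightarrow> real \<Rightarrow> (real \<Rightarrow> 'a::real_normed_vector) \<Rightarrow> ennreal" where
  "holder T \<omega> \<theta> x = holder2 T \<omega> \<theta> (\<lambda>u v. x v - x u)"

definition var_holder ::
    "real \<Rightarrow> (real \<Rightarrow> real \<Rightarrow> real) \<Rightarrow> real \<Rightarrow> (real \<Rightarrow> 'a::real_normed_vector) \<Rightarrow> ennreal" where
  "var_holder T \<omega> \<theta> x =
     Inf {ennreal c |c. 0 < c \<and>
       (\<forall>u v. 0 \<le> u \<and> u \<le> v \<and> v \<le> T \<longrightarrow> total_var x u v \<le> ennreal (c * \<omega> u v powr \<theta>))}"

definition holder_paths ::
    "real \<Rightarrow> (real \<Rightarrow> real \<Rightarrow> real) \<Rightarrow> real \<Rightarrow> (real \<Rightarrow> 'a::real_normed_vector) set" where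
  "holder_paths T \<omega> \<theta> = {x \<in> paths T. holder T \<omega> \<theta> x < \<infinity>}"

(* The derivative D^k f(x), k = length vs, evaluated in the directions vs. *)
primrec iter_deriv :: "('a::real_normed_vector \<Rightarrow> 'b::real_normed_vector) \<Rightarrow> 'a list \<Rightarrow> 'a \<Rightarrow> 'b" where
  "iter_deriv f [] = f"
| "iter_deriv f (v # vs) = (\<lambda>x. frechet_derivative (iter_deriv f vs) (at x) v)"

(* Lip^g with g = m + \<theta>, 0 < \<theta> \<le> 1.  Bounds on |D^k f| are bounds on the norm of the k-linear map
   D^k f(x), and E is finite-dimensional, so differentiability and continuity of D^k f amount to
   the same for each of its evaluations. *)
definition Lip_class ::
    "real \<Rightarrow> ('a::euclidean_space \<Rightarrow> 'b::real_normed_vector) set" where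
  "Lip_class g = {f. \<exists>(m::nat) \<theta>. g = real m + \<theta> \<and> 0 < \<theta> \<and> \<theta> \<le> 1 \<and>
     (\<forall>vs x. length vs < m \<longrightarrow> iter_deriv f vs differentiable (at x)) \<and>
     (\<forall>vs. length vs \<le> m \<longrightarrow> continuous_on UNIV (iter_deriv f vs)) \<and>
     (\<exists>B. \<forall>vs x. length vs \<le> m \<longrightarrow> norm (iter_deriv f vs x) \<le> B * prod_list (map norm vs)) \<and>
     (\<exists>H. \<forall>vs x y. length vs = m \<longrightarrow>
        norm (iter_deriv f vs x - iter_deriv f vs y) \<le> H * prod_list (map norm vs) * norm (x - y) powr \<theta>)}"

(* Tensors in R^a \<otimes> R^b are matrices: the entry $ i $ j belongs to e_i \<otimes> e_j. *)
definition tensor :: "real ^ 'a \<Rightarrow> real ^ 'b \<Rightarrow> real ^ 'b ^ 'a" where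
  "tensor a b = (\<chi> i j. a $ i * b $ j)"

(* The linear extension of a bilinear map B to tensors, a \<otimes> b being sent to B a b. *)
definition tensor_app ::
    "(real ^ 'a \<Rightarrow> real ^ 'b \<Rightarrow> 'c::real_vector) \<Rightarrow> real ^ 'b ^ 'a \<Rightarrow> 'c" where
  "tensor_app B M = (\<Sum>i\<in>UNIV. \<Sum>j\<in>UNIV. (M $ i $ j) *\<^sub>R B (axis i 1) (axis j 1))"

(* The first level enters through its increments X t - X s only. *)
definition rough_path ::
    "real \<Rightarrow> (real \<Rightarrow> real \<Rightarrow> real) \<Rightarrow> real \<Rightarrow> (real \<Rightarrow> real ^ 'd) \<Rightarrow>
     (real \<Rightarrow> real \<Rightarrow> real ^ 'd ^ 'd) \<Rightarrow> bool" where
  "rough_path T \<omega> \<beta> X XX \<longleftrightarrow> control T \<omega> \<and>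
     (\<forall>s u t. 0 \<le> s \<and> s \<le> u \<and> u \<le> t \<and> t \<le> T \<longrightarrow>
        XX s t = XX s u + XX u t + tensor (X u - X s) (X t - X u)) \<and>
     holder T \<omega> \<beta> X < \<infinity> \<and> holder2 T \<omega> (2 * \<beta>) XX < \<infinity>"

definition rough_norm ::
    "real \<Rightarrow> (real \<Rightarrow> real \<Rightarrow> real) \<Rightarrow> real \<Rightarrow> (real \<Rightarrow> real ^ 'd) \<Rightarrow>
     (real \<Rightarrow> real \<Rightarrow> real ^ 'd ^ 'd) \<Rightarrow> real" where
  "rough_norm T \<omega> \<beta> X XX =
     enn2real (holder T \<omega> \<beta> X) + sqrt (enn2real (holder2 T \<omega> (2 * \<beta>) XX))"

definition rough_norm3 ::
    "real \<Rightarrow> (real \<Rightarrow> real \<Rightarrow> real) \<Rightarrow> real \<Rightarrow> (real \<Rightarrow> real ^ 'd) \<Rightarrow>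
     (real \<Rightarrow> real \<Rightarrow> real ^ 'd ^ 'd) \<Rightarrow> real" where
  "rough_norm3 T \<omega> \<beta> X XX = (\<Sum>i=1..3. rough_norm T \<omega> \<beta> X XX ^ i)"

definition remainder ::
    "(real \<Rightarrow> real ^ 'd) \<Rightarrow> (real \<Rightarrow> real ^ 'n) \<Rightarrow> (real \<Rightarrow> (real ^ 'd) \<Rightarrow>\<^sub>L (real ^ 'n)) \<Rightarrow>
     real \<Rightarrow> real \<Rightarrow> real ^ 'n" where
  "remainder X Z Z' s t = Z t - Z s - blinfun_apply (Z' s) (X t - X s)"

definition controlled_paths ::
    "real \<Rightarrow> (real \<Rightarrow> real \<Rightarrow> real) \<Rightarrow> real \<Rightarrow> (real \<Rightarrow> real ^ 'd) \<Rightarrow>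
     ((real \<Rightarrow> real ^ 'n) \<times> (real \<Rightarrow> (real ^ 'd) \<Rightarrow>\<^sub>L (real ^ 'n))) set" where
  "controlled_paths T \<omega> \<beta> X =
     {(Z, Z'). Z \<in> holder_paths T \<omega> \<beta> \<and> Z' \<in> holder_paths T \<omega> \<beta> \<and>
        holder2 T \<omega> (2 * \<beta>) (remainder X Z Z') < \<infinity>}"

(* The Young integral of (\<Psi> r - \<Psi> s) \<otimes> dX r over [s,t], as the limit of left-point sums. *)
definition young_integral ::
    "(real \<Rightarrow> real ^ 'n) \<Rightarrow> (real \<Rightarrow> real ^ 'd) \<Rightarrow> real \<Rightarrow> real \<Rightarrow> real ^ 'd ^ 'n" where
  "young_integral \<Psi> X s t = (THE I. mesh_limit (\<lambda>u v. tensor (\<Psi> u - \<Psi> s) (X v - X u)) s t I)"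

definition rough_germ ::
    "(real ^ 'n \<Rightarrow> (real ^ 'd) \<Rightarrow>\<^sub>L (real ^ 'n)) \<Rightarrow> (real \<Rightarrow> real ^ 'd) \<Rightarrow> (real \<Rightarrow> real \<Rightarrow> real ^ 'd ^ 'd) \<Rightarrow>
     (real \<Rightarrow> real ^ 'n) \<Rightarrow> (real \<Rightarrow> (real ^ 'd) \<Rightarrow>\<^sub>L (real ^ 'n)) \<Rightarrow> (real \<Rightarrow> real ^ 'n) \<Rightarrow>
     real \<Rightarrow> real \<Rightarrow> real ^ 'n" where
  "rough_germ \<sigma> X XX Z Z' \<Psi> s t =
     (let y = Z s + \<Psi> s; D\<sigma> = frechet_derivative \<sigma> (at y)
      in blinfun_apply (\<sigma> y) (X t - X s)
         + tensor_app (\<lambda>a b. blinfun_apply (D\<sigma> (blinfun_apply (Z' s) a)) b) (XX s t)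
         + tensor_app (\<lambda>a b. blinfun_apply (D\<sigma> a) b) (young_integral \<Psi> X s t))"

(* The integral of \<sigma>(Z + \<Psi>) against the rough path over [s,t] exists and equals I. *)
definition has_rough_integral ::
    "(real ^ 'n \<Rightarrow> (real ^ 'd) \<Rightarrow>\<^sub>L (real ^ 'n)) \<Rightarrow> (real \<Rightarrow> real ^ 'd) \<Rightarrow> (real \<Rightarrow> real \<Rightarrow> real ^ 'd ^ 'd) \<Rightarrow>
     (real \<Rightarrow> real ^ 'n) \<Rightarrow> (real \<Rightarrow> (real ^ 'd) \<Rightarrow>\<^sub>L (real ^ 'n)) \<Rightarrow> (real \<Rightarrow> real ^ 'n) \<Rightarrow>
     real \<Rightarrow> real \<Rightarrow> real ^ 'n \<Rightarrow> bool" where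
  "has_rough_integral \<sigma> X XX Z Z' \<Psi> s t I \<longleftrightarrow> mesh_limit (rough_germ \<sigma> X XX Z Z' \<Psi>) s t I"

definition Lip_cond ::
    "real \<Rightarrow> real \<Rightarrow> ((real \<Rightarrow> 'a::real_normed_vector) \<Rightarrow> (real \<Rightarrow> 'b::real_normed_vector)) \<Rightarrow> bool" where
  "Lip_cond T \<rho> C \<longleftrightarrow> 0 < \<rho> \<and>
     (\<forall>x\<in>paths T. \<forall>y\<in>paths T. \<forall>t\<in>{0..T}.
        sup_norm (\<lambda>u. C x u - C y u) 0 t \<le> \<rho> * sup_norm (\<lambda>u. x u - y u) 0 t)"

definition BV_cond ::
    "real \<Rightarrow> real \<Rightarrow> ((real \<Rightarrow> 'a::real_normed_vector) \<Rightarrow> (real \<Rightarrow> 'b::real_normed_vector)) \<Rightarrow> bool" where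
  "BV_cond T \<rho> C \<longleftrightarrow> 0 < \<rho> \<and>
     (\<forall>x\<in>paths T. \<forall>s t. 0 \<le> s \<and> s \<le> t \<and> t \<le> T \<longrightarrow>
        total_var (C x) s t \<le> ennreal (\<rho> * sup_var x s t))"

definition continuous_mapping ::
    "real \<Rightarrow> ((real \<Rightarrow> 'a::real_normed_vector) \<Rightarrow> (real \<Rightarrow> 'b::real_normed_vector)) \<Rightarrow> bool" where
  "continuous_mapping T C \<longleftrightarrow>
     (\<forall>x\<in>paths T. \<forall>\<epsilon>>0. \<exists>\<delta>>0. \<forall>y\<in>paths T.
        sup_norm (\<lambda>u. y u - x u) 0 T < \<delta> \<longrightarrow> sup_norm (\<lambda>u. C y u - C x u) 0 T < \<epsilon>)"

(* The sigma-algebra on C([0,T], 'a) generated by the evaluations x \<mapsto> x u, 0 \<le> u \<le> t. *)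
definition eval_algebra :: "real \<Rightarrow> real \<Rightarrow> (real \<Rightarrow> 'a::real_normed_vector) measure" where
  "eval_algebra T t = sigma (paths T) {{x \<in> paths T. x u \<in> B} |u B. u \<in> {0..t} \<and> B \<in> sets borel}"

definition adapted ::
    "real \<Rightarrow> ((real \<Rightarrow> 'a::real_normed_vector) \<Rightarrow> (real \<Rightarrow> 'b::real_normed_vector)) \<Rightarrow> bool" where
  "adapted T C \<longleftrightarrow>
     (\<forall>t\<in>{0..T}. \<forall>s\<in>{0..t}. (\<lambda>x. C x s) \<in> measurable (eval_algebra T t) borel)"

definition C_init :: "real \<Rightarrow> ((real \<Rightarrow> real ^ 'n) \<Rightarrow> (real \<Rightarrow> real ^ 'n)) \<Rightarrow> real ^ 'n \<Rightarrow> real ^ 'n" where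
  "C_init T C v = C (const_path T v) 0"

definition C_tilde ::
    "real \<Rightarrow> ((real \<Rightarrow> real ^ 'n) \<Rightarrow> (real \<Rightarrow> real ^ 'n)) \<Rightarrow> (real \<Rightarrow> real ^ 'n) \<Rightarrow> real \<Rightarrow> real ^ 'n" where
  "C_tilde T C x = (\<lambda>t. (THE y. y \<in> paths T \<and> y = (\<lambda>s. x s + C y s)) t - x t)"

(* From here on the index N :: 'n plays the role of the n-th coordinate. *)
definition ell :: "real \<Rightarrow> 'n \<Rightarrow> (real \<Rightarrow> real ^ 'n) \<Rightarrow> real \<Rightarrow> real" where
  "ell T N x = (\<lambda>t. if t \<in> {0..T} then SUP s\<in>{0..t}. max (- (x s $ N)) 0 else 0)"

definition M_map ::
    "real \<Rightarrow> ((real \<Rightarrow> real ^ 'n) \<Rightarrow> (real \<Rightarrow> real ^ 'n)) \<Rightarrow> 'n \<Rightarrow> (real \<Rightarrow> real ^ 'n) \<Rightarrow>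
     (real \<Rightarrow> real) \<Rightarrow> real \<Rightarrow> real" where
  "M_map T C N x \<phi> = ell T N (\<lambda>s. x s + C_tilde T C (\<lambda>r. x r + \<phi> r *\<^sub>R axis N 1) s)"

definition L_tilde ::
    "real \<Rightarrow> ((real \<Rightarrow> real ^ 'n) \<Rightarrow> (real \<Rightarrow> real ^ 'n)) \<Rightarrow> 'n \<Rightarrow> (real \<Rightarrow> real ^ 'n) \<Rightarrow> real \<Rightarrow> real" where
  "L_tilde T C N x = (THE \<phi>. \<phi> \<in> paths T \<and> \<phi> 0 = 0 \<and> M_map T C N x \<phi> = \<phi>)"

definition A_tilde ::
    "real \<Rightarrow> ((real \<Rightarrow> real ^ 'n) \<Rightarrow> (real \<Rightarrow> real ^ 'n)) \<Rightarrow> 'n \<Rightarrow> (real \<Rightarrow> real ^ 'n) \<Rightarrow> real \<Rightarrow> real ^ 'n" where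
  "A_tilde T C N x =
     (\<lambda>t. C_tilde T C (\<lambda>s. x s + L_tilde T C N x s *\<^sub>R axis N 1) t + L_tilde T C N x t *\<^sub>R axis N 1)"

(* \<Phi> is extended by constants beyond [0,T] to obtain its Lebesgue-Stieltjes measure d\<Phi>. *)
definition reflection_term :: "real \<Rightarrow> 'n \<Rightarrow> (real \<Rightarrow> real ^ 'n) \<Rightarrow> (real \<Rightarrow> real) \<Rightarrow> bool" where
  "reflection_term T N Y \<Phi> \<longleftrightarrow>
     (\<forall>t\<in>{0..T}. 0 \<le> Y t \<bullet> axis N 1) \<and>
     \<Phi> \<in> paths T \<and> mono_on {0..T} \<Phi> \<and> \<Phi> 0 = 0 \<and>
     (\<forall>t\<in>{0..T}. \<Phi> t =
        (LINT s:{0..t}|interval_measure (\<lambda>r. \<Phi> (max 0 (min T r))). indicator {0} (Y s $ N)))"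

(* (Y, \<Phi>) solves (P1), and (Z, Z') is the controlled path appearing in the definition. *)
definition P1_solution_via ::
    "real \<Rightarrow> (real \<Rightarrow> real \<Rightarrow> real) \<Rightarrow> real \<Rightarrow> (real \<Rightarrow> real ^ 'd) \<Rightarrow> (real \<Rightarrow> real \<Rightarrow> real ^ 'd ^ 'd) \<Rightarrow>
     (real ^ 'n \<Rightarrow> (real ^ 'd) \<Rightarrow>\<^sub>L (real ^ 'n)) \<Rightarrow> real ^ 'n \<Rightarrow>
     ((real \<Rightarrow> real ^ 'n) \<Rightarrow> (real \<Rightarrow> real ^ 'n)) \<Rightarrow> 'n \<Rightarrow>
     (real \<Rightarrow> real ^ 'n) \<times> (real \<Rightarrow> real) \<Rightarrow>
     (real \<Rightarrow> real ^ 'n) \<times> (real \<Rightarrow> (real ^ 'd) \<Rightarrow>\<^sub>L (real ^ 'n)) \<Rightarrow> bool" where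
  "P1_solution_via T \<omega> \<beta> X XX \<sigma> \<xi> C N = (\<lambda>(Y, \<Phi>) (Z, Z').
     Y \<in> paths T \<and> reflection_term T N Y \<Phi> \<and>
     (Z, Z') \<in> controlled_paths T \<omega> \<beta> X \<and>
     (\<forall>t\<in>{0..T}. Y t = Z t + C Y t + \<Phi> t *\<^sub>R axis N 1) \<and>
     (\<forall>t\<in>{0..T}. Z' t = \<sigma> (Y t)) \<and>
     (\<forall>t\<in>{0..T}. has_rough_integral \<sigma> X XX Z Z' (\<lambda>s. C Y s + \<Phi> s *\<^sub>R axis N 1) 0 t (Z t - \<xi>)))"

definition P1_solutions ::
    "real \<Rightarrow> (real \<Rightarrow> real \<Rightarrow> real) \<Rightarrow> real \<Rightarrow> (real \<Rightarrow> real ^ 'd) \<Rightarrow> (real \<Rightarrow> real \<Rightarrow> real ^ 'd ^ 'd) \<Rightarrow>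
     (real ^ 'n \<Rightarrow> (real ^ 'd) \<Rightarrow>\<^sub>L (real ^ 'n)) \<Rightarrow> real ^ 'n \<Rightarrow>
     ((real \<Rightarrow> real ^ 'n) \<Rightarrow> (real \<Rightarrow> real ^ 'n)) \<Rightarrow> 'n \<Rightarrow>
     ((real \<Rightarrow> real ^ 'n) \<times> (real \<Rightarrow> real)) set" where
  "P1_solutions T \<omega> \<beta> X XX \<sigma> \<xi> C N = {S. \<exists>W. P1_solution_via T \<omega> \<beta> X XX \<sigma> \<xi> C N S W}"

definition P2_solutions ::
    "real \<Rightarrow> (real \<Rightarrow> real \<Rightarrow> real) \<Rightarrow> real \<Rightarrow> (real \<Rightarrow> real ^ 'd) \<Rightarrow> (real \<Rightarrow> real \<Rightarrow> real ^ 'd ^ 'd) \<Rightarrow>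
     (real ^ 'n \<Rightarrow> (real ^ 'd) \<Rightarrow>\<^sub>L (real ^ 'n)) \<Rightarrow> real ^ 'n \<Rightarrow>
     ((real \<Rightarrow> real ^ 'n) \<Rightarrow> (real \<Rightarrow> real ^ 'n)) \<Rightarrow> 'n \<Rightarrow>
     ((real \<Rightarrow> real ^ 'n) \<times> (real \<Rightarrow> (real ^ 'd) \<Rightarrow>\<^sub>L (real ^ 'n))) set" where
  "P2_solutions T \<omega> \<beta> X XX \<sigma> \<xi> C N = {(Z, Z').
     (Z, Z') \<in> controlled_paths T \<omega> \<beta> X \<and>
     (\<forall>t\<in>{0..T}. Z' t = \<sigma> (Z t + A_tilde T C N Z t)) \<and>
     (\<forall>t\<in>{0..T}. has_rough_integral \<sigma> X XX Z Z' (A_tilde T C N Z) 0 t (Z t - \<xi>))}"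

definition P2_to_P1 ::
    "real \<Rightarrow> ((real \<Rightarrow> real ^ 'n) \<Rightarrow> (real \<Rightarrow> real ^ 'n)) \<Rightarrow> 'n \<Rightarrow>
     (real \<Rightarrow> real ^ 'n) \<times> (real \<Rightarrow> (real ^ 'd) \<Rightarrow>\<^sub>L (real ^ 'n)) \<Rightarrow>
     (real \<Rightarrow> real ^ 'n) \<times> (real \<Rightarrow> real)" where
  "P2_to_P1 T C N = (\<lambda>(Z, Z'). (\<lambda>t. Z t + A_tilde T C N Z t, L_tilde T C N Z))"

definition P1_to_P2 ::
    "real \<Rightarrow> (real \<Rightarrow> real \<Rightarrow> real) \<Rightarrow> real \<Rightarrow> (real \<Rightarrow> real ^ 'd) \<Rightarrow> (real \<Rightarrow> real \<Rightarrow> real ^ 'd ^ 'd) \<Rightarrow>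
     (real ^ 'n \<Rightarrow> (real ^ 'd) \<Rightarrow>\<^sub>L (real ^ 'n)) \<Rightarrow> real ^ 'n \<Rightarrow>
     ((real \<Rightarrow> real ^ 'n) \<Rightarrow> (real \<Rightarrow> real ^ 'n)) \<Rightarrow> 'n \<Rightarrow>
     (real \<Rightarrow> real ^ 'n) \<times> (real \<Rightarrow> real) \<Rightarrow>
     (real \<Rightarrow> real ^ 'n) \<times> (real \<Rightarrow> (real ^ 'd) \<Rightarrow>\<^sub>L (real ^ 'n))" where
  "P1_to_P2 T \<omega> \<beta> X XX \<sigma> \<xi> C N S = (THE W. P1_solution_via T \<omega> \<beta> X XX \<sigma> \<xi> C N S W)"

end

theory Submission
  imports Defs "HOL-Complex_Analysis.Great_Picard"
begin

text \<open>
  Equivalence of (P1) and (P2).  By adaptedness and the fixed-point characterisation of \<open>C_tilde\<close>, a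
  solution of (P1) satisfies \<open>C Y = C_tilde (Z + \<Phi> e)\<close>, and the uniqueness in Skorokhod's problem
  identifies \<open>\<Phi>\<close> with the running maximum, hence with \<open>L_tilde Z\<close>.  The Young integral in the germ is
  bounded by the product of a total variation and an oscillation of \<open>X\<close>; it disappears in the mesh limit,
  so \<open>Z\<close> is determined by \<open>Y\<close> and \<open>X\<close>.

  Existence.  The rough norm is absorbed into the control, \<open>w = R powr (1/\<beta>) * \<omega>\<close>.  For the Euler scheme
  (without the Young term) the defect \<open>J s t = Z t - Z s - \<sigma>(Y s) (X t - X s) - G(Y s) XX s t\<close> vanishes on
  single steps, and Davie's induction over the number of steps gives
  \<open>J s t \<le> L w(s,t)^a + L' V(s,t) w(s,t)^\<beta>\<close> with \<open>a > 1\<close> on intervals with \<open>w(s,t) \<le> h\<close>, where \<open>V\<close> is the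
  total variation of \<open>A_tilde Z\<close>, itself bounded by the oscillation of \<open>Z\<close>.  The exponents of the two controls
  add up to more than one, so sums of \<open>J\<close> over subdivisions vanish with the mesh; Arzela-Ascoli gives
  a limit of the Euler paths, which solves (P2).
\<close>

subsection \<open>Paths, subdivisions and total variation\<close>

text \<open>The obstacle: the total variation \<open>V\<close> of \<open>A_tilde Z\<close> is only
  of order \<open>w powr \<beta>\<close>, so the error \<open>V * w powr \<beta>\<close> has order
  \<open>2 * \<beta> \<le> 1\<close> and cannot be summed as a power of \<open>w\<close>. Kept as a
  superadditive function of its own, \<open>V\<close> yields sums bounded by its total mass times
  the largest \<open>w powr \<beta>\<close>, which vanishes with the mesh. The \<open>V\<close> of
  the Euler paths need not converge; uniform bounds on them suffice. The Young term is itself of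
  size \<open>V * w powr \<beta>\<close>, which is why the scheme can omit it. Dependence of the
  constants: besides making \<open>L_tilde\<close> well defined, \<rho>' and \<kappa> enter only
  through \<open>KA\<close>, which serves non-anticipation and convergence of \<open>A_tilde\<close>
  along the Euler paths. The quantitative bounds see the correction only through \<open>CA\<close>,
  built from \<rho>'' and \<kappa>'. Once the rough norm sits in the control, \<open>h\<close>,
  \<open>L\<close> and \<open>L'\<close> depend on \<open>B\<close>, \<theta>, \<beta> and
  \<open>CA\<close> alone. Passing from short to long intervals costs the factor
  \<open>1 + w 0 T / h\<close>; hence the exponents \<open>1 / \<beta>\<close>, 1 and 1.\<close>

lemma paths_continuous:
  "x \<in> paths T \<Longrightarrow> 0 \<le> s \<Longrightarrow> t \<le> T \<Longrightarrow> continuous_on {s..t} x"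
  unfolding paths_def by (auto intro: continuous_on_subset)

lemma paths_outside: "x \<in> paths T \<Longrightarrow> t \<notin> {0..T} \<Longrightarrow> x t = 0"
  unfolding paths_def by auto

lemma paths_add: "x \<in> paths T \<Longrightarrow> y \<in> paths T \<Longrightarrow> (\<lambda>t. x t + y t) \<in> paths T"
  unfolding paths_def by (auto intro: continuous_intros)

lemma paths_diff: "x \<in> paths T \<Longrightarrow> y \<in> paths T \<Longrightarrow> (\<lambda>t. x t - y t) \<in> paths T"
  unfolding paths_def by (auto intro: continuous_intros)

lemma paths_scaleR: "\<phi> \<in> paths T \<Longrightarrow> (\<lambda>t. \<phi> t *\<^sub>R (e :: 'a::real_normed_vector)) \<in> paths T"
  unfolding paths_def by (auto intro!: continuous_intros)

lemma paths_nth: "x \<in> paths T \<Longrightarrow> (\<lambda>t. x t $ N) \<in> paths T"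
  unfolding paths_def by (auto intro!: continuous_intros)

lemma bdd_above_norm_path:
  "continuous_on {s..t::real} x \<Longrightarrow> bdd_above ((\<lambda>u. norm (x u :: 'a::real_normed_vector)) ` {s..t})"
  by (intro compact_imp_bounded[THEN bounded_imp_bdd_above] compact_continuous_image
      continuous_intros) auto

lemma norm_le_sup_norm:
  "continuous_on {s..t} x \<Longrightarrow> u \<in> {s..t} \<Longrightarrow> norm (x u) \<le> sup_norm x s t"
  unfolding sup_norm_def by (rule cSUP_upper) (auto intro: bdd_above_norm_path)

lemma sup_norm_le:
  "s \<le> t \<Longrightarrow> (\<And>u. s \<le> u \<Longrightarrow> u \<le> t \<Longrightarrow> norm (x u) \<le> c) \<Longrightarrow> sup_norm x s t \<le> c"
  unfolding sup_norm_def by (rule cSUP_least) auto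

lemma le_sup_var:
  assumes "continuous_on {s..t} x" "s \<le> u" "u \<le> v" "v \<le> t"
  shows "norm (x v - x u) \<le> sup_var x s t"
proof -
  have "bdd_above ((\<lambda>(u, v). norm (x v - x u)) ` {(u, v). s \<le> u \<and> u \<le> v \<and> v \<le> t})"
  proof (rule bdd_aboveI2)
    fix p assume "p \<in> {(u, v). s \<le> u \<and> u \<le> v \<and> v \<le> t}"
    then obtain u v where p: "p = (u, v)" "s \<le> u" "u \<le> v" "v \<le> t" by auto
    have "norm (x u) \<le> sup_norm x s t" "norm (x v) \<le> sup_norm x s t"
      using p by (auto intro!: norm_le_sup_norm assms)
    then show "(case p of (u, v) \<Rightarrow> norm (x v - x u)) \<le> 2 * sup_norm x s t"
      using norm_triangle_ineq4[of "x v" "x u"] by (simp add: p)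
  qed
  from cSUP_upper[OF _ this, of "(u, v)"] show ?thesis
    using assms by (auto simp: sup_var_def)
qed

lemma sup_var_le:
  assumes "s \<le> t" "\<And>u v. s \<le> u \<Longrightarrow> u \<le> v \<Longrightarrow> v \<le> t \<Longrightarrow> norm (x v - x u) \<le> c"
  shows "sup_var x s t \<le> c"
proof -
  have "(s, s) \<in> {(u, v). s \<le> u \<and> u \<le> v \<and> v \<le> t}" using assms by auto
  then show ?thesis unfolding sup_var_def
    using assms by (intro cSUP_least) auto
qed

lemma sup_var_nonneg: "continuous_on {s..t} x \<Longrightarrow> s \<le> t \<Longrightarrow> 0 \<le> sup_var x s t"
  using le_sup_var[of s t x s s] by simp

lemma subdivision_mono:
  assumes "subdivision s t m p" "i \<le> j" "j \<le> m" shows "p i \<le> p j"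
  using assms(2,3)
proof (induction j rule: dec_induct)
  case (step n)
  then have "p n < p (Suc n)" using assms(1) by (auto simp: subdivision_def)
  then show ?case using step by auto
qed auto

lemma subdivision_range:
  "subdivision s t m p \<Longrightarrow> i \<le> m \<Longrightarrow> s \<le> p i \<and> p i \<le> t"
  using subdivision_mono[of s t m p 0 i] subdivision_mono[of s t m p i m]
  by (auto simp: subdivision_def)

lemma subdivision_le: "subdivision s t m p \<Longrightarrow> s \<le> t"
  using subdivision_range[of s t m p m] by (auto simp: subdivision_def)

lemma subdivision_append:
  assumes "subdivision s u m p" "subdivision u t k q"
  shows "subdivision s t (m + k) (\<lambda>i. if i \<le> m then p i else q (i - m))"
  unfolding subdivision_def
proof (intro conjI allI impI)
  fix i assume "i < m + k"
  show "(if i \<le> m then p i else q (i - m)) < (if Suc i \<le> m then p (Suc i) else q (Suc i - m))"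
  proof (cases "i < m")
    case False
    then have "q (i - m) < q (Suc (i - m))" using assms(2) \<open>i < m + k\<close> by (auto simp: subdivision_def)
    moreover have "i \<le> m \<Longrightarrow> p i = q (i - m)" using False assms by (auto simp: subdivision_def)
    ultimately show ?thesis using False by (auto simp: Suc_diff_le)
  qed (use assms in \<open>auto simp: subdivision_def\<close>)
qed (use assms in \<open>auto simp: subdivision_def\<close>)

lemma subdivision_append_sum:
  assumes "subdivision s u m p" "subdivision u t k q"
  defines "r \<equiv> (\<lambda>i. if i \<le> m then p i else q (i - m))"
  shows "(\<Sum>i<m + k. f (r i) (r (Suc i))) =
    (\<Sum>i<m. f (p i) (p (Suc i))) + (\<Sum>i<k. f (q i) (q (Suc i)) :: 'b::comm_monoid_add)"
proof -
  have "(\<Sum>i<m + k. f (r i) (r (Suc i))) =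
      (\<Sum>i<m. f (r i) (r (Suc i))) + (\<Sum>i<k. f (r (m + i)) (r (Suc (m + i))))"
    by (induction k) (auto simp: add.assoc)
  moreover have "r i = p i" if "i \<le> m" for i using that by (simp add: r_def)
  moreover have "r (m + i) = q i" for i
    using assms(1,2) by (auto simp: r_def subdivision_def)
  ultimately show ?thesis by (simp flip: add_Suc_right)
qed

lemma subdivision_exists:
  assumes "s \<le> t" "0 < \<delta>"
  shows "\<exists>m p. subdivision s t m p \<and> (\<forall>i<m. p (Suc i) - p i < \<delta>)"
proof (cases "s = t")
  case True
  then show ?thesis by (intro exI[of _ 0]) (auto simp: subdivision_def)
next
  case False
  obtain m :: nat where m: "(t - s) / \<delta> < real m" using reals_Archimedean2 by blast
  have "0 < (t - s) / \<delta>" using assms False by simp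
  then have m0: "0 < real m" using m by linarith
  have "(t - s) / real m < \<delta>" using m assms m0 by (simp add: field_simps)
  moreover have "0 < (t - s) / real m" using False assms m0 by simp
  ultimately obtain d where "0 < d" "d < \<delta>" "real m * d = t - s" using m0 by auto
  then show ?thesis
    by (intro exI[of _ m] exI[of _ "\<lambda>i. s + real i * d"]) (auto simp: subdivision_def algebra_simps)
qed

lemma sum_le_total_var:
  "subdivision s t m p \<Longrightarrow>
    (\<Sum>i<m. ennreal (norm (x (p (Suc i)) - x (p i)))) \<le> total_var x s t"
  unfolding total_var_def by (rule SUP_upper2[of "(m, p)"]) auto

lemma total_var_le:
  "(\<And>m p. subdivision s t m p \<Longrightarrow> (\<Sum>i<m. ennreal (norm (x (p (Suc i)) - x (p i)))) \<le> c) \<Longrightarrow>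
    total_var x s t \<le> c"
  unfolding total_var_def by (rule SUP_least) auto

lemma norm_le_total_var:
  assumes "s \<le> t" shows "ennreal (norm (x t - x s)) \<le> total_var x s t"
proof (cases "s = t")
  case False
  then have "subdivision s t 1 (\<lambda>i. if i = 0 then s else t)" using assms by (auto simp: subdivision_def)
  from sum_le_total_var[OF this, of x] show ?thesis by simp
qed simp

lemma total_var_superadditive:
  assumes "s \<le> u" "u \<le> t"
  shows "total_var x s u + total_var x u t \<le> total_var x s t"
proof -
  \<comment> \<open>Both index sets are nonempty; only then do suprema in \<open>ennreal\<close>
    commute with addition.\<close>
  obtain m0 p0 m1 p1 where ne: "subdivision s u m0 p0" "subdivision u t m1 p1"
    using subdivision_exists[OF assms(1), of 1] subdivision_exists[OF assms(2), of 1] by auto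
  define f :: "real \<Rightarrow> real \<Rightarrow> ennreal" where "f = (\<lambda>u v. ennreal (norm (x v - x u)))"
  have tv: "total_var x a b = (SUP (m, p)\<in>{(m, p). subdivision a b m p}. \<Sum>i<m. f (p i) (p (Suc i)))" for a b
    by (simp add: total_var_def f_def)
  have key: "(\<Sum>i<m. f (p i) (p (Suc i))) + (\<Sum>i<k. f (q i) (q (Suc i))) \<le> total_var x s t"
    if "subdivision s u m p" "subdivision u t k q" for m p k q
    using sum_le_total_var[OF subdivision_append[OF that], of x]
      subdivision_append_sum[OF that, of f] by (simp add: f_def)
  have "(\<Sum>i<m. f (p i) (p (Suc i))) + total_var x u t \<le> total_var x s t"
    if "subdivision s u m p" for m p
    unfolding tv[of u t] using ne that
    by (subst ennreal_SUP_add_right) (auto intro!: SUP_least key)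
  then show ?thesis
    unfolding tv[of s u] using ne
    by (subst ennreal_SUP_add_left[symmetric]) (auto intro!: SUP_least)
qed

lemma total_var_add:
  "total_var (\<lambda>t. x t + y t) s t \<le> total_var x s t + total_var y s t"
proof (rule total_var_le)
  fix m p assume p: "subdivision s t m p"
  have "(\<Sum>i<m. ennreal (norm (x (p (Suc i)) + y (p (Suc i)) - (x (p i) + y (p i))))) \<le>
    (\<Sum>i<m. ennreal (norm (x (p (Suc i)) - x (p i))) + ennreal (norm (y (p (Suc i)) - y (p i))))"
    by (intro sum_mono) (simp add: add_diff_add norm_triangle_ineq flip: ennreal_plus)
  also have "\<dots> \<le> total_var x s t + total_var y s t"
    by (subst sum.distrib) (intro add_mono sum_le_total_var p)
  finally show "(\<Sum>i<m. ennreal (norm (x (p (Suc i)) + y (p (Suc i)) - (x (p i) + y (p i)))))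
    \<le> total_var x s t + total_var y s t" .
qed

text \<open>Increments of a monotone function do not cancel, so the sums telescope to the same value
  on every subdivision.\<close>

lemma total_var_mono_scaleR:
  assumes "\<And>u v. s \<le> u \<Longrightarrow> u \<le> v \<Longrightarrow> v \<le> t \<Longrightarrow> \<phi> u \<le> (\<phi> v :: real)"
  shows "total_var (\<lambda>r. \<phi> r *\<^sub>R e) s t \<le> ennreal ((\<phi> t - \<phi> s) * norm e)"
proof (rule total_var_le)
  fix m p assume p: "subdivision s t m p"
  have "ennreal (norm (\<phi> (p (Suc i)) *\<^sub>R e - \<phi> (p i) *\<^sub>R e)) = ennreal ((\<phi> (p (Suc i)) - \<phi> (p i)) * norm e)
      \<and> 0 \<le> (\<phi> (p (Suc i)) - \<phi> (p i)) * norm e" if "i < m" for i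
  proof -
    have "\<phi> (p i) \<le> \<phi> (p (Suc i))"
      using subdivision_range[OF p, of i] subdivision_range[OF p, of "Suc i"]
        subdivision_mono[OF p, of i "Suc i"] that by (auto intro: assms)
    then show ?thesis by (simp flip: scaleR_diff_left)
  qed
  then have "(\<Sum>i<m. ennreal (norm (\<phi> (p (Suc i)) *\<^sub>R e - \<phi> (p i) *\<^sub>R e))) =
      ennreal (\<Sum>i<m. (\<phi> (p (Suc i)) - \<phi> (p i)) * norm e)"
    by (subst sum_ennreal[symmetric]) (auto intro!: sum.cong)
  also have "(\<Sum>i<m. (\<phi> (p (Suc i)) - \<phi> (p i)) * norm e) = (\<phi> t - \<phi> s) * norm e"
    using p by (simp add: sum_lessThan_telescope[of "\<lambda>i. \<phi> (p i)"] subdivision_def flip: sum_distrib_right)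
  finally show "(\<Sum>i<m. ennreal (norm (\<phi> (p (Suc i)) *\<^sub>R e - \<phi> (p i) *\<^sub>R e))) \<le> ennreal ((\<phi> t - \<phi> s) * norm e)"
    by simp
qed

subsection \<open>Superadditive functions of two parameters\<close>

text \<open>A control function without continuity, on an arbitrary interval. It covers the control
  of the rough path and the total variation of a path alike; for the latter continuity is never
  established.\<close>

definition superadditive :: "real \<Rightarrow> real \<Rightarrow> (real \<Rightarrow> real \<Rightarrow> real) \<Rightarrow> bool" where
  "superadditive a b V \<longleftrightarrow> (\<forall>s t. a \<le> s \<and> s \<le> t \<and> t \<le> b \<longrightarrow> 0 \<le> V s t) \<and>
     (\<forall>s u t. a \<le> s \<and> s \<le> u \<and> u \<le> t \<and> t \<le> b \<longrightarrow> V s u + V u t \<le> V s t)"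

lemma superadditiveD:
  assumes "superadditive a b V" "a \<le> s" "s \<le> u" "u \<le> t" "t \<le> b"
  shows "V s u + V u t \<le> V s t" "0 \<le> V s u" "0 \<le> V u t" "V s u \<le> V s t" "V u t \<le> V s t"
proof -
  show *: "V s u + V u t \<le> V s t" "0 \<le> V s u" "0 \<le> V u t"
    using assms unfolding superadditive_def by (auto dest: order_trans)
  show "V s u \<le> V s t" "V u t \<le> V s t" using * by linarith+
qed

lemma superadditive_mono:
  assumes "superadditive a b V" "a \<le> s" "s \<le> u" "u \<le> v" "v \<le> t" "t \<le> b"
  shows "V u v \<le> V s t"
  using superadditiveD(5)[OF assms(1), of s u t] superadditiveD(4)[OF assms(1), of u v t] assms by auto

lemma superadditive_diag:
  assumes "superadditive a b V" "a \<le> s" "s \<le> b" shows "V s s = 0"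
  using superadditiveD[OF assms(1), of s s s] assms by auto

lemma superadditive_subset:
  "superadditive a b V \<Longrightarrow> a \<le> c \<Longrightarrow> d \<le> b \<Longrightarrow> superadditive c d V"
  unfolding superadditive_def by (meson order_trans)

lemma superadditive_sum:
  assumes V: "superadditive a b V" and p: "subdivision s t m p" and "a \<le> s" "t \<le> b"
  shows "(\<Sum>i<m. V (p i) (p (Suc i))) \<le> V s t"
proof -
  have "(\<Sum>i<k. V (p i) (p (Suc i))) \<le> V s (p k)" if "k \<le> m" for k
    using that
  proof (induction k)
    case 0
    have "s \<le> t" using p by (rule subdivision_le)
    then show ?case using superadditive_diag[OF V, of s] p assms(3,4) by (auto simp: subdivision_def)
  next
    case (Suc k)
    have "s \<le> p k" "p k \<le> p (Suc k)" "p (Suc k) \<le> t"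
      using subdivision_range[OF p, of k] subdivision_range[OF p, of "Suc k"]
        subdivision_mono[OF p, of k "Suc k"] Suc.prems by auto
    then show ?case using Suc superadditiveD(1)[OF V, of s "p k" "p (Suc k)"] assms(3,4) by auto
  qed
  from this[of m] show ?thesis using p by (auto simp: subdivision_def)
qed

lemma control_superadditive: "control T \<omega> \<Longrightarrow> superadditive 0 T \<omega>"
  unfolding control_def superadditive_def by auto

text \<open>Finiteness on the whole interval passes to every subinterval by superadditivity in
  \<open>ennreal\<close>; only then is \<open>enn2real\<close> faithful, since it would collapse
  \<infinity> to 0.\<close>

lemma superadditive_total_var:
  assumes "total_var x a b < \<infinity>"
  shows "superadditive a b (\<lambda>s t. enn2real (total_var x s t))"
    "\<And>s t. a \<le> s \<Longrightarrow> s \<le> t \<Longrightarrow> t \<le> b \<Longrightarrow> norm (x t - x s) \<le> enn2real (total_var x s t)"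
proof -
  have fin: "total_var x s t < \<infinity>" if "a \<le> s" "s \<le> t" "t \<le> b" for s t
  proof -
    have "total_var x s t \<le> total_var x a s + total_var x s t" by (simp add: add_increasing)
    also have "\<dots> \<le> total_var x a t" using that by (intro total_var_superadditive) auto
    also have "\<dots> \<le> total_var x a t + total_var x t b" by (simp add: add_increasing2)
    also have "\<dots> \<le> total_var x a b" using that by (intro total_var_superadditive) auto
    finally show ?thesis using assms by (simp add: order_le_less_trans)
  qed
  show "superadditive a b (\<lambda>s t. enn2real (total_var x s t))"
    unfolding superadditive_def
  proof (intro conjI allI impI)
    fix s u t assume *: "a \<le> s \<and> s \<le> u \<and> u \<le> t \<and> t \<le> b"
    then show "enn2real (total_var x s u) + enn2real (total_var x u t) \<le> enn2real (total_var x s t)"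
      using total_var_superadditive[of s u t x] fin[of s u] fin[of u t] fin[of s t]
      by (subst enn2real_plus[symmetric]) (auto intro!: enn2real_mono)
  qed simp
  show "norm (x t - x s) \<le> enn2real (total_var x s t)" if "a \<le> s" "s \<le> t" "t \<le> b" for s t
    using enn2real_mono[OF norm_le_total_var[of s t x]] fin[of s t] that by auto
qed

subsection \<open>Mesh limits and the Young integral\<close>

lemma mesh_limitE:
  assumes "mesh_limit \<Xi> s t I" "0 < e"
  obtains d where "0 < d" "\<And>m p. subdivision s t m p \<Longrightarrow> (\<forall>i<m. p (Suc i) - p i < d) \<Longrightarrow>
        norm ((\<Sum>i<m. \<Xi> (p i) (p (Suc i))) - I) < e"
proof -
  obtain d where "0 < d" and d: "\<forall>m p. subdivision s t m p \<and> (\<forall>i<m. p (Suc i) - p i < d) \<longrightarrow>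
        norm ((\<Sum>i<m. \<Xi> (p i) (p (Suc i))) - I) < e"
    using assms(1)[unfolded mesh_limit_def, rule_format, OF assms(2)] by (elim exE conjE)
  show ?thesis by (rule that[OF \<open>0 < d\<close> d[rule_format]]) auto
qed

text \<open>\<open>s \<le> t\<close> provides a subdivision finer than both thresholds. For
  \<open>t < s\<close> there is no subdivision, and every value would be a limit.\<close>

lemma mesh_limit_unique:
  fixes I J :: "'a::real_normed_vector"
  assumes "mesh_limit \<Xi> s t I" "mesh_limit \<Xi> s t J" "s \<le> t"
  shows "I = J"
proof (rule ccontr)
  assume "I \<noteq> J"
  then have e: "0 < norm (I - J) / 2" by simp
  obtain d1 where d1: "d1 > 0" "\<And>m p. subdivision s t m p \<Longrightarrow> (\<forall>i<m. p (Suc i) - p i < d1) \<Longrightarrow>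
        norm ((\<Sum>i<m. \<Xi> (p i) (p (Suc i))) - I) < norm (I - J) / 2"
    by (rule mesh_limitE[OF assms(1) e]) (rule that)
  obtain d2 where d2: "d2 > 0" "\<And>m p. subdivision s t m p \<Longrightarrow> (\<forall>i<m. p (Suc i) - p i < d2) \<Longrightarrow>
        norm ((\<Sum>i<m. \<Xi> (p i) (p (Suc i))) - J) < norm (I - J) / 2"
    by (rule mesh_limitE[OF assms(2) e]) (rule that)
  obtain m p where p: "subdivision s t m p" "\<forall>i<m. p (Suc i) - p i < min d1 d2"
    using subdivision_exists[OF assms(3), of "min d1 d2"] d1(1) d2(1) by auto
  have "norm ((\<Sum>i<m. \<Xi> (p i) (p (Suc i))) - I) < norm (I - J) / 2"
    by (rule d1(2)) (use p in auto)
  moreover have "norm ((\<Sum>i<m. \<Xi> (p i) (p (Suc i))) - J) < norm (I - J) / 2"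
    by (rule d2(2)) (use p in auto)
  ultimately show False
    using norm_triangle_ineq4[of "(\<Sum>i<m. \<Xi> (p i) (p (Suc i))) - J" "(\<Sum>i<m. \<Xi> (p i) (p (Suc i))) - I"]
    by simp
qed

lemma mesh_limit_add:
  assumes "mesh_limit \<Xi> s t I" "mesh_limit \<Theta> s t J"
  shows "mesh_limit (\<lambda>u v. \<Xi> u v + \<Theta> u v) s t (I + J)"
  unfolding mesh_limit_def
proof (intro allI impI)
  fix e :: real assume "0 < e"
  then have e: "0 < e / 2" by simp
  obtain d1 where d1: "d1 > 0" "\<And>m p. subdivision s t m p \<Longrightarrow> (\<forall>i<m. p (Suc i) - p i < d1) \<Longrightarrow>
        norm ((\<Sum>i<m. \<Xi> (p i) (p (Suc i))) - I) < e / 2"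
    by (rule mesh_limitE[OF assms(1) e]) (rule that)
  obtain d2 where d2: "d2 > 0" "\<And>m p. subdivision s t m p \<Longrightarrow> (\<forall>i<m. p (Suc i) - p i < d2) \<Longrightarrow>
        norm ((\<Sum>i<m. \<Theta> (p i) (p (Suc i))) - J) < e / 2"
    by (rule mesh_limitE[OF assms(2) e]) (rule that)
  show "\<exists>\<delta>>0. \<forall>m p. subdivision s t m p \<and> (\<forall>i<m. p (Suc i) - p i < \<delta>) \<longrightarrow>
      norm ((\<Sum>i<m. \<Xi> (p i) (p (Suc i)) + \<Theta> (p i) (p (Suc i))) - (I + J)) < e"
  proof (intro exI[of _ "min d1 d2"] conjI allI impI)
    fix m p assume p: "subdivision s t m p \<and> (\<forall>i<m. p (Suc i) - p i < min d1 d2)"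
    have I: "norm ((\<Sum>i<m. \<Xi> (p i) (p (Suc i))) - I) < e / 2"
      by (rule d1(2)) (use p in auto)
    have J: "norm ((\<Sum>i<m. \<Theta> (p i) (p (Suc i))) - J) < e / 2"
      by (rule d2(2)) (use p in auto)
    from norm_add_less[OF I J] have
      "norm ((\<Sum>i<m. \<Xi> (p i) (p (Suc i)) + \<Theta> (p i) (p (Suc i))) - (I + J)) < e / 2 + e / 2"
      by (simp only: sum.distrib add_diff_add)
    then show "norm ((\<Sum>i<m. \<Xi> (p i) (p (Suc i)) + \<Theta> (p i) (p (Suc i))) - (I + J)) < e" by simp
  qed (use d1 d2 in auto)
qed

lemma mesh_limit_norm_le:
  assumes "mesh_limit \<Xi> s t I" "s \<le> t"
    and "\<And>m p. subdivision s t m p \<Longrightarrow> norm (\<Sum>i<m. \<Xi> (p i) (p (Suc i))) \<le> c"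
  shows "norm I \<le> c"
proof (rule field_le_epsilon)
  fix e :: real assume "0 < e"
  obtain d where d: "d > 0" "\<And>m p. subdivision s t m p \<Longrightarrow> (\<forall>i<m. p (Suc i) - p i < d) \<Longrightarrow>
        norm ((\<Sum>i<m. \<Xi> (p i) (p (Suc i))) - I) < e"
    by (rule mesh_limitE[OF assms(1) \<open>0 < e\<close>]) (rule that)
  obtain m p where p: "subdivision s t m p" "\<forall>i<m. p (Suc i) - p i < d"
    using subdivision_exists[OF assms(2) d(1)] by auto
  show "norm I \<le> c + e"
    using d(2)[OF p] assms(3)[OF p(1)] norm_triangle_ineq3[of "\<Sum>i<m. \<Xi> (p i) (p (Suc i))" I] by linarith
qed

text \<open>Sums along one sequence of subdivisions with mesh below \<open>1 / (n + 1)\<close>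
  converge by completeness, and any fine sum is compared with a member of this sequence. The
  elimination rule \<open>cauchyE\<close> stands for: every \<epsilon> has a \<delta> such that any
  two subdivisions finer than \<delta> have sums within \<epsilon>.\<close>

lemma mesh_limit_Cauchy:
  fixes \<Xi> :: "real \<Rightarrow> real \<Rightarrow> 'a::banach"
  assumes "s \<le> t" and cauchyE: "\<And>\<epsilon> thesis. 0 < \<epsilon> \<Longrightarrow>
      (\<And>\<delta>. 0 < \<delta> \<Longrightarrow> (\<And>m p k q. subdivision s t m p \<Longrightarrow> subdivision s t k q \<Longrightarrow>
      (\<forall>i<m. p (Suc i) - p i < \<delta>) \<Longrightarrow> (\<forall>i<k. q (Suc i) - q i < \<delta>) \<Longrightarrow>
      norm ((\<Sum>i<m. \<Xi> (p i) (p (Suc i))) - (\<Sum>i<k. \<Xi> (q i) (q (Suc i)))) \<le> \<epsilon>) \<Longrightarrow> thesis) \<Longrightarrow> thesis"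
  shows "\<exists>I. mesh_limit \<Xi> s t I"
proof -
  have "\<exists>mp. subdivision s t (fst mp) (snd mp) \<and>
      (\<forall>i<fst mp. snd mp (Suc i) - snd mp i < inverse (real (Suc n)))" for n
    using subdivision_exists[OF assms(1), of "inverse (real (Suc n))"] by auto
  then have "\<exists>mp. \<forall>n. subdivision s t (fst (mp n)) (snd (mp n)) \<and>
      (\<forall>i<fst (mp n). snd (mp n) (Suc i) - snd (mp n) i < inverse (real (Suc n)))"
    by (intro choice allI)
  then obtain mp where mp: "\<forall>n. subdivision s t (fst (mp n)) (snd (mp n)) \<and>
      (\<forall>i<fst (mp n). snd (mp n) (Suc i) - snd (mp n) i < inverse (real (Suc n)))" ..
  define M P where "M = fst \<circ> mp" and "P = snd \<circ> mp"
  have P: "subdivision s t (M n) (P n)" "i < M n \<Longrightarrow> P n (Suc i) - P n i < inverse (real (Suc n))" for n i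
    using mp by (auto simp: M_def P_def)
  define S where "S n = (\<Sum>i<M n. \<Xi> (P n i) (P n (Suc i)))" for n
  have fine: "\<exists>n0. \<forall>n\<ge>n0. \<forall>i<M n. P n (Suc i) - P n i < d" if "d > 0" for d
  proof -
    obtain n0 where n0: "inverse (real (Suc n0)) < d" using reals_Archimedean[OF \<open>d > 0\<close>] by blast
    have "P n (Suc i) - P n i < d" if "n0 \<le> n" "i < M n" for n i
    proof -
      have "inverse (real (Suc n)) \<le> inverse (real (Suc n0))" using that by (intro le_imp_inverse_le) auto
      then show ?thesis using P(2)[OF that(2)] n0 by linarith
    qed
    then show ?thesis by blast
  qed
  have "Cauchy S"
  proof (rule CauchyI)
    fix e :: real assume "0 < e"
    obtain d where d: "d > 0" "\<And>m p k q. subdivision s t m p \<Longrightarrow> subdivision s t k q \<Longrightarrow>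
      (\<forall>i<m. p (Suc i) - p i < d) \<Longrightarrow> (\<forall>i<k. q (Suc i) - q i < d) \<Longrightarrow>
      norm ((\<Sum>i<m. \<Xi> (p i) (p (Suc i))) - (\<Sum>i<k. \<Xi> (q i) (q (Suc i)))) \<le> e / 2"
      by (rule cauchyE[OF half_gt_zero[OF \<open>0 < e\<close>]]) (rule that)
    from fine[OF d(1)] obtain n0 where n0: "\<forall>n\<ge>n0. \<forall>i<M n. P n (Suc i) - P n i < d" by blast
    have *: "norm (S m - S n) \<le> e / 2" if "m \<ge> n0" "n \<ge> n0" for m n
      unfolding S_def by (rule d(2)[OF P(1) P(1)]) (use that n0 in blast)+
    then show "\<exists>M. \<forall>m\<ge>M. \<forall>n\<ge>M. norm (S m - S n) < e"
    proof (intro exI[of _ n0] allI impI)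
      fix m n assume "n0 \<le> m" "n0 \<le> n"
      with * have "norm (S m - S n) \<le> e / 2" .
      then show "norm (S m - S n) < e" using \<open>0 < e\<close> by linarith
    qed
  qed
  then obtain I where I: "S \<longlonglongrightarrow> I" using Cauchy_convergent convergent_def by blast
  have "mesh_limit \<Xi> s t I"
    unfolding mesh_limit_def
  proof (intro allI impI)
    fix e :: real assume "0 < e"
    obtain d where d: "d > 0" "\<And>m p k q. subdivision s t m p \<Longrightarrow> subdivision s t k q \<Longrightarrow>
      (\<forall>i<m. p (Suc i) - p i < d) \<Longrightarrow> (\<forall>i<k. q (Suc i) - q i < d) \<Longrightarrow>
      norm ((\<Sum>i<m. \<Xi> (p i) (p (Suc i))) - (\<Sum>i<k. \<Xi> (q i) (q (Suc i)))) \<le> e / 2"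
      by (rule cauchyE[OF half_gt_zero[OF \<open>0 < e\<close>]]) (rule that)
    from fine[OF d(1)] obtain n0 where n0: "\<forall>n\<ge>n0. \<forall>i<M n. P n (Suc i) - P n i < d" by blast
    show "\<exists>\<delta>>0. \<forall>m p. subdivision s t m p \<and> (\<forall>i<m. p (Suc i) - p i < \<delta>) \<longrightarrow>
        norm ((\<Sum>i<m. \<Xi> (p i) (p (Suc i))) - I) < e"
    proof (intro exI[of _ d] conjI allI impI)
      fix m p assume p: "subdivision s t m p \<and> (\<forall>i<m. p (Suc i) - p i < d)"
      have "(\<lambda>n. norm ((\<Sum>i<m. \<Xi> (p i) (p (Suc i))) - S n)) \<longlonglongrightarrow> norm ((\<Sum>i<m. \<Xi> (p i) (p (Suc i))) - I)"
        by (intro tendsto_intros I)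
      moreover have "norm ((\<Sum>i<m. \<Xi> (p i) (p (Suc i))) - S n) \<le> e / 2" if "n0 \<le> n" for n
        unfolding S_def by (rule d(2)[OF _ P(1)]) (use p n0 that in blast)+
      ultimately have "norm ((\<Sum>i<m. \<Xi> (p i) (p (Suc i))) - I) \<le> e / 2"
        by (intro Lim_bounded[of _ _ n0]) blast+
      then show "norm ((\<Sum>i<m. \<Xi> (p i) (p (Suc i))) - I) < e" using \<open>0 < e\<close> by simp
    qed (rule d(1))
  qed
  then show ?thesis by blast
qed

text \<open>Both sums are Stieltjes sums with respect to \<open>\<Psi>\<close>.  Moving the common right end point to the
  larger of the two last interior points reduces the total number of intervals.\<close>

lemma stieltjes_sums_close:
  fixes \<Psi> :: "real \<Rightarrow> 'a::real_normed_vector" and B :: "'a \<Rightarrow> 'b::real_normed_vector \<Rightarrow> 'c::real_normed_vector"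
  assumes B: "bounded_bilinear B" "\<And>a b. norm (B a b) \<le> norm a * norm b" and "0 \<le> \<epsilon>"
  assumes "superadditive a b V" "\<And>u v. a \<le> u \<Longrightarrow> u \<le> v \<Longrightarrow> v \<le> b \<Longrightarrow> norm (\<Psi> v - \<Psi> u) \<le> V u v"
    and "a \<le> s" "t \<le> b" "subdivision s t m p" "subdivision s t k q"
    and "\<And>i j. i < m \<Longrightarrow> j < k \<Longrightarrow> p i < q (Suc j) \<Longrightarrow> q j < p (Suc i) \<Longrightarrow> norm (\<tau> i - \<upsilon> j) \<le> \<epsilon>"
  shows "norm ((\<Sum>i<m. B (\<Psi> (p (Suc i)) - \<Psi> (p i)) (\<tau> i)) - (\<Sum>j<k. B (\<Psi> (q (Suc j)) - \<Psi> (q j)) (\<upsilon> j)))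
    \<le> V s t * \<epsilon>"
  using assms(7-10)
proof (induction "m + k" arbitrary: m k p q \<tau> \<upsilon> t rule: less_induct)
  case (less m k p q \<tau> \<upsilon> t)
  interpret B: bounded_bilinear B by (rule B(1))
  note V = assms(4)
  show ?case
  proof (cases "m = 0 \<or> k = 0")
    case True
    have "m = 0 \<and> k = 0"
    proof -
      have "s < t" if "subdivision s t n r" "n \<noteq> 0" for n r
        using that subdivision_mono[OF that(1), of 1 n] by (auto simp: subdivision_def gr0_conv_Suc)
      moreover have "s = t" using True less.prems(2,3) by (auto simp: subdivision_def)
      ultimately show ?thesis using less.prems(2,3) by blast
    qed
    then show ?thesis using less.prems superadditiveD(2)[OF V, of s t t] assms(3,6) subdivision_le[OF less.prems(2)] by simp
  next
    case False
    \<comment> \<open>The case in which the last point of \<open>p\<close> before \<open>t\<close>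
      is at most that of \<open>q\<close>. The other case exchanges the two sums, so the claim is
      stated for arbitrary data, with a bound \<open>l\<close> on \<open>m + k\<close> and the
      induction hypothesis as a premise.\<close>
    have step: "norm ((\<Sum>i<m. B (\<Psi> (p (Suc i)) - \<Psi> (p i)) (\<tau> i)) - (\<Sum>j<k. B (\<Psi> (q (Suc j)) - \<Psi> (q j)) (\<upsilon> j)))
      \<le> V s t * \<epsilon>"
      if mk: "m = Suc m'" "k = Suc k'" and le: "p m' \<le> q k'" and small: "m + k \<le> l"
       and IH: "\<And>m k t p q \<tau> \<upsilon>. m + k < l \<Longrightarrow> t \<le> b \<Longrightarrow> subdivision s t m p \<Longrightarrow> subdivision s t k q \<Longrightarrow>
          (\<And>i j. i < m \<Longrightarrow> j < k \<Longrightarrow> p i < q (Suc j) \<Longrightarrow> q j < p (Suc i) \<Longrightarrow> norm (\<tau> i - \<upsilon> j) \<le> \<epsilon>) \<Longrightarrow>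
          norm ((\<Sum>i<m. B (\<Psi> (p (Suc i)) - \<Psi> (p i)) (\<tau> i)) - (\<Sum>j<k. B (\<Psi> (q (Suc j)) - \<Psi> (q j)) (\<upsilon> j)))
          \<le> V s t * \<epsilon>"
       and pre: "subdivision s t m p" "subdivision s t k q"
         "\<And>i j. i < m \<Longrightarrow> j < k \<Longrightarrow> p i < q (Suc j) \<Longrightarrow> q j < p (Suc i) \<Longrightarrow> norm (\<tau> i - \<upsilon> j) \<le> \<epsilon>"
      for l m' k' m k p q \<tau> \<upsilon>
    proof -
      define r where "r = q k'"
      have t: "p (Suc m') = t" "q (Suc k') = t" "r < t" "p m' < t" "s \<le> r"
        using pre mk subdivision_range[OF pre(2), of k'] by (auto simp: subdivision_def r_def)
      have last: "norm (\<tau> m' - \<upsilon> k') \<le> \<epsilon>" using pre(3)[of m' k'] mk t le by (auto simp: r_def)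
      have q': "subdivision s r k' q" using pre(2) mk by (auto simp: subdivision_def r_def)
      \<comment> \<open>Cut \<open>p\<close> at \<open>r\<close>: its last cell disappears if
        \<open>p m' = r\<close> and is shortened otherwise. Both sums then carry the same increment
        \<open>\<Psi> t - \<Psi> r\<close> on \<open>[r,t]\<close>, with tags of overlapping cells,
        while \<open>q\<close> loses a cell, so the induction applies on
        \<open>[s,r]\<close>.\<close>
      have "\<exists>n p'. subdivision s r n p' \<and> n \<le> m \<and> (\<forall>i<n. p' i = p i \<and> p' (Suc i) \<le> p (Suc i)) \<and>
        (\<Sum>i<m. B (\<Psi> (p (Suc i)) - \<Psi> (p i)) (\<tau> i)) =
        (\<Sum>i<n. B (\<Psi> (p' (Suc i)) - \<Psi> (p' i)) (\<tau> i)) + B (\<Psi> t - \<Psi> r) (\<tau> m')"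
      proof (cases "p m' = r")
        case True
        have "subdivision s r m' p" using pre(1) mk True by (simp add: subdivision_def)
        moreover have "(\<Sum>i<m. B (\<Psi> (p (Suc i)) - \<Psi> (p i)) (\<tau> i)) =
          (\<Sum>i<m'. B (\<Psi> (p (Suc i)) - \<Psi> (p i)) (\<tau> i)) + B (\<Psi> t - \<Psi> r) (\<tau> m')"
          using mk t True by simp
        ultimately show ?thesis using mk by (intro exI[of _ m'] exI[of _ p]) simp
      next
        case False
        have "(\<Sum>i<m. B (\<Psi> (p (Suc i)) - \<Psi> (p i)) (\<tau> i)) =
          (\<Sum>i<m'. B (\<Psi> (p (Suc i)) - \<Psi> (p i)) (\<tau> i)) + B (\<Psi> r - \<Psi> (p m')) (\<tau> m') + B (\<Psi> t - \<Psi> r) (\<tau> m')"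
          using mk t by (simp add: B.diff_left)
        moreover have "subdivision s r m (p(Suc m' := r))"
          using pre(1) mk le False unfolding subdivision_def r_def[symmetric] by (simp add: less_Suc_eq)
        moreover have "(p(Suc m' := r)) i = p i \<and> (p(Suc m' := r)) (Suc i) \<le> p (Suc i)" if "i < m" for i
          using that mk t by simp
        moreover have "(\<Sum>i<m'. B (\<Psi> ((p(Suc m' := r)) (Suc i)) - \<Psi> ((p(Suc m' := r)) i)) (\<tau> i)) =
          (\<Sum>i<m'. B (\<Psi> (p (Suc i)) - \<Psi> (p i)) (\<tau> i))"
          by (intro sum.cong) auto
        ultimately show ?thesis using mk
          by (intro exI[of _ m] exI[of _ "p(Suc m' := r)"]) simp
      qed
      then obtain n p' where p': "subdivision s r n p'" "n \<le> m" "\<forall>i<n. p' i = p i \<and> p' (Suc i) \<le> p (Suc i)"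
        "(\<Sum>i<m. B (\<Psi> (p (Suc i)) - \<Psi> (p i)) (\<tau> i)) =
        (\<Sum>i<n. B (\<Psi> (p' (Suc i)) - \<Psi> (p' i)) (\<tau> i)) + B (\<Psi> t - \<Psi> r) (\<tau> m')"
        by (elim exE conjE) (rule that)
      have ih: "norm ((\<Sum>i<n. B (\<Psi> (p' (Suc i)) - \<Psi> (p' i)) (\<tau> i)) - (\<Sum>j<k'. B (\<Psi> (q (Suc j)) - \<Psi> (q j)) (\<upsilon> j)))
          \<le> V s r * \<epsilon>"
      proof (rule IH[OF _ _ p'(1) q'])
        show "n + k' < l" using p'(2) small mk by auto
        show "r \<le> b" using t less.prems by auto
        fix i j assume "i < n" "j < k'" "p' i < q (Suc j)" "q j < p' (Suc i)"
        then show "norm (\<tau> i - \<upsilon> j) \<le> \<epsilon>" using p'(2) p'(3)[rule_format, of i] mk by (intro pre(3)) auto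
      qed
      have "norm (B (\<Psi> t - \<Psi> r) (\<tau> m') - B (\<Psi> t - \<Psi> r) (\<upsilon> k')) \<le> norm (\<Psi> t - \<Psi> r) * norm (\<tau> m' - \<upsilon> k')"
        using B(2)[of "\<Psi> t - \<Psi> r" "\<tau> m' - \<upsilon> k'"] by (simp add: B.diff_right)
      also have "\<dots> \<le> V r t * \<epsilon>"
        using t less.prems(1) assms(6) superadditiveD(3)[OF V, of r r t] by (intro mult_mono assms(5) last) auto
      finally have b: "norm (B (\<Psi> t - \<Psi> r) (\<tau> m') - B (\<Psi> t - \<Psi> r) (\<upsilon> k')) \<le> V r t * \<epsilon>" .
      have "(\<Sum>i<m. B (\<Psi> (p (Suc i)) - \<Psi> (p i)) (\<tau> i)) - (\<Sum>j<k. B (\<Psi> (q (Suc j)) - \<Psi> (q j)) (\<upsilon> j)) =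
        ((\<Sum>i<n. B (\<Psi> (p' (Suc i)) - \<Psi> (p' i)) (\<tau> i)) - (\<Sum>j<k'. B (\<Psi> (q (Suc j)) - \<Psi> (q j)) (\<upsilon> j))) +
        (B (\<Psi> t - \<Psi> r) (\<tau> m') - B (\<Psi> t - \<Psi> r) (\<upsilon> k'))"
        unfolding p'(4) using mk t by (simp add: r_def)
      also have "norm \<dots> \<le> V s r * \<epsilon> + V r t * \<epsilon>"
        by (rule norm_triangle_mono[OF ih b])
      also have "\<dots> \<le> V s t * \<epsilon>"
        using superadditiveD(1)[OF V, of s r t] t less.prems(1) assms(3,6)
        by (simp add: mult_right_mono flip: distrib_right)
      finally show ?thesis .
    qed
    obtain m' k' where mk: "m = Suc m'" "k = Suc k'" using False by (metis not0_implies_Suc)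
    have IH: "norm ((\<Sum>i<m'. B (\<Psi> (p (Suc i)) - \<Psi> (p i)) (\<tau> i)) - (\<Sum>j<k'. B (\<Psi> (q (Suc j)) - \<Psi> (q j)) (\<upsilon> j)))
          \<le> V s t * \<epsilon>"
      if "m' + k' < m + k" "t \<le> b" "subdivision s t m' p" "subdivision s t k' q"
        "\<And>i j. i < m' \<Longrightarrow> j < k' \<Longrightarrow> p i < q (Suc j) \<Longrightarrow> q j < p (Suc i) \<Longrightarrow> norm (\<tau> i - \<upsilon> j) \<le> \<epsilon>"
      for m' k' t p q \<tau> \<upsilon>
      using that by (rule less.hyps)
    show ?thesis
    proof (cases "p m' \<le> q k'")
      case True
      show ?thesis
        by (rule step[OF mk True order_refl IH less.prems(2-4)])
    next
      case F: False
      have "norm ((\<Sum>j<k. B (\<Psi> (q (Suc j)) - \<Psi> (q j)) (\<upsilon> j)) - (\<Sum>i<m. B (\<Psi> (p (Suc i)) - \<Psi> (p i)) (\<tau> i)))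
        \<le> V s t * \<epsilon>"
      proof (rule step[OF mk(2) mk(1) _ _ IH less.prems(3) less.prems(2)])
        show "q k' \<le> p m'" using F by simp
        show "k + m \<le> m + k" by simp
        show "norm (\<upsilon> i - \<tau> j) \<le> \<epsilon>" if "i < k" "j < m" "q i < p (Suc j)" "p j < q (Suc i)" for i j
          using less.prems(4)[of j i] that by (simp add: norm_minus_commute)
      qed
      then show ?thesis by (subst norm_minus_commute)
    qed
  qed
qed

section \<open>Tensors as matrices with the Frobenius norm\<close>

lemma norm_tensor: "norm (tensor a b) = norm a * norm b"
proof -
  have "norm (tensor a b $ i) = \<bar>a $ i\<bar> * norm b" for i
  proof -
    have "tensor a b $ i = a $ i *\<^sub>R b" by (simp add: tensor_def vec_eq_iff)
    then show ?thesis by simp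
  qed
  then have "norm (tensor a b) = L2_set (\<lambda>i. \<bar>a $ i\<bar> * norm b) UNIV" by (simp add: norm_vec_def)
  also have "\<dots> = L2_set (\<lambda>i. \<bar>a $ i\<bar>) UNIV * norm b" by (simp add: L2_set_left_distrib)
  finally show ?thesis by (simp add: norm_vec_def)
qed

lemma bounded_bilinear_tensor: "bounded_bilinear tensor"
proof
  show "\<exists>K. \<forall>a b. norm (tensor a b) \<le> norm a * norm b * K"
    by (intro exI[of _ 1]) (simp add: norm_tensor)
qed (auto simp: tensor_def vec_eq_iff algebra_simps)

interpretation tensor: bounded_bilinear tensor by (rule bounded_bilinear_tensor)

lemma tensor_app_zero: "tensor_app B 0 = 0"
  by (simp add: tensor_app_def)

lemma tensor_app_add: "tensor_app B (M + M') = tensor_app B M + tensor_app B M'"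
  by (simp add: tensor_app_def scaleR_add_left sum.distrib)

lemma tensor_app_diff: "tensor_app B (M - M') = tensor_app B M - tensor_app B M'"
  by (simp add: tensor_app_def scaleR_diff_left sum_subtractf)

lemma tensor_app_diff_left:
  "tensor_app (\<lambda>a b. B a b - B' a b) M = tensor_app B M - tensor_app B' M"
  by (simp add: tensor_app_def scaleR_diff_right sum_subtractf)

lemma norm_tensor_app_le:
  fixes M :: "real ^ 'b ^ 'a"
  assumes "\<And>i j. norm (B (axis i 1) (axis j 1)) \<le> c"
  shows "norm (tensor_app B M) \<le> real (CARD('a) * CARD('b)) * c * norm M"
proof -
  have "norm (tensor_app B M) \<le> (\<Sum>i\<in>(UNIV::'a set). \<Sum>j\<in>(UNIV::'b set). norm M * c)"
    unfolding tensor_app_def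
  proof (intro sum_norm_le)
    fix i j
    have "\<bar>M $ i $ j\<bar> \<le> norm M"
      using Finite_Cartesian_Product.norm_nth_le[of "M $ i" j] Finite_Cartesian_Product.norm_nth_le[of M i] by simp
    then show "norm ((M $ i $ j) *\<^sub>R B (axis i 1) (axis j 1)) \<le> norm M * c"
      using assms[of i j] by (simp add: mult_mono)
  qed
  then show ?thesis by (simp add: algebra_simps)
qed

lemma tensor_app_tensor:
  assumes "bounded_bilinear B" shows "tensor_app B (tensor a b) = B a b"
proof -
  interpret bounded_bilinear B by fact
  have "B a b = B (\<Sum>i\<in>UNIV. a $ i *\<^sub>R axis i 1) (\<Sum>j\<in>UNIV. b $ j *\<^sub>R axis j 1)"
    using basis_expansion[of a] basis_expansion[of b] by (simp add: scalar_mult_eq_scaleR)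
  then show ?thesis
    unfolding tensor_app_def tensor_def
    by (subst sum.swap) (simp add: sum_left sum_right scaleR_left scaleR_right scaleR_sum_right mult.commute)
qed

text \<open>Abel summation. It trades the increments of \<open>X\<close>, which may have infinite
  variation, for those of \<open>\<Psi>\<close>, leaving only oscillations of \<open>X\<close> as
  weights.\<close>

lemma young_sum_by_parts:
  "(\<Sum>i<m. tensor (\<Psi> (p i) - \<Psi> (p 0)) (X (p (Suc i)) - X (p i))) =
   (\<Sum>i<m. tensor (\<Psi> (p (Suc i)) - \<Psi> (p i)) (X (p m) - X (p (Suc i))))"
proof (induction m)
  case (Suc m)
  have "(\<Sum>i<Suc m. tensor (\<Psi> (p (Suc i)) - \<Psi> (p i)) (X (p (Suc m)) - X (p (Suc i)))) =
    (\<Sum>i<m. tensor (\<Psi> (p (Suc i)) - \<Psi> (p i)) ((X (p m) - X (p (Suc i))) + (X (p (Suc m)) - X (p m))))"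
    by (simp add: tensor.zero_right)
  also have "\<dots> = (\<Sum>i<m. tensor (\<Psi> (p (Suc i)) - \<Psi> (p i)) (X (p m) - X (p (Suc i)))) +
    tensor (\<Sum>i<m. \<Psi> (p (Suc i)) - \<Psi> (p i)) (X (p (Suc m)) - X (p m))"
    by (simp only: tensor.add_right sum.distrib tensor.sum_left)
  finally show ?case using Suc by (simp add: sum_lessThan_telescope[of "\<lambda>i. \<Psi> (p i)"])
qed simp

lemma uniformly_small_increments:
  fixes x :: "real \<Rightarrow> 'a::real_normed_vector"
  assumes "continuous_on {s..t} x" "0 < e"
  obtains d where "0 < d" "\<And>u v. s \<le> u \<Longrightarrow> u \<le> t \<Longrightarrow> s \<le> v \<Longrightarrow> v \<le> t \<Longrightarrow> \<bar>u - v\<bar> < d \<Longrightarrow> norm (x u - x v) < e"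
proof -
  have "uniformly_continuous_on {s..t} x"
    using assms(1) by (rule compact_uniformly_continuous) auto
  then obtain d where "0 < d" "\<forall>u\<in>{s..t}. \<forall>v\<in>{s..t}. dist v u < d \<longrightarrow> dist (x v) (x u) < e"
    using assms(2) unfolding uniformly_continuous_on_def by fastforce
  then show ?thesis by (intro that[of d]) (auto simp: dist_norm)
qed

text \<open>After summation by parts these are Stieltjes sums with the integrator
  \<open>\<Psi>\<close> of bounded variation and the integrand \<open>X t - X\<close>, for which
  continuity of \<open>X\<close> suffices.\<close>

lemma young_integral_exists:
  fixes \<Psi> :: "real \<Rightarrow> real ^ 'n" and X :: "real \<Rightarrow> real ^ 'd"
  assumes V: "superadditive s t V" "\<And>u v. s \<le> u \<Longrightarrow> u \<le> v \<Longrightarrow> v \<le> t \<Longrightarrow> norm (\<Psi> v - \<Psi> u) \<le> V u v"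
    and X: "continuous_on {s..t} X" and "s \<le> t"
  shows "\<exists>I. mesh_limit (\<lambda>u v. tensor (\<Psi> u - \<Psi> s) (X v - X u)) s t I"
proof (rule mesh_limit_Cauchy[OF \<open>s \<le> t\<close>])
  fix e :: real and thesis
  assume "0 < e" and that: "(\<And>\<delta>. 0 < \<delta> \<Longrightarrow> (\<And>m p k q. subdivision s t m p \<Longrightarrow> subdivision s t k q \<Longrightarrow>
      \<forall>i<m. p (Suc i) - p i < \<delta> \<Longrightarrow> \<forall>i<k. q (Suc i) - q i < \<delta> \<Longrightarrow>
      norm ((\<Sum>i<m. tensor (\<Psi> (p i) - \<Psi> s) (X (p (Suc i)) - X (p i))) -
            (\<Sum>i<k. tensor (\<Psi> (q i) - \<Psi> s) (X (q (Suc i)) - X (q i)))) \<le> e) \<Longrightarrow> thesis)"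
  have V0: "0 \<le> V s t" using superadditiveD(2)[OF V(1), of s t t] \<open>s \<le> t\<close> by simp
  define e' where "e' = e / (1 + V s t)"
  have e': "0 < e'" "V s t * e' \<le> e" using V0 \<open>0 < e\<close> by (auto simp: e'_def field_simps)
  obtain d where d: "0 < d" "\<And>u v. s \<le> u \<Longrightarrow> u \<le> t \<Longrightarrow> s \<le> v \<Longrightarrow> v \<le> t \<Longrightarrow> \<bar>u - v\<bar> < d \<Longrightarrow> norm (X u - X v) < e'"
    by (rule uniformly_small_increments[OF X e'(1)]) (rule that)
  show thesis
  proof (rule that[OF d(1)])
    fix m p k q
    assume p: "subdivision s t m p" and q: "subdivision s t k q"
      and mp: "\<forall>i<m. p (Suc i) - p i < d" and mq: "\<forall>i<k. q (Suc i) - q i < d"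
    have eq: "(\<Sum>i<m. tensor (\<Psi> (p i) - \<Psi> s) (X (p (Suc i)) - X (p i))) =
      (\<Sum>i<m. tensor (\<Psi> (p (Suc i)) - \<Psi> (p i)) (X t - X (p (Suc i))))" if "subdivision s t m p" for m p
      using young_sum_by_parts[of \<Psi> p X m] that by (simp add: subdivision_def)
    have "norm ((\<Sum>i<m. tensor (\<Psi> (p (Suc i)) - \<Psi> (p i)) (X t - X (p (Suc i)))) -
            (\<Sum>i<k. tensor (\<Psi> (q (Suc i)) - \<Psi> (q i)) (X t - X (q (Suc i))))) \<le> V s t * e'"
    proof (rule stieltjes_sums_close[OF bounded_bilinear_tensor _ _ V _ _ p q])
      fix i j assume ij: "i < m" "j < k" "p i < q (Suc j)" "q j < p (Suc i)"
      \<comment> \<open>The right end points of two overlapping cells are closer than the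
        mesh.\<close>
      have "norm (X (q (Suc j)) - X (p (Suc i))) < e'"
      proof (rule d(2))
        show "\<bar>q (Suc j) - p (Suc i)\<bar> < d" using ij mp[rule_format, of i] mq[rule_format, of j] by linarith
      qed (use subdivision_range[OF p, of "Suc i"] subdivision_range[OF q, of "Suc j"] ij in auto)
      then show "norm (X t - X (p (Suc i)) - (X t - X (q (Suc j)))) \<le> e'" by simp
    qed (use e' in \<open>auto simp: norm_tensor\<close>)
    then show "norm ((\<Sum>i<m. tensor (\<Psi> (p i) - \<Psi> s) (X (p (Suc i)) - X (p i))) -
            (\<Sum>i<k. tensor (\<Psi> (q i) - \<Psi> s) (X (q (Suc i)) - X (q i)))) \<le> e"
      using e'(2) by (simp only: eq[OF p] eq[OF q])
  qed
qed

text \<open>Summation by parts weighs each increment of \<open>\<Psi>\<close> with an increment of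
  \<open>X\<close> that ends at \<open>t\<close>; superadditivity of \<open>V\<close> then bounds
  every sum, hence the limit.\<close>

lemma norm_young_integral_le:
  fixes \<Psi> :: "real \<Rightarrow> real ^ 'n" and X :: "real \<Rightarrow> real ^ 'd"
  assumes V: "superadditive s t V" "\<And>u v. s \<le> u \<Longrightarrow> u \<le> v \<Longrightarrow> v \<le> t \<Longrightarrow> norm (\<Psi> v - \<Psi> u) \<le> V u v"
    and X: "continuous_on {s..t} X" and "s \<le> t"
    and small: "\<And>r. s \<le> r \<Longrightarrow> r \<le> t \<Longrightarrow> norm (X t - X r) \<le> \<epsilon>"
  shows "norm (young_integral \<Psi> X s t) \<le> V s t * \<epsilon>"
proof -
  obtain I where I: "mesh_limit (\<lambda>u v. tensor (\<Psi> u - \<Psi> s) (X v - X u)) s t I"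
    using young_integral_exists[OF V X \<open>s \<le> t\<close>] ..
  then have "young_integral \<Psi> X s t = I"
    unfolding young_integral_def by (rule the_equality) (rule mesh_limit_unique[OF _ I \<open>s \<le> t\<close>])
  moreover have "norm I \<le> V s t * \<epsilon>"
  proof (rule mesh_limit_norm_le[OF I \<open>s \<le> t\<close>])
    fix m p assume p: "subdivision s t m p"
    have "0 \<le> \<epsilon>" using small[of t] \<open>s \<le> t\<close> by simp
    have "(\<Sum>i<m. tensor (\<Psi> (p i) - \<Psi> s) (X (p (Suc i)) - X (p i))) =
      (\<Sum>i<m. tensor (\<Psi> (p (Suc i)) - \<Psi> (p i)) (X t - X (p (Suc i))))"
      using young_sum_by_parts[of \<Psi> p X m] p by (simp add: subdivision_def)
    also have "norm \<dots> \<le> (\<Sum>i<m. V (p i) (p (Suc i)) * \<epsilon>)"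
    proof (rule sum_norm_le)
      fix i assume "i \<in> {..<m}"
      then have "s \<le> p i" "p i \<le> p (Suc i)" "s \<le> p (Suc i)" "p (Suc i) \<le> t"
        using subdivision_range[OF p, of i] subdivision_range[OF p, of "Suc i"] subdivision_mono[OF p, of i "Suc i"]
        by auto
      then show "norm (tensor (\<Psi> (p (Suc i)) - \<Psi> (p i)) (X t - X (p (Suc i)))) \<le> V (p i) (p (Suc i)) * \<epsilon>"
        unfolding norm_tensor using superadditiveD(2)[OF V(1), of "p i" "p (Suc i)" "p (Suc i)"]
        by (intro mult_mono V(2) small) auto
    qed
    also have "\<dots> \<le> V s t * \<epsilon>"
      unfolding sum_distrib_right[symmetric] using \<open>0 \<le> \<epsilon>\<close> superadditive_sum[OF V(1) p]
      by (intro mult_right_mono) auto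
    finally show "norm (\<Sum>i<m. tensor (\<Psi> (p i) - \<Psi> s) (X (p (Suc i)) - X (p i))) \<le> V s t * \<epsilon>" .
  qed
  ultimately show ?thesis by simp
qed

text \<open>The sum over a subdivision is at most the total variation of \<open>\<Psi>\<close> times the oscillation of \<open>X\<close> at the scale of the mesh.\<close>

lemma mesh_limit_young_germ:
  fixes \<Psi> :: "real \<Rightarrow> real ^ 'n" and X :: "real \<Rightarrow> real ^ 'd" and \<Xi> :: "real \<Rightarrow> real \<Rightarrow> 'a::real_normed_vector"
  assumes V: "superadditive s t V" "\<And>u v. s \<le> u \<Longrightarrow> u \<le> v \<Longrightarrow> v \<le> t \<Longrightarrow> norm (\<Psi> v - \<Psi> u) \<le> V u v"
    and X: "continuous_on {s..t} X" and "s \<le> t" and "0 \<le> c"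
    and dom: "\<And>u v. s \<le> u \<Longrightarrow> u \<le> v \<Longrightarrow> v \<le> t \<Longrightarrow> norm (\<Xi> u v) \<le> c * norm (young_integral \<Psi> X u v)"
  shows "mesh_limit \<Xi> s t 0"
  unfolding mesh_limit_def
proof (intro allI impI)
  fix e :: real assume "0 < e"
  have V0: "0 \<le> V s t" using superadditiveD(2)[OF V(1), of s t t] \<open>s \<le> t\<close> by simp
  define e' where "e' = e / (1 + c * V s t)"
  have "0 \<le> c * V s t" using V0 \<open>0 \<le> c\<close> by simp
  then have e': "0 < e'" "c * V s t * e' < e" using \<open>0 < e\<close> by (auto simp: e'_def field_simps add_pos_nonneg)
  obtain d where d: "0 < d" "\<And>u v. s \<le> u \<Longrightarrow> u \<le> t \<Longrightarrow> s \<le> v \<Longrightarrow> v \<le> t \<Longrightarrow> \<bar>u - v\<bar> < d \<Longrightarrow> norm (X u - X v) < e'"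
    by (rule uniformly_small_increments[OF X e'(1)]) (rule that)
  show "\<exists>\<delta>>0. \<forall>m p. subdivision s t m p \<and> (\<forall>i<m. p (Suc i) - p i < \<delta>) \<longrightarrow>
      norm ((\<Sum>i<m. \<Xi> (p i) (p (Suc i))) - 0) < e"
  proof (intro exI[of _ d] conjI allI impI)
    fix m p assume p: "subdivision s t m p \<and> (\<forall>i<m. p (Suc i) - p i < d)"
    have "norm (\<Sum>i<m. \<Xi> (p i) (p (Suc i))) \<le> (\<Sum>i<m. c * (V (p i) (p (Suc i)) * e'))"
    proof (rule sum_norm_le)
      fix i assume "i \<in> {..<m}"
      then have i: "s \<le> p i" "p i \<le> p (Suc i)" "s \<le> p (Suc i)" "p (Suc i) \<le> t" "p (Suc i) - p i < d"
        using subdivision_range[of s t m p i] subdivision_range[of s t m p "Suc i"]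
          subdivision_mono[of s t m p i "Suc i"] p by auto
      have "norm (young_integral \<Psi> X (p i) (p (Suc i))) \<le> V (p i) (p (Suc i)) * e'"
      proof (rule norm_young_integral_le)
        show "superadditive (p i) (p (Suc i)) V" using i by (intro superadditive_subset[OF V(1)])
        show "norm (X (p (Suc i)) - X r) \<le> e'" if "p i \<le> r" "r \<le> p (Suc i)" for r
          by (rule less_imp_le, rule d(2)) (use i that in auto)
      qed (use i in \<open>auto intro!: V(2) continuous_on_subset[OF X]\<close>)
      then show "norm (\<Xi> (p i) (p (Suc i))) \<le> c * (V (p i) (p (Suc i)) * e')"
        using \<open>0 \<le> c\<close> i by (intro order_trans[OF dom] mult_left_mono) auto
    qed
    also have "\<dots> = c * (\<Sum>i<m. V (p i) (p (Suc i))) * e'"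
      by (simp add: sum_distrib_left sum_distrib_right algebra_simps)
    also have "\<dots> \<le> c * V s t * e'"
      using superadditive_sum[OF V(1)] p e' \<open>0 \<le> c\<close> by (intro mult_right_mono mult_left_mono) auto
    finally show "norm ((\<Sum>i<m. \<Xi> (p i) (p (Suc i))) - 0) < e" using e' by simp
  qed (rule d)
qed

subsection \<open>Hoelder norms\<close>

text \<open>The infimum ranges over strictly positive constants, so \<open>c\<close> itself need not
  belong to the set; \<open>c + e\<close> does for every \<open>e > 0\<close>.\<close>

lemma holder2_le:
  assumes "0 \<le> c" "\<And>u v. 0 \<le> u \<Longrightarrow> u \<le> v \<Longrightarrow> v \<le> T \<Longrightarrow> norm (f u v) \<le> c * \<omega> u v powr \<theta>"
  shows "holder2 T \<omega> \<theta> f \<le> ennreal c"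
proof (rule ennreal_le_epsilon)
  fix e :: real assume "0 < e"
  have "norm (f u v) \<le> (c + e) * \<omega> u v powr \<theta>" if "0 \<le> u" "u \<le> v" "v \<le> T" for u v
    using assms(2)[OF that] \<open>0 < e\<close> by (smt (verit) mult_right_mono powr_ge_zero)
  then have "holder2 T \<omega> \<theta> f \<le> ennreal (c + e)"
    unfolding holder2_def using assms(1) \<open>0 < e\<close> by (intro Inf_lower) (auto intro!: exI[of _ "c + e"])
  then show "holder2 T \<omega> \<theta> f \<le> ennreal c + ennreal e" using assms(1) \<open>0 < e\<close> by (simp add: ennreal_plus)
qed

lemma holder_le:
  assumes "0 \<le> c" "\<And>u v. 0 \<le> u \<Longrightarrow> u \<le> v \<Longrightarrow> v \<le> T \<Longrightarrow> norm (x v - x u) \<le> c * \<omega> u v powr \<theta>"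
  shows "holder T \<omega> \<theta> x \<le> ennreal c"
  unfolding holder_def by (intro holder2_le assms)

lemma var_holder_le:
  assumes "0 \<le> c" "\<And>u v. 0 \<le> u \<Longrightarrow> u \<le> v \<Longrightarrow> v \<le> T \<Longrightarrow> total_var x u v \<le> ennreal (c * \<omega> u v powr \<theta>)"
  shows "var_holder T \<omega> \<theta> x \<le> ennreal c"
proof (rule ennreal_le_epsilon)
  fix e :: real assume "0 < e"
  have "total_var x u v \<le> ennreal ((c + e) * \<omega> u v powr \<theta>)" if "0 \<le> u" "u \<le> v" "v \<le> T" for u v
    using \<open>0 < e\<close> by (intro order_trans[OF assms(2)[OF that]] ennreal_leI mult_right_mono) auto
  then have "var_holder T \<omega> \<theta> x \<le> ennreal (c + e)"
    unfolding var_holder_def using assms(1) \<open>0 < e\<close> by (intro Inf_lower) (auto intro!: exI[of _ "c + e"])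
  then show "var_holder T \<omega> \<theta> x \<le> ennreal c + ennreal e" using assms(1) \<open>0 < e\<close> by (simp add: ennreal_plus)
qed

text \<open>A finite infimum is itself an admissible bound: admissible constants come within
  \<open>e'\<close> of it, and dividing by \<open>1 + w\<close> keeps \<open>e' * w \<le> e\<close>
  without a case distinction on \<open>w\<close>.\<close>

lemma norm_le_holder2:
  assumes "holder2 T \<omega> \<theta> f < \<infinity>" "0 \<le> u" "u \<le> v" "v \<le> T"
  shows "norm (f u v) \<le> enn2real (holder2 T \<omega> \<theta> f) * \<omega> u v powr \<theta>"
proof (rule field_le_epsilon)
  fix e :: real assume "0 < e"
  define h where "h = enn2real (holder2 T \<omega> \<theta> f)"
  define w where "w = \<omega> u v powr \<theta>"
  have "0 \<le> w" by (simp add: w_def)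
  define e' where "e' = e / (1 + w)"
  have e': "0 < e'" "e' * w \<le> e" using \<open>0 < e\<close> \<open>0 \<le> w\<close> by (auto simp: e'_def field_simps)
  have "holder2 T \<omega> \<theta> f = ennreal h" using assms(1) by (simp add: h_def)
  then have "holder2 T \<omega> \<theta> f < ennreal (h + e')"
    using e' enn2real_nonneg[of "holder2 T \<omega> \<theta> f"] unfolding h_def[symmetric]
    by (simp only:) (simp add: ennreal_less_iff)
  then obtain c where c: "0 < c" "ennreal c < ennreal (h + e')"
    "\<forall>u v. 0 \<le> u \<and> u \<le> v \<and> v \<le> T \<longrightarrow> norm (f u v) \<le> c * \<omega> u v powr \<theta>"
    unfolding holder2_def Inf_less_iff by auto
  have "c \<le> h + e'" using c by (simp add: ennreal_less_iff)
  have "norm (f u v) \<le> c * w" using c(3) assms by (auto simp: w_def)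
  also have "\<dots> \<le> (h + e') * w" using \<open>c \<le> h + e'\<close> \<open>0 \<le> w\<close> by (rule mult_right_mono)
  also have "\<dots> \<le> h * w + e" using e' by (simp add: algebra_simps)
  finally show "norm (f u v) \<le> enn2real (holder2 T \<omega> \<theta> f) * \<omega> u v powr \<theta> + e" by (simp add: h_def w_def)
qed

text \<open>A control vanishes on the diagonal by superadditivity and is uniformly continuous on the
  compact triangle.\<close>

lemma control_uniformly_small:
  assumes "control T \<omega>" "0 < e"
  obtains d where "0 < d" "\<And>u v. 0 \<le> u \<Longrightarrow> u \<le> v \<Longrightarrow> v \<le> T \<Longrightarrow> v - u < d \<Longrightarrow> \<omega> u v < e"
proof -
  let ?D = "{(s, t). 0 \<le> s \<and> s \<le> t \<and> t \<le> T}"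
  have D: "?D = ({0..T} \<times> {0..T}) \<inter> {z. fst z \<le> snd z}" by auto
  have "compact ?D" unfolding D
    by (intro compact_Int_closed compact_Times closed_Collect_le continuous_intros) auto
  then have "uniformly_continuous_on ?D (\<lambda>(s, t). \<omega> s t)"
    using assms(1) by (intro compact_uniformly_continuous) (auto simp: control_def)
  then obtain d where d: "0 < d" "\<forall>x\<in>?D. \<forall>y\<in>?D. dist y x < d \<longrightarrow>
      dist ((\<lambda>(s, t). \<omega> s t) y) ((\<lambda>(s, t). \<omega> s t) x) < e"
    using assms(2) unfolding uniformly_continuous_on_def by meson
  show ?thesis
  proof (rule that[OF d(1)])
    fix u v assume *: "0 \<le> u" "u \<le> v" "v \<le> T" "v - u < d"
    then have "dist (u, v) (u, u) < d" by (simp add: dist_Pair_Pair dist_real_def)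
    from d(2)[rule_format, OF _ _ this] have "dist (\<omega> u v) (\<omega> u u) < e" using * by simp
    moreover have "\<omega> u u = 0" using superadditive_diag[OF control_superadditive[OF assms(1)], of u] * by simp
    ultimately show "\<omega> u v < e" by (simp add: dist_real_def)
  qed
qed

section \<open>Fixed points in the space of paths\<close>

lemma paths_eqI:
  "x \<in> paths T \<Longrightarrow> y \<in> paths T \<Longrightarrow> (\<And>t. 0 \<le> t \<Longrightarrow> t \<le> T \<Longrightarrow> x t = y t) \<Longrightarrow> x = y"
  by (rule ext) (metis atLeastAtMost_iff paths_outside)

text \<open>The paths form a set, whereas \<open>banach_fix_type\<close> works on a complete metric
  type. \<open>P\<close> cuts a bounded continuous function on the line down to a path,
  \<open>E\<close> extends a path by its end values, and \<open>E (F (P f))\<close> is a contraction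
  in \<open>f\<close> for the sup metric.\<close>

lemma paths_Banach_fix:
  fixes F :: "(real \<Rightarrow> 'a) \<Rightarrow> (real \<Rightarrow> 'a::banach)"
  assumes T: "0 \<le> T" and \<kappa>: "0 \<le> \<kappa>" "\<kappa> < 1" and F: "\<And>\<phi>. \<phi> \<in> paths T \<Longrightarrow> F \<phi> \<in> paths T"
    and contr: "\<And>\<phi> \<psi> c u. \<phi> \<in> paths T \<Longrightarrow> \<psi> \<in> paths T \<Longrightarrow>
      (\<And>u. 0 \<le> u \<Longrightarrow> u \<le> T \<Longrightarrow> norm (\<phi> u - \<psi> u) \<le> c) \<Longrightarrow> 0 \<le> u \<Longrightarrow> u \<le> T \<Longrightarrow> norm (F \<phi> u - F \<psi> u) \<le> \<kappa> * c"
  shows "\<exists>!\<phi>. \<phi> \<in> paths T \<and> F \<phi> = \<phi>"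
proof -
  define P where "P f = (\<lambda>t. if t \<in> {0..T} then apply_bcontfun f t else (0::'a))" for f :: "real \<Rightarrow>\<^sub>C 'a"
  define clampT where "clampT t = max 0 (min T t)" for t :: real
  have cl: "clampT t \<in> {0..T}" "t \<in> {0..T} \<Longrightarrow> clampT t = t" for t using T by (auto simp: clampT_def)
  have P: "P f \<in> paths T" for f
    unfolding P_def paths_def by (auto intro!: continuous_on_eq[OF continuous_on_apply_bcontfun[of "{0..T}" f]])
  have bc: "(\<lambda>t. h (clampT t)) \<in> bcontfun" if "h \<in> paths T" for h :: "real \<Rightarrow> 'a"
  proof (rule bcontfun_normI)
    have h: "continuous_on {0..T} h" using paths_continuous[OF that, of 0 T] by simp
    show "continuous_on UNIV (\<lambda>t. h (clampT t))"
      by (rule continuous_on_compose2[OF h]) (auto simp: clampT_def T intro!: continuous_intros)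
    show "norm (h (clampT t)) \<le> sup_norm h 0 T" for t by (rule norm_le_sup_norm[OF h cl(1)])
  qed
  define E where "E h = Bcontfun (\<lambda>t. h (clampT t))" for h :: "real \<Rightarrow> 'a"
  have E: "apply_bcontfun (E h) t = h (clampT t)" if "h \<in> paths T" for h t
    unfolding E_def using Bcontfun_inverse[OF bc[OF that]] by simp
  have "\<exists>!f. E (F (P f)) = f"
  proof (rule banach_fix_type[OF \<kappa>], intro allI)
    fix f g :: "real \<Rightarrow>\<^sub>C 'a"
    show "dist (E (F (P f))) (E (F (P g))) \<le> \<kappa> * dist f g"
    proof (rule dist_bound)
      fix t
      have "norm (F (P f) (clampT t) - F (P g) (clampT t)) \<le> \<kappa> * dist f g"
        using cl(1)[of t] by (intro contr P) (auto simp: P_def dist_bounded simp flip: dist_norm)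
      then show "dist (E (F (P f)) t) (E (F (P g)) t) \<le> \<kappa> * dist f g"
        by (simp add: E F P dist_norm)
    qed
  qed
  then obtain f where f: "E (F (P f)) = f" by auto
  have "F (P f) t = P f t" if "0 \<le> t" "t \<le> T" for t
  proof -
    have "P f t = apply_bcontfun (E (F (P f))) t" using that f by (simp add: P_def)
    also have "\<dots> = F (P f) t" using that by (simp add: E F P cl)
    finally show ?thesis by simp
  qed
  then have fix1: "F (P f) = P f" by (intro paths_eqI[of _ T] F P)
  have "\<phi> = P f" if "\<phi> \<in> paths T" "F \<phi> = \<phi>" for \<phi>
  proof -
    let ?c = "sup_norm (\<lambda>u. \<phi> u - P f u) 0 T"
    have c: "norm (\<phi> u - P f u) \<le> ?c" if "0 \<le> u" "u \<le> T" for u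
      using paths_continuous[OF paths_diff[OF \<open>\<phi> \<in> paths T\<close> P], of 0 T] that
      by (intro norm_le_sup_norm[of 0 T "\<lambda>u. \<phi> u - P f u"]) auto
    have "?c \<le> \<kappa> * ?c"
      using contr[OF that(1) P c] that(2) fix1 T by (intro sup_norm_le) auto
    then have "?c * (1 - \<kappa>) \<le> 0" by (simp add: algebra_simps)
    then have "?c \<le> 0" using \<kappa> by (simp add: mult_le_0_iff)
    then have "\<phi> u = P f u" if "0 \<le> u" "u \<le> T" for u using order_trans[OF c[OF that] \<open>?c \<le> 0\<close>] by simp
    then show ?thesis by (intro paths_eqI[OF that(1) P])
  qed
  then show ?thesis using fix1 P by (intro ex1I[of _ "P f"]) auto
qed

subsection \<open>The running maximum and the Skorokhod problem\<close>

lemma ell_upper: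
  assumes x: "continuous_on {0..T} (\<lambda>s. x s $ N)" and "0 \<le> s" "s \<le> t" "t \<le> T"
  shows "max (- (x s $ N)) 0 \<le> ell T N x t"
proof -
  have "continuous_on {0..t} (\<lambda>s. max (- (x s $ N)) 0)"
    by (intro continuous_intros continuous_on_subset[OF x]) (use assms in auto)
  then have "bdd_above ((\<lambda>s. max (- (x s $ N)) 0) ` {0..t})"
    by (intro bounded_imp_bdd_above compact_imp_bounded compact_continuous_image) auto
  then have "max (- (x s $ N)) 0 \<le> (SUP s\<in>{0..t}. max (- (x s $ N)) 0)"
    by (rule cSUP_upper2[OF _ _ order_refl]) (use assms in auto)
  then show ?thesis using assms by (simp add: ell_def)
qed

lemma ell_least:
  assumes "0 \<le> t" "t \<le> T" "\<And>s. 0 \<le> s \<Longrightarrow> s \<le> t \<Longrightarrow> max (- (x s $ N)) 0 \<le> c"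
  shows "ell T N x t \<le> c"
  unfolding ell_def using assms by (auto intro!: cSUP_least)

lemma ell_zero: "0 \<le> T \<Longrightarrow> ell T N x 0 = max (- (x 0 $ N)) 0"
  by (simp add: ell_def)

lemma ell_mono:
  assumes x: "continuous_on {0..T} (\<lambda>s. x s $ N)" and "0 \<le> s" "s \<le> t" "t \<le> T"
  shows "ell T N x s \<le> ell T N x t"
proof (rule ell_least)
  fix r assume "0 \<le> r" "r \<le> s"
  then show "max (- (x r $ N)) 0 \<le> ell T N x t" using assms by (intro ell_upper[OF x]) auto
qed (use assms in auto)

lemma ell_nonneg:
  assumes x: "continuous_on {0..T} (\<lambda>s. x s $ N)" and "0 \<le> t" "t \<le> T"
  shows "0 \<le> ell T N x t"
  using ell_upper[OF x, of 0 t] assms by auto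

text \<open>If the running maximum grows after \<open>s\<close>, its new value is
  \<open>- (x r $ N)\<close> for some \<open>r\<close> in \<open>[s,t]\<close>, which exceeds
  \<open>- (x s $ N)\<close>, and hence \<open>ell T N x s\<close>, by at most
  \<open>c\<close>.\<close>

lemma ell_increment:
  assumes x: "continuous_on {0..T} (\<lambda>s. x s $ N)" and "0 \<le> s" "s \<le> t" "t \<le> T"
    and c: "\<And>u. s \<le> u \<Longrightarrow> u \<le> t \<Longrightarrow> x s $ N - x u $ N \<le> c"
  shows "ell T N x t - ell T N x s \<le> c"
proof -
  have "0 \<le> c" using c[of s] assms by simp
  have "ell T N x t \<le> ell T N x s + c"
  proof (rule ell_least)
    fix r assume r: "0 \<le> r" "r \<le> t"
    have *: "max (- (x r $ N)) 0 \<le> ell T N x s" if "r \<le> s"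
      using that r assms by (intro ell_upper[OF x]) auto
    have "max (- (x s $ N)) 0 \<le> ell T N x s" using assms by (intro ell_upper[OF x]) auto
    then show "max (- (x r $ N)) 0 \<le> ell T N x s + c"
      using * c[of r] \<open>0 \<le> c\<close> r by (cases "r \<le> s") auto
  qed (use assms in auto)
  then show ?thesis by simp
qed

lemma ell_diff:
  assumes x: "continuous_on {0..T} (\<lambda>s. x s $ N)" and y: "continuous_on {0..T} (\<lambda>s. y s $ N)"
    and "0 \<le> t" "t \<le> T" and c: "\<And>u. 0 \<le> u \<Longrightarrow> u \<le> t \<Longrightarrow> \<bar>x u $ N - y u $ N\<bar> \<le> c"
  shows "\<bar>ell T N x t - ell T N y t\<bar> \<le> c"
proof -
  have "ell T N x t \<le> ell T N y t + c" if x: "continuous_on {0..T} (\<lambda>s. x s $ N)"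
    and y: "continuous_on {0..T} (\<lambda>s. y s $ N)" and c: "\<And>u. 0 \<le> u \<Longrightarrow> u \<le> t \<Longrightarrow> \<bar>x u $ N - y u $ N\<bar> \<le> c"
    for x y :: "real \<Rightarrow> real ^ 'a"
  proof (rule ell_least)
    fix s assume "0 \<le> s" "s \<le> t"
    then show "max (- (x s $ N)) 0 \<le> ell T N y t + c"
      using ell_upper[OF y, of s t] c[of s] assms(4) by (auto simp: max_def split: if_splits)
  qed (use assms in auto)
  from this[OF x y c] this[OF y x] c show ?thesis by (simp add: abs_le_iff abs_minus_commute)
qed

lemma ell_path:
  assumes "0 \<le> T" and x: "continuous_on {0..T} (\<lambda>s. x s $ N)"
  shows "ell T N x \<in> paths T"
  unfolding paths_def
proof (intro CollectI conjI allI impI)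
  show "continuous_on {0..T} (ell T N x)"
    unfolding continuous_on_iff
  proof (intro ballI allI impI)
    fix t e :: real assume t: "t \<in> {0..T}" and "0 < e"
    obtain d where d: "0 < d" "\<And>u v. 0 \<le> u \<Longrightarrow> u \<le> T \<Longrightarrow> 0 \<le> v \<Longrightarrow> v \<le> T \<Longrightarrow> \<bar>u - v\<bar> < d \<Longrightarrow> norm (x u $ N - x v $ N) < e / 2"
      by (rule uniformly_small_increments[OF x half_gt_zero[OF \<open>0 < e\<close>]]) (rule that)
    have *: "ell T N x v - ell T N x u \<le> e / 2" if "0 \<le> u" "u \<le> v" "v \<le> T" "v - u < d" for u v
    proof (rule ell_increment[OF x that(1-3)])
      fix r assume "u \<le> r" "r \<le> v"
      then have "norm (x u $ N - x r $ N) < e / 2" using that by (intro d(2)) auto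
      then show "x u $ N - x r $ N \<le> e / 2" unfolding real_norm_def abs_less_iff by linarith
    qed
    show "\<exists>d>0. \<forall>s\<in>{0..T}. dist s t < d \<longrightarrow> dist (ell T N x s) (ell T N x t) < e"
    proof (intro exI[of _ d] conjI ballI impI d(1))
      fix s assume s: "s \<in> {0..T}" "dist s t < d"
      then show "dist (ell T N x s) (ell T N x t) < e"
        using *[of s t] *[of t s] ell_mono[OF x, of s t] ell_mono[OF x, of t s] t \<open>0 < e\<close>
        by (cases "s \<le> t") (auto simp: dist_real_def)
    qed
  qed
qed (auto simp: ell_def)

text \<open>The regulator is constant while the reflected coordinate is positive: near
  \<open>s\<close> the candidates \<open>- (x r $ N)\<close> stay below the value already
  attained.\<close>

lemma ell_flat:
  assumes x: "continuous_on {0..T} (\<lambda>s. x s $ N)" and s: "0 \<le> s" "s \<le> T" and pos: "0 < x s $ N + ell T N x s"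
  obtains d where "0 < d" "\<And>u v. 0 \<le> u \<Longrightarrow> u \<le> v \<Longrightarrow> v \<le> T \<Longrightarrow> \<bar>u - s\<bar> < d \<Longrightarrow> \<bar>v - s\<bar> < d \<Longrightarrow> ell T N x u = ell T N x v"
proof -
  \<comment> \<open>Half of the gap is reserved for the variation of \<open>x\<close>, half for that
    of \<open>ell\<close>.\<close>
  define e where "e = (x s $ N + ell T N x s) / 2"
  have "0 < e" using pos by (simp add: e_def)
  obtain d1 where d1: "0 < d1" "\<And>u v. 0 \<le> u \<Longrightarrow> u \<le> T \<Longrightarrow> 0 \<le> v \<Longrightarrow> v \<le> T \<Longrightarrow> \<bar>u - v\<bar> < d1 \<Longrightarrow> norm (x u $ N - x v $ N) < e"
    by (rule uniformly_small_increments[OF x \<open>0 < e\<close>]) (rule that)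
  have "continuous_on {0..T} (ell T N x)" using ell_path[OF _ x] s by (auto simp: paths_def)
  from this \<open>0 < e\<close> obtain d2 where d2: "0 < d2" "\<And>u v. 0 \<le> u \<Longrightarrow> u \<le> T \<Longrightarrow> 0 \<le> v \<Longrightarrow> v \<le> T \<Longrightarrow> \<bar>u - v\<bar> < d2 \<Longrightarrow> norm (ell T N x u - ell T N x v) < e"
    by (rule uniformly_small_increments) (rule that)
  show ?thesis
  proof (rule that[of "min d1 d2"])
    fix u v assume uv: "0 \<le> u" "u \<le> v" "v \<le> T" "\<bar>u - s\<bar> < min d1 d2" "\<bar>v - s\<bar> < min d1 d2"
    have "ell T N x v \<le> ell T N x u"
    proof (rule ell_least)
      fix r assume r: "0 \<le> r" "r \<le> v"
      show "max (- (x r $ N)) 0 \<le> ell T N x u"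
      proof (cases "r \<le> u")
        case True
        then show ?thesis using r uv by (intro ell_upper[OF x]) auto
      next
        case False
        then have "norm (x r $ N - x s $ N) < e" "norm (ell T N x u - ell T N x s) < e"
          using d1(2)[of r s] d2(2)[of u s] uv r s by auto
        moreover have "0 \<le> ell T N x u" using ell_nonneg[OF x, of u] uv by simp
        moreover have "2 * e = x s $ N + ell T N x s" by (simp add: e_def)
        ultimately show ?thesis unfolding real_norm_def abs_less_iff by linarith
      qed
    qed (use uv in auto)
    moreover have "ell T N x u \<le> ell T N x v" using uv by (intro ell_mono[OF x]) auto
    ultimately show "ell T N x u = ell T N x v" by simp
  qed (use d1 d2 in auto)
qed

lemma LINT_zero_set:
  assumes Y: "continuous_on {0..t} (\<lambda>s. Y s $ N)"
  shows "(LINT s:{0..t}|interval_measure F. indicator {0} (Y s $ N)) =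
    measure (interval_measure F) {s \<in> {0..t}. Y s $ N = 0}"
proof -
  have eq: "(\<lambda>s. indicator {0..t} s *\<^sub>R indicator {0} (Y s $ N)) = (indicator {s \<in> {0..t}. Y s $ N = 0} :: real \<Rightarrow> real)"
    by (auto simp: fun_eq_iff indicator_def)
  show ?thesis
    unfolding set_lebesgue_integral_def eq by simp
qed

text \<open>Existence in the Skorokhod problem. \<open>ell\<close> is locally constant where the
  coordinate is positive, so countably many intervals with rational end points, each of measure
  zero, cover that set. All of the mass \<open>ell T N x t\<close> of \<open>[0,t]\<close> therefore
  lies on the zeros of the coordinate.\<close>

lemma ell_reflection_term:
  assumes T: "0 \<le> T" and x: "continuous_on {0..T} (\<lambda>s. x s $ N)" and "0 \<le> x 0 $ N"
    and Y: "\<And>t. 0 \<le> t \<Longrightarrow> t \<le> T \<Longrightarrow> Y t $ N = x t $ N + ell T N x t"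
  shows "reflection_term T N Y (ell T N x)"
  unfolding reflection_term_def
proof (intro conjI ballI)
  note p = ell_path[OF T x]
  show p': "ell T N x \<in> paths T" by (rule p)
  show "mono_on {0..T} (ell T N x)" by (intro mono_onI ell_mono[OF x]) auto
  show l0: "ell T N x 0 = 0" using assms by (simp add: ell_zero)
  fix t assume t: "t \<in> {0..T}"
  show "0 \<le> Y t \<bullet> axis N 1"
    using ell_upper[OF x, of t t] t by (auto simp: Y inner_axis)
  define F where "F r = ell T N x (max 0 (min T r))" for r
  have monoF: "F a \<le> F b" if "a \<le> b" for a b
    unfolding F_def using that T by (intro ell_mono[OF x]) auto
  have contF: "continuous_on UNIV F"
    unfolding F_def by (rule continuous_on_compose2[OF paths_continuous[OF p, of 0 T]]) (auto simp: T intro!: continuous_intros)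
  define \<mu> where "\<mu> = interval_measure F"
  \<comment> \<open>Continuity of \<open>F\<close> rules out atoms, so closed intervals carry
    exactly the increment of \<open>F\<close>.\<close>
  have Icc: "emeasure \<mu> {a..b} = ennreal (F b - F a)" if "a \<le> b" for a b
    unfolding \<mu>_def using that monoF contF by (rule emeasure_interval_measure_Icc)
  have sets: "sets \<mu> = sets borel" by (simp add: \<mu>_def)
  have contY: "continuous_on {0..t} (\<lambda>s. Y s $ N)"
    by (rule continuous_on_eq[of _ "\<lambda>s. x s $ N + ell T N x s"])
       (use t Y in \<open>auto intro!: continuous_intros continuous_on_subset[OF x] paths_continuous[OF p]\<close>)
  define A where "A = {s \<in> {0..t}. Y s $ N = 0}"
  have "closed A"
    unfolding A_def by (rule continuous_closed_preimage_constant[OF contY]) simp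
  then have A: "A \<in> sets \<mu>" by (simp add: sets)
  define Q where "Q = {(p, q). p \<in> \<rat> \<and> q \<in> \<rat> \<and> p \<le> q \<and> F p = F q}"
  have "Q \<subseteq> \<rat> \<times> \<rat>" by (auto simp: Q_def)
  then have "countable Q" by (rule countable_subset) (auto intro: countable_rat)
  then have null: "(\<Union>(p, q)\<in>Q. {p..q}) \<in> null_sets \<mu>"
    by (rule null_sets_UN') (auto simp: null_sets_def sets Icc Q_def)
  have cover: "{0..t} - A \<subseteq> (\<Union>(p, q)\<in>Q. {p..q})"
  proof
    fix s assume "s \<in> {0..t} - A"
    then have s: "0 \<le> s" "s \<le> t" "Y s $ N \<noteq> 0" by (auto simp: A_def)
    then have "0 < x s $ N + ell T N x s"
      using ell_upper[OF x, of s s] Y[of s] t by auto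
    then obtain d where d: "0 < d" "\<And>u v. 0 \<le> u \<Longrightarrow> u \<le> v \<Longrightarrow> v \<le> T \<Longrightarrow> \<bar>u - s\<bar> < d \<Longrightarrow> \<bar>v - s\<bar> < d \<Longrightarrow> ell T N x u = ell T N x v"
      using ell_flat[OF x, of s] s t by auto
    obtain p where p: "p \<in> \<rat>" "s - d < p" "p < s" using Rats_dense_in_real[of "s - d" s] d by auto
    obtain q where q: "q \<in> \<rat>" "s < q" "q < s + d" using Rats_dense_in_real[of s "s + d"] d by auto
    have "F p = F q"
      unfolding F_def by (rule d(2)) (use p q s t T in auto)
    then show "s \<in> (\<Union>(p, q)\<in>Q. {p..q})" using p q by (intro UN_I[of "(p, q)"]) (auto simp: Q_def)
  qed
  have "{0..t} - A \<in> null_sets \<mu>"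
    by (rule null_sets_subset[OF null _ cover]) (use A in \<open>auto simp: sets\<close>)
  then have "emeasure \<mu> ({0..t} - ({0..t} - A)) = emeasure \<mu> {0..t}"
    by (rule emeasure_Diff_null_set) (simp add: sets)
  moreover have "{0..t} - ({0..t} - A) = A" by (auto simp: A_def)
  ultimately have "emeasure \<mu> A = emeasure \<mu> {0..t}" by simp
  also have "\<dots> = ennreal (ell T N x t)"
  proof -
    have "F t = ell T N x t" "F 0 = 0" using t l0 T by (auto simp: F_def)
    then show ?thesis using Icc[of 0 t] t by simp
  qed
  finally have "measure \<mu> A = ell T N x t"
    using ell_nonneg[OF x, of t] t by (simp add: measure_def)
  then show "ell T N x t = (LINT s:{0..t}|interval_measure (\<lambda>r. ell T N x (max 0 (min T r))). indicator {0} (Y s $ N))"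
    unfolding LINT_zero_set[OF contY] by (simp add: A_def \<mu>_def F_def[abs_def])
qed

text \<open>Uniqueness in the Skorokhod problem. Nonnegativity of the coordinate and monotonicity
  force \<open>\<Phi> \<ge> ell\<close>. If \<open>\<Phi> t > ell T N x t\<close>, then after the
  last time \<open>s\<close> with \<open>\<Phi> s \<le> ell T N x t\<close> the coordinate is
  positive, so \<open>(s,t]\<close> contributes nothing to the integral and
  \<open>\<Phi> t = \<Phi> s\<close>.\<close>

lemma reflection_term_eq_ell:
  assumes x: "continuous_on {0..T} (\<lambda>s. x s $ N)" and R: "reflection_term T N Y \<Phi>"
    and Y: "\<And>t. 0 \<le> t \<Longrightarrow> t \<le> T \<Longrightarrow> Y t $ N = x t $ N + \<Phi> t"
    and t: "0 \<le> t" "t \<le> T"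
  shows "\<Phi> t = ell T N x t"
proof (rule antisym)
  have pos: "\<And>t. 0 \<le> t \<Longrightarrow> t \<le> T \<Longrightarrow> 0 \<le> Y t $ N" and \<Phi>: "\<Phi> \<in> paths T" "mono_on {0..T} \<Phi>" "\<Phi> 0 = 0"
    and int: "\<And>t. t \<in> {0..T} \<Longrightarrow> \<Phi> t =
        (LINT s:{0..t}|interval_measure (\<lambda>r. \<Phi> (max 0 (min T r))). indicator {0} (Y s $ N))"
  proof -
    have 1: "\<forall>t\<in>{0..T}. 0 \<le> Y t \<bullet> axis N 1" and 2: "\<Phi> \<in> paths T \<and> mono_on {0..T} \<Phi> \<and> \<Phi> 0 = 0"
      and 3: "\<forall>t\<in>{0..T}. \<Phi> t =
        (LINT s:{0..t}|interval_measure (\<lambda>r. \<Phi> (max 0 (min T r))). indicator {0} (Y s $ N))"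
      using R unfolding reflection_term_def by blast+
    show "0 \<le> Y t $ N" if "0 \<le> t" "t \<le> T" for t using 1 that by (auto simp: inner_axis)
    show "\<Phi> \<in> paths T" "mono_on {0..T} \<Phi>" "\<Phi> 0 = 0" using 2 by blast+
    show "\<Phi> t = (LINT s:{0..t}|interval_measure (\<lambda>r. \<Phi> (max 0 (min T r))). indicator {0} (Y s $ N))"
      if "t \<in> {0..T}" for t using 3 that by blast
  qed
  have mono: "\<Phi> r \<le> \<Phi> s" if "0 \<le> r" "r \<le> s" "s \<le> T" for r s
    using \<Phi>(2) that by (auto simp: mono_on_def)
  show "ell T N x t \<le> \<Phi> t"
  proof (rule ell_least[OF t])
    fix s assume s: "0 \<le> s" "s \<le> t"
    then show "max (- (x s $ N)) 0 \<le> \<Phi> t"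
      using pos[of s] Y[of s] mono[of s t] mono[of 0 t] \<Phi>(3) t by auto
  qed
  show "\<Phi> t \<le> ell T N x t"
  proof (rule ccontr)
    assume neg: "\<not> \<Phi> t \<le> ell T N x t"
    define S where "S = {s \<in> {0..t}. \<Phi> s \<le> ell T N x t}"
    have S: "closed S"
      unfolding S_def using paths_continuous[OF \<Phi>(1), of 0 t] t by (intro continuous_on_closed_Collect_le) auto
    have "0 \<in> S" using t \<Phi>(3) ell_nonneg[OF x, of t] by (simp add: S_def)
    moreover have bdd: "bdd_above S" by (rule bdd_aboveI[of _ t]) (auto simp: S_def)
    ultimately have "Sup S \<in> S" using S by (intro closed_contains_Sup) auto
    define s where "s = Sup S"
    have s: "0 \<le> s" "s \<le> t" "\<Phi> s \<le> ell T N x t" using \<open>Sup S \<in> S\<close> by (auto simp: S_def s_def)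
    have above: "ell T N x t < \<Phi> r" if "s < r" "r \<le> t" for r
    proof (rule ccontr)
      assume "\<not> ell T N x t < \<Phi> r"
      then have "r \<in> S" using that s by (auto simp: S_def)
      then have "r \<le> s" unfolding s_def using bdd by (rule cSup_upper)
      then show False using that by simp
    qed
    have nz: "Y r $ N \<noteq> 0" if "s < r" "r \<le> t" for r
      using above[OF that] ell_upper[OF x, of r t] Y[of r] s t that by auto
    have eq: "(\<lambda>r. indicator {0..t} r *\<^sub>R indicator {0} (Y r $ N)) =
        (\<lambda>r. indicator {0..s} r *\<^sub>R indicator {0} (Y r $ N) :: real)"
    proof
      fix r
      show "indicator {0..t} r *\<^sub>R indicator {0} (Y r $ N) = (indicator {0..s} r *\<^sub>R indicator {0} (Y r $ N) :: real)"
        using nz[of r] s by (cases "r \<le> s") (auto simp: indicator_def)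
    qed
    have "\<Phi> t = (LINT r:{0..t}|interval_measure (\<lambda>r. \<Phi> (max 0 (min T r))). indicator {0} (Y r $ N))"
      by (rule int) (use t in simp)
    also have "\<dots> = (LINT r:{0..s}|interval_measure (\<lambda>r. \<Phi> (max 0 (min T r))). indicator {0} (Y r $ N))"
      unfolding set_lebesgue_integral_def eq ..
    also have "\<dots> = \<Phi> s"
      by (rule int[symmetric]) (use s t in simp)
    finally have "\<Phi> t = \<Phi> s" .
    then show False using neg s by simp
  qed
qed

subsection \<open>The maps \<open>C_tilde\<close>, \<open>L_tilde\<close> and \<open>A_tilde\<close>\<close>

text \<open>No set of the algebra generated by evaluations up to \<open>t\<close> separates two
  paths that agree on \<open>[0,t]\<close>; the preimage of the point \<open>C x s\<close> is such a
  set. Measurability thus becomes pathwise non-anticipation.\<close>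

lemma adapted_eq:
  assumes "adapted T C" "x \<in> paths T" "y \<in> paths T" "0 \<le> s" "s \<le> t" "t \<le> T"
    and eq: "\<And>u. 0 \<le> u \<Longrightarrow> u \<le> t \<Longrightarrow> x u = y u"
  shows "C x s = C y s"
proof -
  let ?G = "{{x \<in> paths T. x u \<in> B} |u B. u \<in> {0..t} \<and> B \<in> sets borel}"
  have G: "?G \<subseteq> Pow (paths T)" by auto
  have "x \<in> A \<longleftrightarrow> y \<in> A" if "A \<in> sigma_sets (paths T) ?G" for A
    using that
  proof (induction rule: sigma_sets.induct)
    case (Basic a)
    then show ?case using assms(2,3) eq by auto
  qed (use assms(2,3) in auto)
  then have *: "x \<in> A \<longleftrightarrow> y \<in> A" if "A \<in> sets (eval_algebra T t)" for A
    using that unfolding eval_algebra_def sets_measure_of[OF G] .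
  have "(\<lambda>x. C x s) \<in> measurable (eval_algebra T t) borel"
    using assms by (auto simp: adapted_def)
  then have "(\<lambda>x. C x s) -` {C x s} \<inter> space (eval_algebra T t) \<in> sets (eval_algebra T t)"
    by (rule measurable_sets) simp
  from *[OF this] show ?thesis
    using assms(2,3) unfolding eval_algebra_def space_measure_of[OF G] by simp
qed

locale reflected_mapping =
  fixes T :: real and C :: "(real \<Rightarrow> real ^ 'n) \<Rightarrow> (real \<Rightarrow> real ^ 'n)" and N :: 'n and \<xi> :: "real ^ 'n"
    and \<rho>' \<rho>'' \<kappa> \<kappa>' :: real
  assumes T: "0 < T"
    and C_path: "\<And>x. x \<in> paths T \<Longrightarrow> C x \<in> paths T"
    and C_bv: "\<And>x. x \<in> paths T \<Longrightarrow> total_var (C x) 0 T < \<infinity>"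
    and C_adapted: "adapted T C"
    and solvable: "\<And>x. x \<in> paths T \<Longrightarrow> \<exists>!y. y \<in> paths T \<and> y = (\<lambda>t. x t + C y t)"
    and Lip_C: "Lip_cond T \<rho>' (C_tilde T C)" and BV_C: "BV_cond T \<rho>'' (C_tilde T C)"
    and Lip_CN: "Lip_cond T \<kappa> (\<lambda>x t. C_tilde T C x t $ N)" and \<kappa>: "\<kappa> < 1"
    and BV_CN: "BV_cond T \<kappa>' (\<lambda>x t. C_tilde T C x t $ N)" and \<kappa>': "\<kappa>' < 1"
    and initial: "\<And>\<eta>. \<eta> = \<xi> + C_init T C \<eta> \<Longrightarrow> 0 \<le> \<eta> $ N"
begin

abbreviation e :: "real ^ 'n" where "e \<equiv> axis N 1"
abbreviation Ct where "Ct \<equiv> C_tilde T C"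
abbreviation Lt where "Lt \<equiv> L_tilde T C N"
abbreviation At where "At \<equiv> A_tilde T C N"

lemma constants_pos: "0 < \<rho>'" "0 < \<rho>''" "0 < \<kappa>" "0 < \<kappa>'"
  using Lip_C BV_C Lip_CN BV_CN by (auto simp: Lip_cond_def BV_cond_def)

lemma C_tilde_solution:
  assumes "x \<in> paths T"
  obtains y where "y \<in> paths T" "y = (\<lambda>t. x t + C y t)" "Ct x = C y"
proof -
  let ?y = "THE y. y \<in> paths T \<and> y = (\<lambda>s. x s + C y s)"
  have y: "?y \<in> paths T \<and> ?y = (\<lambda>t. x t + C ?y t)" by (rule theI'[OF solvable[OF assms]])
  then have "C ?y t = ?y t - x t" for t using fun_cong[of ?y "\<lambda>t. x t + C ?y t" t] by simp
  then have "Ct x = C ?y" by (auto simp: C_tilde_def)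
  then show ?thesis using that y by blast
qed

lemma C_tilde_eq:
  assumes "x \<in> paths T" "y \<in> paths T" "y = (\<lambda>t. x t + C y t)"
  shows "Ct x = C y"
proof -
  have "(THE y. y \<in> paths T \<and> y = (\<lambda>s. x s + C y s)) = y"
    by (rule the1_equality[OF solvable[OF assms(1)]]) (use assms in blast)
  then have "Ct x t = y t - x t" for t by (simp add: C_tilde_def)
  also have "y t - x t = C y t" for t using fun_cong[OF assms(3), of t] by simp
  finally show ?thesis by auto
qed

lemma C_tilde_path: "x \<in> paths T \<Longrightarrow> Ct x \<in> paths T"
  by (rule C_tilde_solution) (auto intro: C_path)

lemma C_tilde_fixpoint:
  assumes "x \<in> paths T"
  shows "(\<lambda>t. x t + Ct x t) \<in> paths T" "C (\<lambda>t. x t + Ct x t) = Ct x"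
proof -
  obtain y where y: "y \<in> paths T" "y = (\<lambda>t. x t + C y t)" "Ct x = C y" by (rule C_tilde_solution[OF assms])
  then have "(\<lambda>t. x t + Ct x t) = y" by simp
  then show "(\<lambda>t. x t + Ct x t) \<in> paths T" "C (\<lambda>t. x t + Ct x t) = Ct x" using y by auto
qed

lemma C_tilde_Lip:
  assumes "x \<in> paths T" "y \<in> paths T" "0 \<le> t" "t \<le> T" "\<And>u. 0 \<le> u \<Longrightarrow> u \<le> t \<Longrightarrow> norm (x u - y u) \<le> c"
    and u: "0 \<le> u" "u \<le> t"
  shows "norm (Ct x u - Ct y u) \<le> \<rho>' * c" "\<bar>Ct x u $ N - Ct y u $ N\<bar> \<le> \<kappa> * c"
proof -
  have le: "sup_norm (\<lambda>u. x u - y u) 0 t \<le> c" using assms by (intro sup_norm_le) auto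
  have p: "(\<lambda>u. Ct x u - Ct y u) \<in> paths T" "(\<lambda>u. Ct x u $ N - Ct y u $ N) \<in> paths T"
    using assms by (auto intro!: paths_diff C_tilde_path paths_nth)
  have "norm (Ct x u - Ct y u) \<le> sup_norm (\<lambda>u. Ct x u - Ct y u) 0 t"
    using assms by (intro norm_le_sup_norm[of 0 t "\<lambda>u. Ct x u - Ct y u"] paths_continuous[OF p(1)]) auto
  also have "\<dots> \<le> \<rho>' * sup_norm (\<lambda>u. x u - y u) 0 t" using Lip_C assms by (auto simp: Lip_cond_def)
  also have "\<dots> \<le> \<rho>' * c" using le constants_pos by simp
  finally show "norm (Ct x u - Ct y u) \<le> \<rho>' * c" .
  have "norm (Ct x u $ N - Ct y u $ N) \<le> sup_norm (\<lambda>u. Ct x u $ N - Ct y u $ N) 0 t"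
    using assms by (intro norm_le_sup_norm[of 0 t "\<lambda>u. Ct x u $ N - Ct y u $ N"] paths_continuous[OF p(2)]) auto
  also have "\<dots> \<le> \<kappa> * sup_norm (\<lambda>u. x u - y u) 0 t" using Lip_CN assms by (auto simp: Lip_cond_def)
  also have "\<dots> \<le> \<kappa> * c" using le constants_pos by simp
  finally show "\<bar>Ct x u $ N - Ct y u $ N\<bar> \<le> \<kappa> * c" by simp
qed

text \<open>The solution \<open>y\<close> of \<open>y = x + C y\<close> starts at some \<eta> with
  \<open>\<eta> = \<xi> + C_init T C \<eta>\<close>, because adaptedness at time 0 lets the constant
  path replace \<open>y\<close>.\<close>

lemma initial_nonneg:
  assumes "x \<in> paths T" "x 0 = \<xi>"
  shows "0 \<le> \<xi> $ N + Ct x 0 $ N"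
proof -
  obtain y where y: "y \<in> paths T" "y = (\<lambda>t. x t + C y t)" "Ct x = C y" by (rule C_tilde_solution[OF assms(1)])
  have y0: "y 0 = \<xi> + C y 0" using fun_cong[OF y(2), of 0] assms by simp
  have "const_path T (y 0) \<in> paths T"
    unfolding paths_def const_path_def by (auto intro: continuous_on_eq[of _ "\<lambda>_. y 0"])
  then have "C y 0 = C (const_path T (y 0)) 0"
    using T by (intro adapted_eq[OF C_adapted y(1), of _ 0 0]) (auto simp: const_path_def)
  then have "y 0 = \<xi> + C_init T C (y 0)" using y0 by (simp add: C_init_def)
  then have "0 \<le> y 0 $ N" by (rule initial)
  then show ?thesis using y0 y(3) by simp
qed

lemma shifted_path: "x \<in> paths T \<Longrightarrow> \<phi> \<in> paths T \<Longrightarrow> (\<lambda>t. x t + \<phi> t *\<^sub>R e) \<in> paths T"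
  by (intro paths_add paths_scaleR)

lemma M_integrand_path:
  "x \<in> paths T \<Longrightarrow> \<phi> \<in> paths T \<Longrightarrow> (\<lambda>s. x s + Ct (\<lambda>r. x r + \<phi> r *\<^sub>R e) s) \<in> paths T"
  by (intro paths_add C_tilde_path shifted_path)

lemma paths_nth_continuous: "x \<in> paths T \<Longrightarrow> continuous_on {0..T} (\<lambda>s. x s $ N)"
  using paths_continuous[OF paths_nth, of x T 0 T] by simp

text \<open>The running maximum is 1-Lipschitz and component \<open>N\<close> of
  \<open>C_tilde\<close> is \<kappa>-Lipschitz in the sup norm. The version with two inputs and a
  free horizon \<open>t\<close> serves the contraction (\<open>x = y\<close>), the value at time 0
  (\<open>t = 0\<close>) and the Lipschitz bound for \<open>L_tilde\<close>.\<close>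

lemma M_map_diff:
  assumes "x \<in> paths T" "y \<in> paths T" "\<phi> \<in> paths T" "\<psi> \<in> paths T" "0 \<le> t" "t \<le> T"
    and c: "\<And>u. 0 \<le> u \<Longrightarrow> u \<le> t \<Longrightarrow> norm (x u - y u) \<le> c"
    and d: "\<And>u. 0 \<le> u \<Longrightarrow> u \<le> t \<Longrightarrow> \<bar>\<phi> u - \<psi> u\<bar> \<le> d"
    and u: "0 \<le> u" "u \<le> t"
  shows "\<bar>M_map T C N x \<phi> u - M_map T C N y \<psi> u\<bar> \<le> c + \<kappa> * (c + d)"
  unfolding M_map_def
proof (rule ell_diff)
  show "continuous_on {0..T} (\<lambda>s. (x s + Ct (\<lambda>r. x r + \<phi> r *\<^sub>R e) s) $ N)"
    "continuous_on {0..T} (\<lambda>s. (y s + Ct (\<lambda>r. y r + \<psi> r *\<^sub>R e) s) $ N)"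
    by (intro paths_nth_continuous M_integrand_path assms)+
  fix r assume r: "0 \<le> r" "r \<le> u"
  have "\<bar>Ct (\<lambda>r. x r + \<phi> r *\<^sub>R e) r $ N - Ct (\<lambda>r. y r + \<psi> r *\<^sub>R e) r $ N\<bar> \<le> \<kappa> * (c + d)"
  proof (rule C_tilde_Lip(2)[of _ _ t])
    fix v assume v: "0 \<le> v" "v \<le> t"
    have "x v + \<phi> v *\<^sub>R e - (y v + \<psi> v *\<^sub>R e) = (x v - y v) + (\<phi> v - \<psi> v) *\<^sub>R e"
      by (simp add: algebra_simps)
    also have "norm \<dots> \<le> c + d"
      using c[OF v] d[OF v] by (intro norm_triangle_mono) auto
    finally show "norm (x v + \<phi> v *\<^sub>R e - (y v + \<psi> v *\<^sub>R e)) \<le> c + d" .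
  qed (use assms r in \<open>auto intro!: shifted_path\<close>)
  moreover have "\<bar>x r $ N - y r $ N\<bar> \<le> c"
    using c[of r] r u order_trans[OF component_le_norm_cart[of "x r - y r" N]] by auto
  ultimately show "\<bar>(x r + Ct (\<lambda>r. x r + \<phi> r *\<^sub>R e) r) $ N - (y r + Ct (\<lambda>r. y r + \<psi> r *\<^sub>R e) r) $ N\<bar>
      \<le> c + \<kappa> * (c + d)"
    by simp
qed (use assms in auto)

lemma L_tilde_ex1:
  assumes x: "x \<in> paths T" "x 0 = \<xi>"
  shows "\<exists>!\<phi>. \<phi> \<in> paths T \<and> \<phi> 0 = 0 \<and> M_map T C N x \<phi> = \<phi>"
proof -
  have M: "M_map T C N x \<phi> \<in> paths T" if "\<phi> \<in> paths T" for \<phi>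
    unfolding M_map_def using T that x by (intro ell_path paths_nth_continuous M_integrand_path) auto
  have "\<exists>!\<phi>. \<phi> \<in> paths T \<and> M_map T C N x \<phi> = \<phi>"
  proof (rule paths_Banach_fix[OF _ _ \<kappa>])
    fix \<phi> \<psi> :: "real \<Rightarrow> real" and c u
    assume *: "\<phi> \<in> paths T" "\<psi> \<in> paths T" "0 \<le> u" "u \<le> T" "\<And>u. 0 \<le> u \<Longrightarrow> u \<le> T \<Longrightarrow> norm (\<phi> u - \<psi> u) \<le> c"
    then have "\<bar>M_map T C N x \<phi> u - M_map T C N x \<psi> u\<bar> \<le> 0 + \<kappa> * (0 + c)"
      using T x by (intro M_map_diff[of _ _ _ _ T]) auto
    then show "norm (M_map T C N x \<phi> u - M_map T C N x \<psi> u) \<le> \<kappa> * c" by simp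
  qed (use T M constants_pos in auto)
  \<comment> \<open>The fixed point is found without the constraint at 0. Comparison with the zero
    path on the horizon \<open>[0,0]\<close> gives
    \<open>\<bar>\<phi> 0\<bar> \<le> \<kappa> * \<bar>\<phi> 0\<bar>\<close>, since by
    \<open>initial_nonneg\<close> the image of the zero path vanishes there.\<close>
  moreover have "\<phi> 0 = 0" if \<phi>: "\<phi> \<in> paths T" "M_map T C N x \<phi> = \<phi>" for \<phi>
  proof -
    have "\<bar>M_map T C N x \<phi> 0 - M_map T C N x (\<lambda>_. 0) 0\<bar> \<le> 0 + \<kappa> * (0 + \<bar>\<phi> 0\<bar>)"
      using T x \<phi> by (intro M_map_diff[of _ _ _ _ 0]) (auto simp: paths_def)
    moreover have "M_map T C N x (\<lambda>_. 0) 0 = 0"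
      using initial_nonneg[OF x] x T by (simp add: M_map_def ell_zero)
    ultimately have "(1 - \<kappa>) * \<bar>\<phi> 0\<bar> \<le> 0" using \<phi>(2) by (simp add: algebra_simps)
    then show ?thesis using \<kappa> by (simp add: mult_le_0_iff)
  qed
  ultimately show ?thesis unfolding Ex1_def by blast
qed

lemma L_tilde:
  assumes x: "x \<in> paths T" "x 0 = \<xi>"
  shows "Lt x \<in> paths T" "Lt x 0 = 0" "M_map T C N x (Lt x) = Lt x"
  using theI'[OF L_tilde_ex1[OF x]] unfolding L_tilde_def by blast+

lemma L_tilde_eqI:
  assumes x: "x \<in> paths T" "x 0 = \<xi>" and \<phi>: "\<phi> \<in> paths T" "\<phi> 0 = 0" "M_map T C N x \<phi> = \<phi>"
  shows "Lt x = \<phi>"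
  unfolding L_tilde_def by (rule the1_equality[OF L_tilde_ex1[OF x]]) (use \<phi> in simp)

lemma A_tilde_path:
  assumes x: "x \<in> paths T" "x 0 = \<xi>"
  shows "At x \<in> paths T"
  unfolding A_tilde_def by (intro paths_add C_tilde_path shifted_path paths_scaleR x L_tilde(1)[OF x])

text \<open>The bound on \<open>[0,t]\<close> involves the inputs on \<open>[0,t]\<close> only:
  \<open>c = 0\<close> gives non-anticipation of \<open>A_tilde\<close>, and small \<open>c\<close>
  its continuity.\<close>

lemma A_tilde_Lip:
  assumes x: "x \<in> paths T" "x 0 = \<xi>" and y: "y \<in> paths T" "y 0 = \<xi>" and t: "0 \<le> t" "t \<le> T"
    and c: "\<And>u. 0 \<le> u \<Longrightarrow> u \<le> t \<Longrightarrow> norm (x u - y u) \<le> c" and u: "0 \<le> u" "u \<le> t"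
  shows "norm (At x u - At y u) \<le> (\<rho>' * (1 + (1 + \<kappa>) / (1 - \<kappa>)) + (1 + \<kappa>) / (1 - \<kappa>)) * c"
proof -
  define d where "d = (1 + \<kappa>) / (1 - \<kappa>) * c"
  note Lx = L_tilde[OF x] and Ly = L_tilde[OF y]
  let ?l = "\<lambda>u. Lt x u - Lt y u"
  have l: "\<bar>?l v\<bar> \<le> sup_norm ?l 0 t" if "0 \<le> v" "v \<le> t" for v
    using that t norm_le_sup_norm[of 0 t ?l v] paths_continuous[OF paths_diff[OF Lx(1) Ly(1)], of 0 t] by auto
  have "norm (?l v) \<le> c + \<kappa> * (c + sup_norm ?l 0 t)" if "0 \<le> v" "v \<le> t" for v
    using M_map_diff[OF x(1) y(1) Lx(1) Ly(1) t c l that] Lx(3) Ly(3) by simp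
  \<comment> \<open>The finite quantity \<open>sup_norm ?l 0 t\<close> stands on both sides;
    \<kappa> < 1 absorbs it, whence the factor
    \<open>(1 + \<kappa>) / (1 - \<kappa>)\<close>.\<close>
  then have "sup_norm ?l 0 t \<le> c + \<kappa> * (c + sup_norm ?l 0 t)" using t by (intro sup_norm_le) auto
  then have "sup_norm ?l 0 t * (1 - \<kappa>) \<le> (1 + \<kappa>) * c" by (simp add: algebra_simps)
  then have "sup_norm ?l 0 t \<le> d" unfolding d_def using \<kappa> by (simp add: pos_le_divide_eq)
  then have d: "\<bar>?l v\<bar> \<le> d" if "0 \<le> v" "v \<le> t" for v using l[OF that] by linarith
  have "norm (Ct (\<lambda>r. x r + Lt x r *\<^sub>R e) u - Ct (\<lambda>r. y r + Lt y r *\<^sub>R e) u) \<le> \<rho>' * (c + d)"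
  proof (rule C_tilde_Lip(1)[of _ _ t])
    fix v assume v: "0 \<le> v" "v \<le> t"
    have "x v + Lt x v *\<^sub>R e - (y v + Lt y v *\<^sub>R e) = (x v - y v) + ?l v *\<^sub>R e"
      by (simp add: algebra_simps)
    also have "norm \<dots> \<le> c + d" using c[OF v] d[OF v] by (intro norm_triangle_mono) auto
    finally show "norm (x v + Lt x v *\<^sub>R e - (y v + Lt y v *\<^sub>R e)) \<le> c + d" .
  qed (use x y t u Lx Ly in \<open>auto intro!: shifted_path\<close>)
  moreover have "At x u - At y u = (Ct (\<lambda>r. x r + Lt x r *\<^sub>R e) u - Ct (\<lambda>r. y r + Lt y r *\<^sub>R e) u) + ?l u *\<^sub>R e"
    by (simp add: A_tilde_def algebra_simps)
  moreover have "norm (?l u *\<^sub>R e) \<le> d" using d[OF u] by simp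
  ultimately have "norm (At x u - At y u) \<le> \<rho>' * (c + d) + d" by (auto intro: norm_triangle_mono)
  then show ?thesis by (simp add: d_def algebra_simps)
qed

text \<open>Let \<open>S\<close> be the oscillation of \<open>x\<close> and \<open>l\<close> the
  increment of \<open>L_tilde x\<close>. Since \<open>L_tilde x\<close> is the running maximum of a
  path whose component \<open>N\<close> drops by at most \<open>S + \<kappa>' * (S + l)\<close>, the
  increment satisfies \<open>l \<le> S + \<kappa>' * (S + l)\<close>, which \<kappa>' < 1
  resolves.\<close>

lemma L_tilde_increment:
  assumes x: "x \<in> paths T" "x 0 = \<xi>" and st: "0 \<le> s" "s \<le> t" "t \<le> T"
  shows "Lt x s \<le> Lt x t" "Lt x t - Lt x s \<le> (1 + \<kappa>') / (1 - \<kappa>') * sup_var x s t"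
proof -
  note Lx = L_tilde[OF x]
  let ?w = "\<lambda>r. x r + Lt x r *\<^sub>R e"
  let ?f = "\<lambda>s. x s + Ct ?w s"
  have w: "?w \<in> paths T" by (intro shifted_path x Lx)
  have cf: "continuous_on {0..T} (\<lambda>s. ?f s $ N)" by (intro paths_nth_continuous M_integrand_path x Lx)
  have L: "Lt x r = ell T N ?f r" for r using fun_cong[OF Lx(3), of r] by (simp add: M_map_def)
  have mono: "Lt x s \<le> Lt x t" if "0 \<le> s" "s \<le> t" "t \<le> T" for s t
    using ell_mono[OF cf that] by (simp only: L[symmetric])
  show "Lt x s \<le> Lt x t" using st by (rule mono)
  define l where "l = Lt x t - Lt x s"
  define S where "S = sup_var x s t"
  have cx: "continuous_on {s..t} x" using st by (intro paths_continuous[OF x(1)]) auto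
  have S: "norm (x v - x u) \<le> S" if "s \<le> u" "u \<le> v" "v \<le> t" for u v
    unfolding S_def by (rule le_sup_var[OF cx that])
  have "sup_var ?w s t \<le> S + l"
  proof (rule sup_var_le[OF st(2)])
    fix u v assume uv: "s \<le> u" "u \<le> v" "v \<le> t"
    have "?w v - ?w u = (x v - x u) + (Lt x v - Lt x u) *\<^sub>R e" by (simp add: algebra_simps)
    also have "norm \<dots> \<le> S + l"
      using S[OF uv] mono[of u v] mono[of s u] mono[of v t] uv st by (intro norm_triangle_mono) (auto simp: l_def)
    finally show "norm (?w v - ?w u) \<le> S + l" .
  qed
  then have "ell T N ?f t - ell T N ?f s \<le> S + \<kappa>' * (S + l)"
  proof (intro ell_increment[OF cf st])
    fix u assume u: "s \<le> u" "u \<le> t"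
    assume le: "sup_var ?w s t \<le> S + l"
    have "sup_var ?w s u \<le> S + l"
    proof (rule order_trans[OF _ le], rule sup_var_le[OF u(1)])
      fix a b assume "s \<le> a" "a \<le> b" "b \<le> u"
      then show "norm (?w b - ?w a) \<le> sup_var ?w s t"
        using u st paths_continuous[OF w, of s t] by (intro le_sup_var[of s t ?w]) auto
    qed
    then have k: "\<kappa>' * sup_var ?w s u \<le> \<kappa>' * (S + l)" using constants_pos by simp
    have "ennreal (norm (Ct ?w u $ N - Ct ?w s $ N)) \<le> total_var (\<lambda>t. Ct ?w t $ N) s u"
      by (rule norm_le_total_var[OF u(1), of "\<lambda>t. Ct ?w t $ N"])
    also have "\<dots> \<le> ennreal (\<kappa>' * sup_var ?w s u)"
      using BV_CN w st u by (auto simp: BV_cond_def)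
    also have "\<dots> \<le> ennreal (\<kappa>' * (S + l))" using k by (rule ennreal_leI)
    finally have "\<bar>Ct ?w u $ N - Ct ?w s $ N\<bar> \<le> \<kappa>' * (S + l)"
      using order_trans[OF mult_nonneg_nonneg[of \<kappa>' "sup_var ?w s u"] k] constants_pos st u
        sup_var_nonneg[of s u ?w] paths_continuous[OF w, of s u] by (simp add: ennreal_le_iff)
    moreover have "\<bar>x u $ N - x s $ N\<bar> \<le> S"
      using order_trans[OF component_le_norm_cart[of "x u - x s" N] S[OF _ u]] by auto
    ultimately show "?f s $ N - ?f u $ N \<le> S + \<kappa>' * (S + l)" by simp
  qed
  then have "l * (1 - \<kappa>') \<le> (1 + \<kappa>') * S" by (simp add: l_def algebra_simps flip: L)
  then show "Lt x t - Lt x s \<le> (1 + \<kappa>') / (1 - \<kappa>') * sup_var x s t"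
    using \<kappa>' by (simp add: pos_le_divide_eq flip: l_def S_def)
qed

text \<open>Only the constants \<rho>'' and \<kappa>' occur; this is the source of
  \<open>CA\<close>. The bound is linear in the oscillation of \<open>x\<close> on the same
  interval, which makes it usable before \<open>x\<close> is known to be Hoelder.\<close>

lemma A_tilde_total_var:
  assumes x: "x \<in> paths T" "x 0 = \<xi>" and st: "0 \<le> s" "s \<le> t" "t \<le> T"
  defines "q \<equiv> (1 + \<kappa>') / (1 - \<kappa>')"
  shows "total_var (At x) s t \<le> ennreal ((\<rho>'' * (1 + q) + q) * sup_var x s t)"
proof -
  note Lx = L_tilde[OF x]
  let ?w = "\<lambda>r. x r + Lt x r *\<^sub>R e"
  define S where "S = sup_var x s t"
  have w: "?w \<in> paths T" by (intro shifted_path x Lx)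
  have cx: "continuous_on {s..t} x" using st by (intro paths_continuous[OF x(1)]) auto
  have S: "norm (x v - x u) \<le> S" if "s \<le> u" "u \<le> v" "v \<le> t" for u v
    unfolding S_def by (rule le_sup_var[OF cx that])
  have S0: "0 \<le> S" unfolding S_def by (rule sup_var_nonneg[OF cx st(2)])
  have q0: "0 \<le> q" using \<kappa>' constants_pos by (simp add: q_def)
  have l: "Lt x t - Lt x s \<le> q * S" unfolding q_def S_def by (rule L_tilde_increment(2)[OF x st])
  have mono: "Lt x u \<le> Lt x v" if "s \<le> u" "u \<le> v" "v \<le> t" for u v
    using that st by (intro L_tilde_increment(1)[OF x]) auto
  have "sup_var ?w s t \<le> (1 + q) * S"
  proof (rule sup_var_le[OF st(2)])
    fix u v assume uv: "s \<le> u" "u \<le> v" "v \<le> t"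
    have "?w v - ?w u = (x v - x u) + (Lt x v - Lt x u) *\<^sub>R e" by (simp add: algebra_simps)
    also have "norm \<dots> \<le> S + q * S"
      using S[OF uv] mono[of u v] mono[of s u] mono[of v t] uv st l by (intro norm_triangle_mono) auto
    finally show "norm (?w v - ?w u) \<le> (1 + q) * S" by (simp add: algebra_simps)
  qed
  then have "total_var (Ct ?w) s t \<le> ennreal (\<rho>'' * ((1 + q) * S))"
  proof -
    assume le: "sup_var ?w s t \<le> (1 + q) * S"
    have "total_var (Ct ?w) s t \<le> ennreal (\<rho>'' * sup_var ?w s t)"
      using BV_C w st by (auto simp: BV_cond_def)
    also have "\<dots> \<le> ennreal (\<rho>'' * ((1 + q) * S))"
      using le constants_pos by (intro ennreal_leI mult_left_mono) auto
    finally show ?thesis .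
  qed
  moreover have "total_var (\<lambda>r. Lt x r *\<^sub>R e) s t \<le> ennreal (q * S)"
    using l by (intro order_trans[OF total_var_mono_scaleR[OF mono]] ennreal_leI) auto
  ultimately have "total_var (At x) s t \<le> ennreal (\<rho>'' * ((1 + q) * S)) + ennreal (q * S)"
    unfolding A_tilde_def by (intro order_trans[OF total_var_add] add_mono)
  also have "\<dots> = ennreal (\<rho>'' * ((1 + q) * S) + q * S)"
    using constants_pos q0 S0 by (intro ennreal_plus[symmetric]) auto
  also have "\<rho>'' * ((1 + q) * S) + q * S = (\<rho>'' * (1 + q) + q) * sup_var x s t"
    unfolding S_def by algebra
  finally show ?thesis .
qed

end

subsection \<open>Vector fields of class Lip\<close>

text \<open>\<open>1 < g\<close> excludes \<open>m = 0\<close>. For \<open>m = 1\<close> the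
  derivative is Hoelder with exponent \<open>g - 1\<close>; for \<open>m \<ge> 2\<close> the bounded
  second derivative makes it Lipschitz, and the exponent is 1.\<close>

lemma Lip_classE:
  fixes \<sigma> :: "'a::euclidean_space \<Rightarrow> 'b::real_normed_vector"
  assumes "\<sigma> \<in> Lip_class g" "1 < g"
  obtains B H \<theta> where "1 \<le> B" "0 \<le> H" "0 < \<theta>" "\<theta> \<le> 1" "\<theta> = g - 1 \<or> \<theta> = 1"
    "\<And>y. (\<sigma> has_derivative frechet_derivative \<sigma> (at y)) (at y)"
    "\<And>y. norm (\<sigma> y) \<le> B" "\<And>y v. norm (frechet_derivative \<sigma> (at y) v) \<le> B * norm v"
    "\<And>y z v. norm (frechet_derivative \<sigma> (at y) v - frechet_derivative \<sigma> (at z) v) \<le> H * norm v * norm (y - z) powr \<theta>"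
proof -
  obtain m :: nat and \<theta> where g: "g = real m + \<theta>" "0 < \<theta>" "\<theta> \<le> 1"
    and diff: "\<forall>vs x. length vs < m \<longrightarrow> iter_deriv \<sigma> vs differentiable (at x)"
    and bdd: "\<exists>B. \<forall>vs x. length vs \<le> m \<longrightarrow> norm (iter_deriv \<sigma> vs x) \<le> B * prod_list (map norm vs)"
    and hol: "\<exists>H. \<forall>vs x y. length vs = m \<longrightarrow>
        norm (iter_deriv \<sigma> vs x - iter_deriv \<sigma> vs y) \<le> H * prod_list (map norm vs) * norm (x - y) powr \<theta>"
    using assms(1) unfolding Lip_class_def by blast
  have m: "1 \<le> m" using g assms(2) by (cases m) auto
  obtain B0 where B0: "\<forall>vs x. length vs \<le> m \<longrightarrow> norm (iter_deriv \<sigma> vs x) \<le> B0 * prod_list (map norm vs)"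
    using bdd by blast
  define B where "B = max B0 1"
  have B: "norm (iter_deriv \<sigma> vs x) \<le> B * prod_list (map norm vs)" if "length vs \<le> m" for vs x
  proof -
    have "0 \<le> prod_list (map norm vs)" by (induction vs) auto
    then have "B0 * prod_list (map norm vs) \<le> B * prod_list (map norm vs)"
      by (intro mult_right_mono) (auto simp: B_def)
    then show ?thesis using B0 that order_trans by blast
  qed
  let ?D = "\<lambda>y. frechet_derivative \<sigma> (at y)"
  have D: "(\<sigma> has_derivative ?D y) (at y)" for y
    using diff[rule_format, of "[]" y] m by (simp flip: frechet_derivative_works)
  have "\<exists>H \<theta>'. 0 \<le> H \<and> 0 < \<theta>' \<and> \<theta>' \<le> 1 \<and> (\<theta>' = g - 1 \<or> \<theta>' = 1) \<and>
      (\<forall>y z v. norm (?D y v - ?D z v) \<le> H * norm v * norm (y - z) powr \<theta>')"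
  proof (cases "m = 1")
    case True
    obtain H where H: "\<forall>vs x y. length vs = m \<longrightarrow>
        norm (iter_deriv \<sigma> vs x - iter_deriv \<sigma> vs y) \<le> H * prod_list (map norm vs) * norm (x - y) powr \<theta>"
      using hol by blast
    have "norm (?D y v - ?D z v) \<le> max H 0 * norm v * norm (y - z) powr \<theta>" for y z v
    proof -
      have "norm (?D y v - ?D z v) \<le> H * norm v * norm (y - z) powr \<theta>"
        using H[rule_format, of "[v]" y z] True by simp
      also have "\<dots> \<le> max H 0 * norm v * norm (y - z) powr \<theta>" by (intro mult_right_mono) auto
      finally show ?thesis .
    qed
    then show ?thesis using g True by (intro exI[of _ "max H 0"] exI[of _ \<theta>]) auto
  next
    case False
    then have m2: "2 \<le> m" using m by simp
    have "norm (?D y v - ?D z v) \<le> B * norm v * norm (y - z) powr 1" for y z v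
    proof -
      have "norm (iter_deriv \<sigma> [v] y - iter_deriv \<sigma> [v] z) \<le> (B * norm v) * norm (y - z)"
      proof (rule differentiable_bound[of UNIV])
        fix x
        have "(iter_deriv \<sigma> [v] has_derivative frechet_derivative (iter_deriv \<sigma> [v]) (at x)) (at x)"
          using diff[rule_format, of "[v]" x] m2 by (simp flip: frechet_derivative_works)
        then show "(iter_deriv \<sigma> [v] has_derivative frechet_derivative (iter_deriv \<sigma> [v]) (at x)) (at x within UNIV)"
          by simp
        show "onorm (frechet_derivative (iter_deriv \<sigma> [v]) (at x)) \<le> B * norm v"
        proof (rule onorm_le)
          fix w
          show "norm (frechet_derivative (iter_deriv \<sigma> [v]) (at x) w) \<le> B * norm v * norm w"
            using B[of "[w, v]" x] m2 by (simp add: algebra_simps)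
        qed
      qed auto
      then show ?thesis by simp
    qed
    then show ?thesis by (intro exI[of _ B] exI[of _ 1]) (auto simp: B_def)
  qed
  then obtain H \<theta>' where H: "0 \<le> H" "0 < \<theta>'" "\<theta>' \<le> 1" "\<theta>' = g - 1 \<or> \<theta>' = 1"
      "\<forall>y z v. norm (?D y v - ?D z v) \<le> H * norm v * norm (y - z) powr \<theta>'" by blast
  show ?thesis
  proof (rule that[OF _ H(1-4) D])
    show "1 \<le> B" by (simp add: B_def)
    show "norm (\<sigma> y) \<le> B" for y using B[of "[]" y] by simp
    show "norm (?D y v) \<le> B * norm v" for y v using B[of "[v]" y] m by simp
    show "norm (?D y v - ?D z v) \<le> H * norm v * norm (y - z) powr \<theta>'" for y z v using H(5) by blast
  qed
qed

text \<open>The coefficient \<open>D\<sigma> \<sigma>\<close> of the second level: what the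
  \<open>XX\<close> term of \<open>rough_germ\<close> becomes when
  \<open>Z' = \<sigma> (Y)\<close>.\<close>

definition second_order :: "(real ^ 'n \<Rightarrow> (real ^ 'd) \<Rightarrow>\<^sub>L (real ^ 'n)) \<Rightarrow> real ^ 'n \<Rightarrow> real ^ 'd ^ 'd \<Rightarrow> real ^ 'n" where
  "second_order \<sigma> y = tensor_app (\<lambda>a b. blinfun_apply (frechet_derivative \<sigma> (at y) (blinfun_apply (\<sigma> y) a)) b)"

text \<open>One constant \<open>B \<ge> 1\<close> serves all bounds, so that later constants depend
  on \<sigma> through \<open>B\<close> and \<theta> only.\<close>

locale vector_field =
  fixes \<sigma> :: "real ^ 'n \<Rightarrow> (real ^ 'd) \<Rightarrow>\<^sub>L (real ^ 'n)" and B \<theta> :: real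
  assumes B: "1 \<le> B" and \<theta>: "0 < \<theta>" "\<theta> \<le> 1"
    and norm_\<sigma>: "\<And>y. norm (\<sigma> y) \<le> B"
    and derivative: "\<And>y. (\<sigma> has_derivative frechet_derivative \<sigma> (at y)) (at y)"
    and norm_D: "\<And>y v. norm (frechet_derivative \<sigma> (at y) v) \<le> B * norm v"
    and taylor: "\<And>y z. norm (\<sigma> z - \<sigma> y - frechet_derivative \<sigma> (at y) (z - y)) \<le> B * norm (z - y) powr (1 + \<theta>)"
    and norm_G: "\<And>y M. norm (second_order \<sigma> y M) \<le> B * norm M"
    and holder_G: "\<And>y z M. norm (second_order \<sigma> y M - second_order \<sigma> z M) \<le> B * norm (y - z) powr \<theta> * norm M"
begin

abbreviation D where "D y \<equiv> frechet_derivative \<sigma> (at y)"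
abbreviation G where "G \<equiv> second_order \<sigma>"

lemma linear_D: "bounded_linear (D y)" using derivative by (rule has_derivative_bounded_linear)

lemma Lip_\<sigma>: "norm (\<sigma> y - \<sigma> z) \<le> B * norm (y - z)"
proof (rule differentiable_bound[of UNIV])
  show "onorm (D x) \<le> B" for x by (rule onorm_le) (rule norm_D)
qed (use derivative in auto)

lemma norm_apply: "norm (blinfun_apply (\<sigma> y) a) \<le> B * norm a"
  by (rule order_trans[OF norm_blinfun]) (intro mult_right_mono norm_\<sigma> norm_ge_zero)

lemma norm_D_apply: "norm (blinfun_apply (D y v) a) \<le> B * norm v * norm a"
  by (rule order_trans[OF norm_blinfun]) (intro mult_right_mono norm_D norm_ge_zero)

text \<open>Evaluates \<open>G\<close> on the cross term of Chen's relation, for use in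
  \<open>J_defect\<close>.\<close>

lemma G_tensor: "G y (tensor a b) = blinfun_apply (D y (blinfun_apply (\<sigma> y) a)) b"
  unfolding second_order_def
proof (rule tensor_app_tensor)
  interpret D: bounded_linear "D y" by (rule linear_D)
  show "bounded_bilinear (\<lambda>a b. blinfun_apply (D y (blinfun_apply (\<sigma> y) a)) b)"
  proof
    show "\<exists>K. \<forall>a b. norm (blinfun_apply (D y (blinfun_apply (\<sigma> y) a)) b) \<le> norm a * norm b * K"
    proof (intro exI[of _ "B * B"] allI)
      fix a b
      have "norm (blinfun_apply (D y (blinfun_apply (\<sigma> y) a)) b) \<le> B * norm (blinfun_apply (\<sigma> y) a) * norm b"
        by (rule norm_D_apply)
      also have "\<dots> \<le> B * (B * norm a) * norm b"
        using B by (intro mult_right_mono mult_left_mono norm_apply) auto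
      finally show "norm (blinfun_apply (D y (blinfun_apply (\<sigma> y) a)) b) \<le> norm a * norm b * (B * B)"
        by (simp add: algebra_simps)
    qed
  qed (simp_all add: D.add D.scaleR blinfun.add_right blinfun.scaleR_right plus_blinfun.rep_eq scaleR_blinfun.rep_eq)
qed

lemma G_add: "G y (M + M') = G y M + G y M'" and G_diff: "G y (M - M') = G y M - G y M'" and G_zero: "G y 0 = 0"
  by (simp_all add: second_order_def tensor_app_add tensor_app_diff tensor_app_zero)

end

lemma Lip_class_vector_field:
  fixes \<sigma> :: "real ^ 'n \<Rightarrow> (real ^ 'd) \<Rightarrow>\<^sub>L (real ^ 'n)"
  assumes "\<sigma> \<in> Lip_class g" "1 < g"
  obtains B \<theta> where "vector_field \<sigma> B \<theta>" "\<theta> = g - 1 \<or> \<theta> = 1"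
proof -
  obtain b H \<theta> where b: "1 \<le> b" and H: "0 \<le> H" and \<theta>: "0 < \<theta>" "\<theta> \<le> 1" "\<theta> = g - 1 \<or> \<theta> = 1"
    and der: "\<And>y. (\<sigma> has_derivative frechet_derivative \<sigma> (at y)) (at y)"
    and n0: "\<And>y. norm (\<sigma> y) \<le> b" and n1: "\<And>y v. norm (frechet_derivative \<sigma> (at y) v) \<le> b * norm v"
    and h1: "\<And>y z v. norm (frechet_derivative \<sigma> (at y) v - frechet_derivative \<sigma> (at z) v) \<le> H * norm v * norm (y - z) powr \<theta>"
    by (rule Lip_classE[OF assms]) (rule that)
  let ?D = "\<lambda>y. frechet_derivative \<sigma> (at y)"
  define c where "c = real (CARD('d) * CARD('d))"
  have c: "1 \<le> c" unfolding c_def by (simp add: Suc_leI flip: of_nat_mult)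
  \<comment> \<open>The entries serve, in this order, the size of \<sigma> and its derivative, the
    Taylor remainder, the size of \<open>second_order\<close> and its Hoelder constant.\<close>
  define B where "B = max (max b H) (max (c * (b * b)) (c * (H * b + b * (2 * b))))"
  have BB: "b \<le> B" "H \<le> B" "c * (b * b) \<le> B" "c * (H * b + b * (2 * b)) \<le> B" by (auto simp: B_def)
  have ap: "norm (blinfun_apply (\<sigma> y) (axis i 1)) \<le> b" for y i
    using order_trans[OF norm_blinfun[of "\<sigma> y" "axis i 1"]] n0[of y] by simp
  have lip: "norm (\<sigma> y - \<sigma> z) \<le> b * norm (y - z)" for y z
  proof (rule differentiable_bound[of UNIV])
    show "onorm (?D x) \<le> b" for x by (rule onorm_le) (rule n1)
  qed (use der in auto)
  \<comment> \<open>Near the diagonal this follows from the Lipschitz bound, as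
    \<open>r \<le> r powr \<theta>\<close> for \<open>0 \<le> r \<le> 1\<close>; away from it, from
    boundedness.\<close>
  have lip\<theta>: "norm (\<sigma> y - \<sigma> z) \<le> 2 * b * norm (y - z) powr \<theta>" for y z
  proof (cases "norm (y - z) \<le> 1")
    case True
    have "norm (y - z) powr 1 \<le> norm (y - z) powr \<theta>" using True \<theta> by (intro powr_mono') auto
    then have "norm (y - z) \<le> norm (y - z) powr \<theta>" by simp
    then have "b * norm (y - z) \<le> 2 * b * norm (y - z) powr \<theta>" using b by (intro mult_mono) auto
    then show ?thesis using lip[of y z] by simp
  next
    case False
    have "1 \<le> norm (y - z) powr \<theta>" using False \<theta> by (intro ge_one_powr_ge_zero) auto
    then have "2 * b * 1 \<le> 2 * b * norm (y - z) powr \<theta>" using b by (intro mult_left_mono) auto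
    moreover have "norm (\<sigma> y - \<sigma> z) \<le> b + b" using norm_triangle_ineq4[of "\<sigma> y" "\<sigma> z"] n0[of y] n0[of z] by linarith
    ultimately show ?thesis by linarith
  qed
  have "vector_field \<sigma> B \<theta>"
  proof
    show "1 \<le> B" "0 < \<theta>" "\<theta> \<le> 1" using BB b \<theta> by auto
    show "norm (\<sigma> y) \<le> B" for y using n0[of y] BB by linarith
    show "(\<sigma> has_derivative ?D y) (at y)" for y by (rule der)
    show "norm (?D y v) \<le> B * norm v" for y v
      using n1[of y v] BB mult_right_mono[of b B "norm v"] by simp
    show "norm (\<sigma> z - \<sigma> y - ?D y (z - y)) \<le> B * norm (z - y) powr (1 + \<theta>)" for y z
    proof -
      have "norm (\<sigma> z - \<sigma> y - ?D y (z - y)) \<le> norm (z - y) * (H * norm (z - y) powr \<theta>)"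
      proof (rule differentiable_bound_linearization[of y z "cball y (norm (z - y))"])
        show "y + t *\<^sub>R (z - y) \<in> cball y (norm (z - y))" if "t \<in> {0..1}" for t
          using that by (auto simp: dist_norm mult_left_le_one_le)
        show "(\<sigma> has_derivative ?D x) (at x within cball y (norm (z - y)))" for x
          using der by (rule has_derivative_at_withinI)
        show "onorm (?D x - ?D y) \<le> H * norm (z - y) powr \<theta>" if "x \<in> cball y (norm (z - y))" for x
        proof (rule onorm_le)
          fix v
          have "norm (?D x v - ?D y v) \<le> H * norm v * norm (x - y) powr \<theta>" by (rule h1)
          also have "\<dots> \<le> H * norm v * norm (z - y) powr \<theta>"
            using that H \<theta> by (intro mult_left_mono powr_mono2) (auto simp: dist_norm norm_minus_commute)
          finally show "norm ((?D x - ?D y) v) \<le> H * norm (z - y) powr \<theta> * norm v" by (simp add: algebra_simps)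
        qed
      qed auto
      also have "\<dots> = H * norm (z - y) powr (1 + \<theta>)" by (cases "z = y") (auto simp: powr_add)
      also have "\<dots> \<le> B * norm (z - y) powr (1 + \<theta>)" using BB by (intro mult_right_mono) auto
      finally show ?thesis .
    qed
    show "norm (second_order \<sigma> y M) \<le> B * norm M" for y M
    proof -
      have "norm (second_order \<sigma> y M) \<le> c * (b * b) * norm M"
        unfolding second_order_def c_def
      proof (rule norm_tensor_app_le)
        fix i j :: 'd
        have "norm (blinfun_apply (?D y (blinfun_apply (\<sigma> y) (axis i 1))) (axis j 1)) \<le> norm (?D y (blinfun_apply (\<sigma> y) (axis i 1)))"
          using norm_blinfun[of "?D y (blinfun_apply (\<sigma> y) (axis i 1))" "axis j 1"] by simp
        also have "\<dots> \<le> b * norm (blinfun_apply (\<sigma> y) (axis i 1))" by (rule n1)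
        also have "\<dots> \<le> b * b" using ap b by (intro mult_left_mono) auto
        finally show "norm (blinfun_apply (?D y (blinfun_apply (\<sigma> y) (axis i 1))) (axis j 1)) \<le> b * b" .
      qed
      also have "\<dots> \<le> B * norm M" using BB by (intro mult_right_mono) auto
      finally show ?thesis .
    qed
    show "norm (second_order \<sigma> y M - second_order \<sigma> z M) \<le> B * norm (y - z) powr \<theta> * norm M" for y z M
    proof -
      have "norm (second_order \<sigma> y M - second_order \<sigma> z M) \<le>
          c * ((H * b + b * (2 * b)) * norm (y - z) powr \<theta>) * norm M"
        unfolding second_order_def c_def tensor_app_diff_left[symmetric]
      proof (rule norm_tensor_app_le)
        fix i j :: 'd
        let ?a = "axis i 1 :: real ^ 'd" and ?b = "axis j 1 :: real ^ 'd"
        interpret Dz: bounded_linear "?D z" using der by (rule has_derivative_bounded_linear)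
        have eq: "blinfun_apply (?D y (blinfun_apply (\<sigma> y) ?a)) ?b - blinfun_apply (?D z (blinfun_apply (\<sigma> z) ?a)) ?b =
          blinfun_apply ((?D y (blinfun_apply (\<sigma> y) ?a) - ?D z (blinfun_apply (\<sigma> y) ?a)) + ?D z (blinfun_apply (\<sigma> y - \<sigma> z) ?a)) ?b"
          by (simp add: plus_blinfun.rep_eq minus_blinfun.rep_eq Dz.diff)
        have "norm (?D z (blinfun_apply (\<sigma> y - \<sigma> z) ?a)) \<le> b * norm (blinfun_apply (\<sigma> y - \<sigma> z) ?a)" by (rule n1)
        also have "\<dots> \<le> b * norm (\<sigma> y - \<sigma> z)"
          using norm_blinfun[of "\<sigma> y - \<sigma> z" ?a] b by (intro mult_left_mono) auto
        also have "\<dots> \<le> b * (2 * b * norm (y - z) powr \<theta>)" using lip\<theta> b by (intro mult_left_mono) auto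
        finally have 2: "norm (?D z (blinfun_apply (\<sigma> y - \<sigma> z) ?a)) \<le> b * (2 * b * norm (y - z) powr \<theta>)" .
        have "norm (?D y (blinfun_apply (\<sigma> y) ?a) - ?D z (blinfun_apply (\<sigma> y) ?a)) \<le>
          H * norm (blinfun_apply (\<sigma> y) ?a) * norm (y - z) powr \<theta>" by (rule h1)
        also have "\<dots> \<le> H * b * norm (y - z) powr \<theta>" using ap H by (intro mult_right_mono mult_left_mono) auto
        finally have 1: "norm (?D y (blinfun_apply (\<sigma> y) ?a) - ?D z (blinfun_apply (\<sigma> y) ?a)) \<le> H * b * norm (y - z) powr \<theta>" .
        have "norm (blinfun_apply (?D y (blinfun_apply (\<sigma> y) ?a)) ?b - blinfun_apply (?D z (blinfun_apply (\<sigma> z) ?a)) ?b) \<le>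
          norm ((?D y (blinfun_apply (\<sigma> y) ?a) - ?D z (blinfun_apply (\<sigma> y) ?a)) + ?D z (blinfun_apply (\<sigma> y - \<sigma> z) ?a))"
          unfolding eq by (rule order_trans[OF norm_blinfun]) simp
        also have "\<dots> \<le> H * b * norm (y - z) powr \<theta> + b * (2 * b * norm (y - z) powr \<theta>)"
          using 1 2 by (rule norm_triangle_mono)
        finally show "norm (blinfun_apply (?D y (blinfun_apply (\<sigma> y) ?a)) ?b - blinfun_apply (?D z (blinfun_apply (\<sigma> z) ?a)) ?b)
          \<le> (H * b + b * (2 * b)) * norm (y - z) powr \<theta>" by (simp add: algebra_simps)
      qed
      also have "\<dots> = c * (H * b + b * (2 * b)) * (norm (y - z) powr \<theta> * norm M)" by (simp add: algebra_simps)
      also have "\<dots> \<le> B * (norm (y - z) powr \<theta> * norm M)" using BB by (intro mult_right_mono) auto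
      finally show ?thesis by (simp add: algebra_simps)
    qed
  qed
  then show ?thesis using \<theta>(3) by (rule that)
qed

context vector_field begin

lemma has_rough_integral_iff:
  assumes X: "continuous_on {0..T} X" and \<Psi>: "total_var \<Psi> 0 T < \<infinity>" and t: "0 \<le> t" "t \<le> T"
  shows "has_rough_integral \<sigma> X XX Z Z' \<Psi> 0 t I \<longleftrightarrow>
    mesh_limit (\<lambda>u v. blinfun_apply (\<sigma> (Z u + \<Psi> u)) (X v - X u) +
      tensor_app (\<lambda>a b. blinfun_apply (D (Z u + \<Psi> u) (blinfun_apply (Z' u) a)) b) (XX u v)) 0 t I"
    (is "_ \<longleftrightarrow> mesh_limit ?R 0 t I")
proof -
  define Y where "Y u v = tensor_app (\<lambda>a b. blinfun_apply (D (Z u + \<Psi> u) a) b) (young_integral \<Psi> X u v)" for u v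
  define c where "c = real (CARD('n) * CARD('d)) * B"
  have g: "rough_germ \<sigma> X XX Z Z' \<Psi> = (\<lambda>u v. ?R u v + Y u v)"
    by (simp add: fun_eq_iff rough_germ_def Y_def Let_def)
  have Yle: "norm (Y u v) \<le> c * norm (young_integral \<Psi> X u v)" for u v
    unfolding Y_def c_def
  proof (rule norm_tensor_app_le)
    show "norm (blinfun_apply (D (Z u + \<Psi> u) (axis i 1)) (axis j 1)) \<le> B" for i j
      using norm_D_apply[of "Z u + \<Psi> u" "axis i 1" "axis j 1"] by simp
  qed
  have c0: "0 \<le> c" using B by (simp add: c_def)
  have V: "superadditive 0 t (\<lambda>s t. enn2real (total_var \<Psi> s t))"
    by (rule superadditive_subset[OF superadditive_total_var(1)[OF \<Psi>]]) (use t in auto)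
  have V': "norm (\<Psi> v - \<Psi> u) \<le> enn2real (total_var \<Psi> u v)" if "0 \<le> u" "u \<le> v" "v \<le> t" for u v
    by (rule superadditive_total_var(2)[OF \<Psi>]) (use t that in auto)
  have Xt: "continuous_on {0..t} X" using X t by (auto intro: continuous_on_subset)
  have Y0: "mesh_limit Y 0 t 0"
    by (rule mesh_limit_young_germ[OF V V' Xt t(1) c0]) (auto intro: Yle)
  \<comment> \<open>The negative removes the Young part from the germ again, for the forward
    implication.\<close>
  have Y1: "mesh_limit (\<lambda>u v. - Y u v) 0 t 0"
    by (rule mesh_limit_young_germ[OF V V' Xt t(1) c0]) (auto intro: Yle)
  show ?thesis
    unfolding has_rough_integral_def g
    using mesh_limit_add[OF _ Y0, of ?R I] mesh_limit_add[OF _ Y1, of "\<lambda>u v. ?R u v + Y u v" I] by auto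
qed

end

subsection \<open>Equivalence of (P1) and (P2)\<close>

text \<open>A degenerate interval admits only the subdivision with \<open>m = 0\<close>, whose sum
  is empty. This is how the integral equation at time 0 yields \<open>Z 0 = \<xi>\<close>.\<close>

lemma mesh_limit_refl: "mesh_limit \<Xi> s s I \<Longrightarrow> I = 0"
proof -
  assume *: "mesh_limit \<Xi> s s I"
  have m: "m = 0" if "subdivision s s m p" for m p
    using that subdivision_mono[OF that, of 1 m] by (cases m) (auto simp: subdivision_def)
  have "norm I \<le> 0"
  proof (rule mesh_limit_norm_le[OF * order_refl])
    fix m p assume "subdivision s s m p"
    from m[OF this] show "norm (\<Sum>i<m. \<Xi> (p i) (p (Suc i))) \<le> 0" by simp
  qed
  then show ?thesis by simp
qed

lemma control_powr_small:
  assumes "control T \<omega>" "0 < \<beta>" "0 \<le> c" "0 < e"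
  obtains d where "0 < d" "\<And>u v. 0 \<le> u \<Longrightarrow> u \<le> v \<Longrightarrow> v \<le> T \<Longrightarrow> v - u < d \<Longrightarrow> c * \<omega> u v powr \<beta> < e"
proof -
  define w where "w = (e / (c + 1)) powr (1 / \<beta>)"
  have w: "0 < w" using assms(3,4) by (simp add: w_def)
  obtain d where d: "0 < d" "\<And>u v. 0 \<le> u \<Longrightarrow> u \<le> v \<Longrightarrow> v \<le> T \<Longrightarrow> v - u < d \<Longrightarrow> \<omega> u v < w"
    by (rule control_uniformly_small[OF assms(1) w]) (rule that)
  show ?thesis
  proof (rule that[OF d(1)])
    fix u v assume uv: "0 \<le> u" "u \<le> v" "v \<le> T" "v - u < d"
    have "0 \<le> \<omega> u v" using assms(1) uv by (auto simp: control_def)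
    then have "\<omega> u v powr \<beta> \<le> w powr \<beta>" using d(2)[OF uv] assms(2) by (intro powr_mono2) auto
    also have "w powr \<beta> = e / (c + 1)" using assms(2-4) by (simp add: w_def powr_powr)
    finally have "c * \<omega> u v powr \<beta> \<le> c * (e / (c + 1))" using assms(3) by (rule mult_left_mono)
    also have "\<dots> < e" using assms(3,4) by (simp add: field_simps)
    finally show "c * \<omega> u v powr \<beta> < e" .
  qed
qed

lemma holder_path_continuous:
  assumes "control T \<omega>" "0 < \<beta>" "0 \<le> c"
    and x: "\<And>u v. 0 \<le> u \<Longrightarrow> u \<le> v \<Longrightarrow> v \<le> T \<Longrightarrow> norm (x v - x u) \<le> c * \<omega> u v powr \<beta>"
  shows "continuous_on {0..T} x"
  unfolding continuous_on_iff
proof (intro ballI allI impI)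
  fix t e :: real assume t: "t \<in> {0..T}" and "0 < e"
  obtain d where d: "0 < d" "\<And>u v. 0 \<le> u \<Longrightarrow> u \<le> v \<Longrightarrow> v \<le> T \<Longrightarrow> v - u < d \<Longrightarrow> c * \<omega> u v powr \<beta> < e"
    by (rule control_powr_small[OF assms(1-3) \<open>0 < e\<close>]) (rule that)
  show "\<exists>d>0. \<forall>s\<in>{0..T}. dist s t < d \<longrightarrow> dist (x s) (x t) < e"
  proof (intro exI[of _ d] conjI ballI impI d(1))
    fix s assume "s \<in> {0..T}" "dist s t < d"
    then show "dist (x s) (x t) < e"
      using d(2)[of s t] d(2)[of t s] x[of s t] x[of t s] t
      by (cases "s \<le> t") (auto simp: dist_norm norm_minus_commute)
  qed
qed

lemma rough_path_increments:
  assumes "rough_path T \<omega> \<beta> X XX" "0 \<le> u" "u \<le> v" "v \<le> T"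
  shows "norm (X v - X u) \<le> enn2real (holder T \<omega> \<beta> X) * \<omega> u v powr \<beta>"
    "norm (XX u v) \<le> enn2real (holder2 T \<omega> (2 * \<beta>) XX) * \<omega> u v powr (2 * \<beta>)"
  using norm_le_holder2[of T \<omega> \<beta> "\<lambda>u v. X v - X u"] norm_le_holder2[of T \<omega> "2 * \<beta>" XX] assms
  by (auto simp: rough_path_def holder_def)

lemma rough_path_continuous:
  assumes "rough_path T \<omega> \<beta> X XX" "0 < \<beta>" shows "continuous_on {0..T} X"
  by (rule holder_path_continuous[of T \<omega> \<beta>, OF _ assms(2) enn2real_nonneg rough_path_increments(1)[OF assms(1)]])
     (use assms in \<open>auto simp: rough_path_def\<close>)

locale reflected_rde = reflected_mapping T C N \<xi> \<rho>' \<rho>'' \<kappa> \<kappa>' + vector_field \<sigma> B \<theta>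
  for T :: real and C :: "(real \<Rightarrow> real ^ 'n) \<Rightarrow> (real \<Rightarrow> real ^ 'n)" and N :: 'n and \<xi> and \<rho>' \<rho>'' \<kappa> \<kappa>'
    and \<sigma> :: "real ^ 'n \<Rightarrow> (real ^ 'd) \<Rightarrow>\<^sub>L (real ^ 'n)" and B \<theta> +
  fixes \<omega> :: "real \<Rightarrow> real \<Rightarrow> real" and \<beta> :: real and X :: "real \<Rightarrow> real ^ 'd" and XX :: "real \<Rightarrow> real \<Rightarrow> real ^ 'd ^ 'd"
  assumes rough: "rough_path T \<omega> \<beta> X XX" and \<beta>: "0 < \<beta>"
begin

abbreviation "via \<equiv> P1_solution_via T \<omega> \<beta> X XX \<sigma> \<xi> C N"
abbreviation "P1 \<equiv> P1_solutions T \<omega> \<beta> X XX \<sigma> \<xi> C N"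
abbreviation "P2 \<equiv> P2_solutions T \<omega> \<beta> X XX \<sigma> \<xi> C N"

lemma X_continuous: "continuous_on {0..T} X"
  using rough \<beta> by (rule rough_path_continuous)

lemma rough_integral_start: "has_rough_integral \<sigma> X XX Z Z' \<Psi> 0 0 (Z 0 - \<xi>) \<Longrightarrow> Z 0 = \<xi>"
  using mesh_limit_refl[of _ 0 "Z 0 - \<xi>"] by (auto simp: has_rough_integral_def)

text \<open>The path \<open>?w\<close> satisfies \<open>?w + C_tilde ?w = Y\<close>, hence
  \<open>C Y = C_tilde ?w\<close>. With this substitution the fixed point equation of
  \<open>M_map\<close> says that \<open>L_tilde Z\<close> is the running maximum for
  \<open>Z + C Y\<close>, and \<open>ell_reflection_term\<close> applies.\<close>

lemma P2_structure:
  assumes Z: "(Z, Z') \<in> P2"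
  defines "Y \<equiv> \<lambda>t. Z t + At Z t"
  shows "Z \<in> paths T" "Z 0 = \<xi>" "Y \<in> paths T" "At Z = (\<lambda>t. C Y t + Lt Z t *\<^sub>R e)"
    "Lt Z = ell T N (\<lambda>s. Z s + C Y s)" "reflection_term T N Y (Lt Z)"
    "via (Y, Lt Z) (Z, Z')"
proof -
  have cp: "(Z, Z') \<in> controlled_paths T \<omega> \<beta> X" and Z': "\<forall>t\<in>{0..T}. Z' t = \<sigma> (Z t + At Z t)"
    and int: "\<forall>t\<in>{0..T}. has_rough_integral \<sigma> X XX Z Z' (At Z) 0 t (Z t - \<xi>)"
    using Z by (auto simp: P2_solutions_def)
  show Zp: "Z \<in> paths T" using cp by (auto simp: controlled_paths_def holder_paths_def)
  show Z0: "Z 0 = \<xi>" using int T by (intro rough_integral_start) auto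
  note L = L_tilde[OF Zp Z0]
  show Yp: "Y \<in> paths T" unfolding Y_def by (intro paths_add Zp A_tilde_path Z0)
  let ?w = "\<lambda>t. Z t + Lt Z t *\<^sub>R e"
  have w: "?w \<in> paths T" by (intro shifted_path Zp L)
  have "(\<lambda>t. ?w t + Ct ?w t) = Y" by (auto simp: Y_def A_tilde_def)
  then have CY: "C Y = Ct ?w" using C_tilde_fixpoint(2)[OF w] by simp
  show A: "At Z = (\<lambda>t. C Y t + Lt Z t *\<^sub>R e)" by (auto simp: A_tilde_def CY)
  show ell: "Lt Z = ell T N (\<lambda>s. Z s + C Y s)" using L(3) by (simp add: M_map_def CY)
  have Yt: "Y t = Z t + At Z t" for t by (simp add: Y_def)
  have YA: "Y t = Z t + C Y t + Lt Z t *\<^sub>R e" for t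
    using Yt[of t] fun_cong[OF A, of t] by (simp only: add.assoc)
  have "reflection_term T N Y (ell T N (\<lambda>s. Z s + C Y s))"
  proof (rule ell_reflection_term)
    show "continuous_on {0..T} (\<lambda>s. (Z s + C Y s) $ N)"
      by (intro paths_nth_continuous paths_add Zp C_path Yp)
    show "0 \<le> (Z 0 + C Y 0) $ N" using initial_nonneg[OF w] Z0 L(2) by (simp add: CY)
    show "Y t $ N = (Z t + C Y t) $ N + ell T N (\<lambda>s. Z s + C Y s) t" for t
      using arg_cong[OF YA[of t], of "\<lambda>v. v $ N"] by (simp add: ell[symmetric])
  qed (use T in auto)
  then show R: "reflection_term T N Y (Lt Z)" by (simp add: ell[symmetric])
  show "via (Y, Lt Z) (Z, Z')"
    unfolding P1_solution_via_def prod.case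
  proof (intro conjI ballI Yp R cp)
    fix t assume t: "t \<in> {0..T}"
    show "Y t = Z t + C Y t + Lt Z t *\<^sub>R e" by (rule YA)
    show "Z' t = \<sigma> (Y t)" using Z' t by (simp only: Yt)
    show "has_rough_integral \<sigma> X XX Z Z' (\<lambda>s. C Y s + Lt Z s *\<^sub>R e) 0 t (Z t - \<xi>)"
      using int t by (simp only: A)
  qed
qed

lemma P1_structure:
  assumes via: "via (Y, \<Phi>) (Z, Z')"
  shows "Z \<in> paths T" "Z 0 = \<xi>" "\<Phi> = Lt Z" "At Z = (\<lambda>t. C Y t + \<Phi> t *\<^sub>R e)" "Y = (\<lambda>t. Z t + At Z t)"
    "(Z, Z') \<in> P2" "total_var (At Z) 0 T < \<infinity>"
proof -
  have Yp: "Y \<in> paths T" and R: "reflection_term T N Y \<Phi>" and cp: "(Z, Z') \<in> controlled_paths T \<omega> \<beta> X"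
    and Y: "\<forall>t\<in>{0..T}. Y t = Z t + C Y t + \<Phi> t *\<^sub>R e" and Z': "\<forall>t\<in>{0..T}. Z' t = \<sigma> (Y t)"
    and int: "\<forall>t\<in>{0..T}. has_rough_integral \<sigma> X XX Z Z' (\<lambda>s. C Y s + \<Phi> s *\<^sub>R e) 0 t (Z t - \<xi>)"
    using via unfolding P1_solution_via_def by blast+
  show Zp: "Z \<in> paths T" using cp by (auto simp: controlled_paths_def holder_paths_def)
  show Z0: "Z 0 = \<xi>" using int T by (intro rough_integral_start) auto
  have \<Phi>: "\<Phi> \<in> paths T" "\<Phi> 0 = 0" using R unfolding reflection_term_def by blast+
  note CYp = C_path[OF Yp]
  \<comment> \<open>The equation is given on \<open>[0,T]\<close> only; both sides vanish elsewhere,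
    which makes it an equality of functions, as \<open>C_tilde_eq\<close> demands.\<close>
  have Y': "Y = (\<lambda>t. (Z t + \<Phi> t *\<^sub>R e) + C Y t)"
    using Y by (intro paths_eqI[OF Yp] paths_add Zp paths_scaleR \<Phi> CYp) (auto simp: algebra_simps)
  have w: "(\<lambda>t. Z t + \<Phi> t *\<^sub>R e) \<in> paths T" by (intro shifted_path Zp \<Phi>)
  have CY: "Ct (\<lambda>t. Z t + \<Phi> t *\<^sub>R e) = C Y" by (rule C_tilde_eq[OF w Yp Y'])
  have cont: "continuous_on {0..T} (\<lambda>s. (Z s + C Y s) $ N)"
    by (intro paths_nth_continuous paths_add Zp CYp)
  have "\<Phi> = ell T N (\<lambda>s. Z s + C Y s)"
  proof (rule paths_eqI[OF \<Phi>(1)])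
    show "ell T N (\<lambda>s. Z s + C Y s) \<in> paths T" using T cont by (intro ell_path) auto
    show "\<Phi> t = ell T N (\<lambda>s. Z s + C Y s) t" if "0 \<le> t" "t \<le> T" for t
    proof (rule reflection_term_eq_ell[OF cont R _ that])
      show "Y t $ N = (Z t + C Y t) $ N + \<Phi> t" if "0 \<le> t" "t \<le> T" for t
      proof -
        have "Y t = Z t + C Y t + \<Phi> t *\<^sub>R e" using Y that by simp
        then show ?thesis by simp
      qed
    qed
  qed
  then have eq: "ell T N (\<lambda>s. Z s + C Y s) = \<Phi>" ..
  have "M_map T C N Z \<Phi> = \<Phi>" by (simp only: M_map_def CY eq)
  then show L: "\<Phi> = Lt Z" using L_tilde_eqI[OF Zp Z0 \<Phi>] by simp
  show A: "At Z = (\<lambda>t. C Y t + \<Phi> t *\<^sub>R e)" by (auto simp: A_tilde_def CY L[symmetric])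
  show YA: "Y = (\<lambda>t. Z t + At Z t)"
  proof
    fix t
    have "Y t = (Z t + \<Phi> t *\<^sub>R e) + C Y t" using fun_cong[OF Y', of t] .
    also have "\<dots> = Z t + At Z t" using fun_cong[OF A, of t] by simp
    finally show "Y t = Z t + At Z t" .
  qed
  have Yt: "Y t = Z t + At Z t" for t using fun_cong[OF YA, of t] by simp
  show "(Z, Z') \<in> P2"
    unfolding P2_solutions_def mem_Collect_eq prod.case
  proof (intro conjI ballI cp)
    fix t assume t: "t \<in> {0..T}"
    show "Z' t = \<sigma> (Z t + At Z t)" using Z' t by (simp only: Yt[symmetric])
    show "has_rough_integral \<sigma> X XX Z Z' (At Z) 0 t (Z t - \<xi>)" using int t by (simp only: A)
  qed
  have "total_var (\<lambda>r. \<Phi> r *\<^sub>R e) 0 T \<le> ennreal ((\<Phi> T - \<Phi> 0) * norm e)"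
    using L_tilde_increment(1)[OF Zp Z0] by (intro total_var_mono_scaleR) (auto simp: L)
  then have "total_var (\<lambda>t. C Y t + \<Phi> t *\<^sub>R e) 0 T \<le> total_var (C Y) 0 T + ennreal ((\<Phi> T - \<Phi> 0) * norm e)"
    by (intro order_trans[OF total_var_add] add_left_mono)
  also have "\<dots> < \<infinity>" using C_bv[OF Yp] by simp
  finally show "total_var (At Z) 0 T < \<infinity>" unfolding A .
qed

text \<open>Without its Young part the germ involves \<open>Z\<close> only through \<open>Y\<close>
  and \<open>Z' = \<sigma> (Y)\<close>, so both candidates are mesh limits of the same germ,
  whatever \<open>\<Phi>\<^sub>1\<close> and \<open>\<Phi>\<^sub>2\<close> are.\<close>

lemma P1_controlled_path_unique:
  assumes via: "via (Y, \<Phi>\<^sub>1) W\<^sub>1" "via (Y, \<Phi>\<^sub>2) W\<^sub>2"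
  shows "W\<^sub>1 = W\<^sub>2"
proof -
  obtain Z1 Z1' Z2 Z2' where W: "W\<^sub>1 = (Z1, Z1')" "W\<^sub>2 = (Z2, Z2')" by (metis surj_pair)
  note v1 = via(1)[unfolded W] and v2 = via(2)[unfolded W]
  note s1 = P1_structure[OF v1] and s2 = P1_structure[OF v2]
  have p: "Z1' \<in> paths T" "Z2' \<in> paths T"
    and Z': "\<forall>t\<in>{0..T}. Z1' t = \<sigma> (Y t)" "\<forall>t\<in>{0..T}. Z2' t = \<sigma> (Y t)"
    using v1 v2 by (auto simp: P1_solution_via_def controlled_paths_def holder_paths_def)
  have eq': "Z1' = Z2'" by (rule paths_eqI[OF p]) (use Z' in auto)
  let ?R = "\<lambda>u v. blinfun_apply (\<sigma> (Y u)) (X v - X u) +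
      tensor_app (\<lambda>a b. blinfun_apply (D (Y u) (blinfun_apply (Z1' u) a)) b) (XX u v)"
  have m: "mesh_limit ?R 0 t (Z t - \<xi>)" if t: "0 \<le> t" "t \<le> T" and v: "via (Y, \<Phi>) (Z, Z1')" for t Z \<Phi>
  proof -
    note s = P1_structure[OF v]
    have "has_rough_integral \<sigma> X XX Z Z1' (At Z) 0 t (Z t - \<xi>)"
      using s(6) t by (auto simp: P2_solutions_def)
    then show ?thesis
      unfolding has_rough_integral_iff[OF X_continuous s(7) t] by (simp only: fun_cong[OF s(5), symmetric])
  qed
  have "Z1 = Z2"
  proof (rule paths_eqI[OF s1(1) s2(1)])
    fix t assume t: "0 \<le> t" "t \<le> T"
    have "Z1 t - \<xi> = Z2 t - \<xi>"
      using mesh_limit_unique[OF m[OF t v1] m[OF t v2[folded eq']] t(1)] .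
    then show "Z1 t = Z2 t" by simp
  qed
  then show ?thesis using eq' W by simp
qed

lemma P1_to_P2_eq:
  assumes "via S W" shows "P1_to_P2 T \<omega> \<beta> X XX \<sigma> \<xi> C N S = W"
proof -
  obtain Y \<Phi> where S: "S = (Y, \<Phi>)" by (cases S)
  show ?thesis unfolding P1_to_P2_def
    using assms P1_controlled_path_unique unfolding S by (intro the_equality)
qed

lemma P2_to_P1_via: "W \<in> P2 \<Longrightarrow> via (P2_to_P1 T C N W) W"
  using P2_structure(7) by (cases W) (auto simp: P2_to_P1_def)

lemma P1_via_P2: "via S W \<Longrightarrow> W \<in> P2" and P2_to_P1_eq: "via S W \<Longrightarrow> P2_to_P1 T C N W = S"
proof -
  assume v: "via S W"
  obtain Y \<Phi> Z Z' where S: "S = (Y, \<Phi>)" "W = (Z, Z')" by (metis surj_pair)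
  note s = P1_structure[OF v[unfolded S]]
  show "W \<in> P2" using s(6) S by simp
  show "P2_to_P1 T C N W = S" unfolding S P2_to_P1_def using s(3,5) by simp
qed

lemma P1I: "via S W \<Longrightarrow> S \<in> P1"
  unfolding P1_solutions_def mem_Collect_eq by (rule exI)

lemma P1E:
  assumes "S \<in> P1" obtains W where "via S W"
  using assms unfolding P1_solutions_def mem_Collect_eq by (rule exE)

lemma P1_P2_uniqueness: "(\<exists>\<^sub>\<le>\<^sub>1S. S \<in> P1) \<longleftrightarrow> (\<exists>\<^sub>\<le>\<^sub>1W. W \<in> P2)"
proof
  assume P: "\<exists>\<^sub>\<le>\<^sub>1S. S \<in> P1"
  show "\<exists>\<^sub>\<le>\<^sub>1W. W \<in> P2"
  proof (rule Uniq_I)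
    fix W V assume "W \<in> P2" "V \<in> P2"
    then have v: "via (P2_to_P1 T C N W) W" "via (P2_to_P1 T C N V) V" by (auto intro: P2_to_P1_via)
    have "P2_to_P1 T C N W = P2_to_P1 T C N V"
      by (rule Uniq_D[OF P P1I[OF v(1)] P1I[OF v(2)]])
    then show "V = W" by (metis P1_to_P2_eq v)
  qed
next
  assume P: "\<exists>\<^sub>\<le>\<^sub>1W. W \<in> P2"
  show "\<exists>\<^sub>\<le>\<^sub>1S. S \<in> P1"
  proof (rule Uniq_I)
    fix S R assume "S \<in> P1" "R \<in> P1"
    then obtain W V where v: "via S W" "via R V" by (meson P1E)
    have "W = V" by (rule Uniq_D[OF P P1_via_P2[OF v(1)] P1_via_P2[OF v(2)]])
    then show "R = S" by (metis P2_to_P1_eq v)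
  qed
qed

end

subsection \<open>Davie estimate for the Euler scheme\<close>

text \<open>Davie's induction on \<open>j - i\<close>, with two error terms. A balanced split leaves
  \<open>J i m\<close>, \<open>J (Suc m) j\<close> and two defects. The pure power reappears on both
  sides, at the cost \<open>2 * 2 powr (- a)\<close>, which is below 1 only for
  \<open>a > 1\<close>. The term with \<open>V\<close> is superadditive across the split and costs
  \<open>2 powr (- b)\<close> only, so any \<open>b > 0\<close> does. The margins pay for the
  defects. \<open>step\<close> may use the bound inside \<open>[i,k]\<close> only, where the
  induction supplies it.\<close>

lemma discrete_sewing:
  fixes J :: "nat \<Rightarrow> nat \<Rightarrow> 'a::real_normed_vector" and w V :: "nat \<Rightarrow> nat \<Rightarrow> real"
  assumes w: "\<And>i j. i \<le> j \<Longrightarrow> j \<le> n \<Longrightarrow> 0 \<le> w i j"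
      "\<And>i k j. i \<le> k \<Longrightarrow> k \<le> j \<Longrightarrow> j \<le> n \<Longrightarrow> w i k + w k j \<le> w i j"
    and V: "\<And>i j. i \<le> j \<Longrightarrow> j \<le> n \<Longrightarrow> 0 \<le> V i j"
      "\<And>i k j. i \<le> k \<Longrightarrow> k \<le> j \<Longrightarrow> j \<le> n \<Longrightarrow> V i k + V k j \<le> V i j"
    and ab: "0 < a" "0 < b" and L: "0 \<le> L" "0 \<le> L'" and \<epsilon>0: "0 \<le> \<epsilon>\<^sub>1" "0 \<le> \<epsilon>\<^sub>2"
    and \<epsilon>: "2 * \<epsilon>\<^sub>1 + 2 * 2 powr (- a) \<le> 1" "2 * \<epsilon>\<^sub>2 + 2 powr (- b) \<le> 1"
    and J: "\<And>i. J i i = 0" "\<And>i. i < n \<Longrightarrow> J i (Suc i) = 0"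
    and step: "\<And>i k j. i \<le> k \<Longrightarrow> k \<le> j \<Longrightarrow> j \<le> n \<Longrightarrow> w i j \<le> h \<Longrightarrow>
      (\<And>p q. i \<le> p \<Longrightarrow> p \<le> q \<Longrightarrow> q \<le> k \<Longrightarrow> norm (J p q) \<le> L * w p q powr a + L' * V p q * w p q powr b) \<Longrightarrow>
      norm (J i j - J i k - J k j) \<le> \<epsilon>\<^sub>1 * (L * w i j powr a) + \<epsilon>\<^sub>2 * (L' * V i j * w i j powr b)"
    and ij: "i \<le> j" "j \<le> n" "w i j \<le> h"
  shows "norm (J i j) \<le> L * w i j powr a + L' * V i j * w i j powr b"
  using ij
proof (induction "j - i" arbitrary: i j rule: less_induct)
  case (less i j)
  have P0: "0 \<le> L * w p q powr a + L' * V p q * w p q powr b" if "p \<le> q" "q \<le> n" for p q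
    using V(1)[OF that] L by (intro add_nonneg_nonneg mult_nonneg_nonneg) auto
  have wm: "w p q \<le> w i j" if "i \<le> p" "p \<le> q" "q \<le> j" for p q
    using w(2)[of i p j] w(2)[of p q j] w(1)[of i p] w(1)[of q j] that less.prems by linarith
  have Vm: "V p q \<le> V i j" if "i \<le> p" "p \<le> q" "q \<le> j" for p q
    using V(2)[of i p j] V(2)[of p q j] V(1)[of i p] V(1)[of q j] that less.prems by linarith
  show ?case
  proof (cases "j \<le> Suc i")
    case True
    then have "j = i \<or> j = Suc i" using less.prems by auto
    then have "J i j = 0" using J less.prems by auto
    then show ?thesis using P0[of i j] less.prems by simp
  next
    case False
    define W where "W = w i j"
    have W0: "0 \<le> W" unfolding W_def using less.prems by (intro w) auto
    have wii: "w p p = 0" if "p \<le> n" for p using w(2)[of p p p] w(1)[of p p] that by auto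
    \<comment> \<open>The largest element \<open>m\<close> is the last index before \<open>j\<close>
      whose left part carries at most half of \<open>W\<close>. By maximality the part from
      \<open>Suc m\<close> on also carries at most half; the cell between may be large, but
      \<open>J\<close> vanishes on it.\<close>
    define S where "S = {m. i \<le> m \<and> m < j \<and> w i m \<le> W / 2}"
    have S: "finite S" "i \<in> S" using False less.prems W0 wii[of i] by (auto simp: S_def)
    define m where "m = Max S"
    have "m \<in> S" unfolding m_def using S by (intro Max_in) auto
    then have m: "i \<le> m" "m < j" "w i m \<le> W / 2" by (auto simp: S_def)
    have m': "w (Suc m) j \<le> W / 2"
    proof (cases "Suc m = j")
      case True
      then show ?thesis using W0 wii[of j] less.prems by simp
    next
      case F: False
      have "Suc m \<notin> S" using Max_ge[OF S(1), of "Suc m"] by (auto simp: m_def)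
      then have "W / 2 < w i (Suc m)" using F m by (auto simp: S_def)
      then show ?thesis using w(2)[of i "Suc m" j] m less.prems by (simp add: W_def)
    qed
    have half: "w p q powr c \<le> 2 powr (- c) * W powr c" if "w p q \<le> W / 2" "p \<le> q" "q \<le> n" "0 < c" for p q c
    proof -
      have "w p q powr c \<le> (W / 2) powr c" using that w(1)[of p q] by (intro powr_mono2) auto
      also have "\<dots> = 2 powr (- c) * W powr c" using W0 by (simp add: powr_divide powr_minus_divide)
      finally show ?thesis .
    qed
    have sub: "norm (J p q) \<le> 2 powr (- a) * (L * W powr a) + 2 powr (- b) * (L' * V p q * W powr b)"
      if "i \<le> p" "p \<le> q" "q \<le> j" "q - p < j - i" "w p q \<le> W / 2" for p q
    proof -
      have q: "q \<le> n" using that less.prems by simp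
      have "norm (J p q) \<le> L * w p q powr a + L' * V p q * w p q powr b"
        using that less.prems wm[of p q] q by (intro less.hyps) auto
      also have "\<dots> \<le> L * (2 powr (- a) * W powr a) + L' * V p q * (2 powr (- b) * W powr b)"
        using that q V(1)[of p q] L ab by (intro add_mono mult_left_mono half) auto
      finally show ?thesis by (simp add: algebra_simps)
    qed
    have Jim: "norm (J i m) \<le> 2 powr (- a) * (L * W powr a) + 2 powr (- b) * (L' * V i m * W powr b)"
      using m by (intro sub) auto
    have Jmj: "norm (J (Suc m) j) \<le> 2 powr (- a) * (L * W powr a) + 2 powr (- b) * (L' * V (Suc m) j * W powr b)"
      using m m' by (intro sub) auto
    have IH: "norm (J p q) \<le> L * w p q powr a + L' * V p q * w p q powr b"
      if "i \<le> p" "p \<le> q" "q \<le> j" "q - p < j - i" for p q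
      using that wm[of p q] less.prems by (intro less.hyps) auto
    have d1: "norm (J i j - J i m - J m j) \<le> \<epsilon>\<^sub>1 * (L * w i j powr a) + \<epsilon>\<^sub>2 * (L' * V i j * w i j powr b)"
    proof (rule step)
      fix p q assume "i \<le> p" "p \<le> q" "q \<le> m"
      then show "norm (J p q) \<le> L * w p q powr a + L' * V p q * w p q powr b" using m by (intro IH) auto
    qed (use m less.prems in auto)
    have "norm (J m j - J m (Suc m) - J (Suc m) j) \<le> \<epsilon>\<^sub>1 * (L * w m j powr a) + \<epsilon>\<^sub>2 * (L' * V m j * w m j powr b)"
    proof (rule step)
      show "w m j \<le> h" using wm[of m j] m less.prems by simp
      fix p q assume "m \<le> p" "p \<le> q" "q \<le> Suc m"
      then show "norm (J p q) \<le> L * w p q powr a + L' * V p q * w p q powr b" using m False by (intro IH) auto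
    qed (use m less.prems in auto)
    also have "\<dots> \<le> \<epsilon>\<^sub>1 * (L * w i j powr a) + \<epsilon>\<^sub>2 * (L' * V i j * w i j powr b)"
      using wm[of m j] Vm[of m j] w(1)[of m j] V(1)[of m j] V(1)[of i j] m less.prems L \<epsilon>0 ab
      by (intro add_mono mult_left_mono mult_mono powr_mono2) auto
    finally have d2: "norm (J m j - J m (Suc m) - J (Suc m) j) \<le> \<epsilon>\<^sub>1 * (L * W powr a) + \<epsilon>\<^sub>2 * (L' * V i j * W powr b)"
      by (simp add: W_def)
    have Jm: "J m (Suc m) = 0" using m less.prems by (intro J(2)) auto
    have split: "J i j = (J i j - J i m - J m j) + (J m j - J m (Suc m) - J (Suc m) j) + J i m + J (Suc m) j"
      using Jm by simp
    have "norm (J i j) \<le> norm (J i j - J i m - J m j) + norm (J m j - J m (Suc m) - J (Suc m) j)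
        + norm (J i m) + norm (J (Suc m) j)"
      by (subst split) (intro norm_triangle_le add_right_mono, simp)
    also have "\<dots> \<le> (2 * \<epsilon>\<^sub>1 + 2 * 2 powr (- a)) * (L * W powr a) +
      (2 * \<epsilon>\<^sub>2 * (L' * V i j * W powr b) + 2 powr (- b) * (L' * (V i m + V (Suc m) j) * W powr b))"
      using d1 d2 Jim Jmj by (simp add: W_def algebra_simps)
    also have "\<dots> \<le> 1 * (L * W powr a) + (2 * \<epsilon>\<^sub>2 * (L' * V i j * W powr b) + 2 powr (- b) * (L' * V i j * W powr b))"
    proof (intro add_mono mult_right_mono mult_left_mono \<epsilon> order_refl)
      show "V i m + V (Suc m) j \<le> V i j"
        using V(2)[of i m j] V(2)[of m "Suc m" j] V(1)[of m "Suc m"] m less.prems by auto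
    qed (use L \<epsilon>0 V(1)[of i j] less.prems in auto)
    also have "\<dots> = L * W powr a + (2 * \<epsilon>\<^sub>2 + 2 powr (- b)) * (L' * V i j * W powr b)" by (simp add: algebra_simps)
    also have "\<dots> \<le> L * W powr a + 1 * (L' * V i j * W powr b)"
      using L V(1)[of i j] less.prems by (intro add_mono mult_right_mono \<epsilon> order_refl) auto
    finally show ?thesis by (simp add: W_def)
  qed
qed

text \<open>\<open>18 B w\<^sup>\<beta>\<close> will bound the oscillation of an Euler path and \<open>M w\<^sup>\<beta>\<close> that of \<open>Y\<close>, both independently of
  \<open>L\<close> and \<open>L'\<close>.  One can therefore fix \<open>L\<close> and \<open>L'\<close> large and afterwards take \<open>h\<close> small.\<close>

locale davie_constants = vector_field \<sigma> B \<theta>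
  for \<sigma> :: "real ^ 'n \<Rightarrow> (real ^ 'd) \<Rightarrow>\<^sub>L (real ^ 'n)" and B \<theta> +
  fixes \<beta> CA M a h L L' \<epsilon>\<^sub>1 \<epsilon>\<^sub>2 :: real
  assumes \<beta>: "0 < \<beta>" and a: "a = (2 + \<theta>) * \<beta>" "1 < a" and CA: "0 \<le> CA"
    and M: "M = 18 * B * (1 + CA)"
    and h: "0 < h" "h \<le> 1" and L: "0 \<le> L" "0 \<le> L'" and \<epsilon>0: "0 \<le> \<epsilon>\<^sub>1" "0 \<le> \<epsilon>\<^sub>2"
    and \<epsilon>: "2 * \<epsilon>\<^sub>1 + 2 * 2 powr (- a) \<le> 1" "2 * \<epsilon>\<^sub>2 + 2 powr (- \<beta>) \<le> 1"
    and hL: "L * h powr \<beta> \<le> 1" "L' * CA * h powr \<beta> \<le> 1 / 2"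
      "B * M ^ 2 + B * B + B * M + B * h powr \<beta> * L \<le> \<epsilon>\<^sub>1 * L"
      "B + B * h powr \<beta> * L' \<le> \<epsilon>\<^sub>2 * L'"

text \<open>Order of choice: \<open>M\<close>, the margins, \<open>L\<close> and \<open>L'\<close>,
  then \<open>h\<close>. The margin \<open>\<epsilon>\<^sub>1\<close> is positive because
  \<open>(2 + \<theta>) * \<beta> > 1\<close>. Half of \<open>\<epsilon>\<^sub>1 * L\<close> pays
  for the constant \<open>c\<close>, the other half for \<open>B * h powr \<beta> * L\<close> as
  soon as \<open>B * h powr \<beta> \<le> \<epsilon>\<^sub>1 / 2\<close>; \<open>L'\<close> is
  treated in the same way.\<close>

lemma (in vector_field) davie_constants_exist:
  assumes \<beta>: "0 < \<beta>" "1 < (2 + \<theta>) * \<beta>" and CA: "0 \<le> CA"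
  shows "\<exists>M h L L' \<epsilon>\<^sub>1 \<epsilon>\<^sub>2. davie_constants \<sigma> B \<theta> \<beta> CA M ((2 + \<theta>) * \<beta>) h L L' \<epsilon>\<^sub>1 \<epsilon>\<^sub>2"
proof -
  define a where "a = (2 + \<theta>) * \<beta>"
  define M where "M = 18 * B * (1 + CA)"
  define c where "c = B * M ^ 2 + B * B + B * M"
  have M0: "0 \<le> M" using B CA by (simp add: M_def)
  have c0: "0 \<le> c" using B M0 by (simp add: c_def)
  define \<epsilon>\<^sub>1 where "\<epsilon>\<^sub>1 = (1 - 2 * 2 powr (- a)) / 2"
  define \<epsilon>\<^sub>2 where "\<epsilon>\<^sub>2 = (1 - 2 powr (- \<beta>)) / 2"
  have "2 * 2 powr (- a) = 2 powr (1 - a)" by (simp add: powr_diff powr_minus_divide)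
  also have "\<dots> < 2 powr 0" using \<beta> by (intro powr_less_mono) (auto simp: a_def)
  finally have e1: "0 < \<epsilon>\<^sub>1" by (simp add: \<epsilon>\<^sub>1_def)
  have "2 powr (- \<beta>) < 2 powr (0::real)" using \<beta> by (intro powr_less_mono) auto
  then have e2: "0 < \<epsilon>\<^sub>2" by (simp add: \<epsilon>\<^sub>2_def)
  define L where "L = 2 * c / \<epsilon>\<^sub>1"
  define L' where "L' = 2 * B / \<epsilon>\<^sub>2"
  have L0: "0 \<le> L" "0 \<le> L'" using c0 e1 e2 B by (auto simp: L_def L'_def)
  \<comment> \<open>\<open>q\<close> is the value of \<open>h powr \<beta>\<close>; its five bounds
    give, in turn, \<open>h \<le> 1\<close>, the smallness conditions with \<open>L\<close> and
    \<open>L'\<close>, and the absorption into \<open>\<epsilon>\<^sub>1\<close> and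
    \<open>\<epsilon>\<^sub>2\<close>.\<close>
  define q where "q = Min {1, 1 / (1 + L), 1 / (2 * (1 + L' * CA)), \<epsilon>\<^sub>1 / (2 * B), \<epsilon>\<^sub>2 / (2 * B)}"
  have LC: "0 \<le> L' * CA" using L0 CA by simp
  have q: "0 < q" "q \<le> 1" "q \<le> 1 / (1 + L)" "q \<le> 1 / (2 * (1 + L' * CA))" "q \<le> \<epsilon>\<^sub>1 / (2 * B)" "q \<le> \<epsilon>\<^sub>2 / (2 * B)"
    using e1 e2 B L0 LC by (auto simp: q_def)
  define h where "h = q powr (1 / \<beta>)"
  have h: "0 < h" "h \<le> 1" "h powr \<beta> = q"
    using q \<beta> by (auto simp: h_def powr_powr powr_le1)
  have "davie_constants \<sigma> B \<theta> \<beta> CA M a h L L' \<epsilon>\<^sub>1 \<epsilon>\<^sub>2"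
  proof (unfold_locales, goal_cases)
    case 12
    show ?case by (simp add: \<epsilon>\<^sub>1_def field_simps)
  next
    case 13
    show ?case by (simp add: \<epsilon>\<^sub>2_def field_simps)
  next
    case 14
    have "L * q \<le> L * (1 / (1 + L))" using q L0 by (intro mult_left_mono) auto
    also have "\<dots> \<le> 1" using L0 by (simp add: divide_le_eq)
    finally show ?case by (simp add: h)
  next
    case 15
    have "L' * CA * q \<le> L' * CA * (1 / (2 * (1 + L' * CA)))" using q LC by (intro mult_left_mono) auto
    also have "\<dots> \<le> 1 / 2" using LC by (simp add: divide_le_eq)
    finally show ?case by (simp add: h)
  next
    case 16
    have "B * q \<le> \<epsilon>\<^sub>1 / 2" using q(5) B by (simp add: field_simps)
    then have "B * q * L \<le> \<epsilon>\<^sub>1 / 2 * L" using L0(1) by (rule mult_right_mono)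
    moreover have "c = \<epsilon>\<^sub>1 / 2 * L" using e1 by (simp add: L_def)
    ultimately have "c + B * q * L \<le> \<epsilon>\<^sub>1 * L" by linarith
    then show ?case by (simp add: h c_def)
  next
    case 17
    have "B * q \<le> \<epsilon>\<^sub>2 / 2" using q(6) B by (simp add: field_simps)
    then have "B * q * L' \<le> \<epsilon>\<^sub>2 / 2 * L'" using L0(2) by (rule mult_right_mono)
    moreover have "B = \<epsilon>\<^sub>2 / 2 * L'" using e2 by (simp add: L'_def)
    ultimately have "B + B * q * L' \<le> \<epsilon>\<^sub>2 * L'" by linarith
    then show ?case by (simp add: h)
  qed (use \<beta> CA h L0 e1 e2 in \<open>auto simp: a_def M_def\<close>)
  then show ?thesis unfolding a_def by blast
qed

text \<open>\<open>w\<close> is the control rescaled so that \<open>X\<close> and \<open>XX\<close>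
  have constants 1, and \<open>A\<close> stands for \<open>A_tilde\<close>. \<open>KA\<close> is
  kept apart from the parameters of \<open>davie_constants\<close>: it serves non-anticipation and
  convergence, not the quantitative bounds.\<close>

locale davie = davie_constants \<sigma> B \<theta> \<beta> CA M a h L L' \<epsilon>\<^sub>1 \<epsilon>\<^sub>2
  for \<sigma> :: "real ^ 'n \<Rightarrow> (real ^ 'd) \<Rightarrow>\<^sub>L (real ^ 'n)" and B \<theta> \<beta> CA M a h L L' \<epsilon>\<^sub>1 \<epsilon>\<^sub>2 +
  fixes T KA :: real and w :: "real \<Rightarrow> real \<Rightarrow> real" and X :: "real \<Rightarrow> real ^ 'd"
    and XX :: "real \<Rightarrow> real \<Rightarrow> real ^ 'd ^ 'd" and A :: "(real \<Rightarrow> real ^ 'n) \<Rightarrow> real \<Rightarrow> real ^ 'n" and \<xi> :: "real ^ 'n"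
  assumes T: "0 < T" and w: "control T w"
    and X: "\<And>u v. 0 \<le> u \<Longrightarrow> u \<le> v \<Longrightarrow> v \<le> T \<Longrightarrow> norm (X v - X u) \<le> w u v powr \<beta>"
    and XX: "\<And>u v. 0 \<le> u \<Longrightarrow> u \<le> v \<Longrightarrow> v \<le> T \<Longrightarrow> norm (XX u v) \<le> w u v powr (2 * \<beta>)"
    and chen: "\<And>s u t. 0 \<le> s \<Longrightarrow> s \<le> u \<Longrightarrow> u \<le> t \<Longrightarrow> t \<le> T \<Longrightarrow>
      XX s t = XX s u + XX u t + tensor (X u - X s) (X t - X u)"
    and A_path: "\<And>x. x \<in> paths T \<Longrightarrow> x 0 = \<xi> \<Longrightarrow> A x \<in> paths T"
    and A_Lip: "\<And>x y t c u. x \<in> paths T \<Longrightarrow> x 0 = \<xi> \<Longrightarrow> y \<in> paths T \<Longrightarrow> y 0 = \<xi> \<Longrightarrow> 0 \<le> t \<Longrightarrow> t \<le> T \<Longrightarrow>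
      (\<And>u. 0 \<le> u \<Longrightarrow> u \<le> t \<Longrightarrow> norm (x u - y u) \<le> c) \<Longrightarrow> 0 \<le> u \<Longrightarrow> u \<le> t \<Longrightarrow> norm (A x u - A y u) \<le> KA * c"
    and A_tv: "\<And>x s t. x \<in> paths T \<Longrightarrow> x 0 = \<xi> \<Longrightarrow> 0 \<le> s \<Longrightarrow> s \<le> t \<Longrightarrow> t \<le> T \<Longrightarrow>
      total_var (A x) s t \<le> ennreal (CA * sup_var x s t)"
begin

lemma w_super: "superadditive 0 T w" using w by (rule control_superadditive)

lemma w_nonneg: "0 \<le> s \<Longrightarrow> s \<le> t \<Longrightarrow> t \<le> T \<Longrightarrow> 0 \<le> w s t"
  using w by (auto simp: control_def)

lemma w_mono: "0 \<le> s \<Longrightarrow> s \<le> u \<Longrightarrow> u \<le> v \<Longrightarrow> v \<le> t \<Longrightarrow> t \<le> T \<Longrightarrow> w u v \<le> w s t"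
  by (rule superadditive_mono[OF w_super])

lemma w_powr_mono:
  "0 \<le> s \<Longrightarrow> s \<le> u \<Longrightarrow> u \<le> v \<Longrightarrow> v \<le> t \<Longrightarrow> t \<le> T \<Longrightarrow> 0 \<le> c \<Longrightarrow> w u v powr c \<le> w s t powr c"
  using w_mono w_nonneg by (intro powr_mono2) auto

lemma w_double: "w u v powr (2 * \<beta>) = w u v powr \<beta> * w u v powr \<beta>"
  by (simp flip: powr_add)

lemma X_continuous: "continuous_on {0..T} X"
  by (rule holder_path_continuous[OF w \<beta>, of 1]) (use X in auto)

lemma XX_refl: "0 \<le> s \<Longrightarrow> s \<le> T \<Longrightarrow> XX s s = 0"
  using chen[of s s s] by (simp add: tensor.zero_left)

lemma XX_increment:
  assumes "0 \<le> r" "r \<le> s" "s \<le> t" "t \<le> T"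
  shows "norm (XX r t - XX r s) \<le> (w s t powr \<beta> + w r s powr \<beta>) * w s t powr \<beta>"
proof -
  have "XX r t - XX r s = XX s t + tensor (X s - X r) (X t - X s)" using chen[of r s t] assms by simp
  also have "norm \<dots> \<le> w s t powr \<beta> * w s t powr \<beta> + w r s powr \<beta> * w s t powr \<beta>"
    using XX[of s t] X[of r s] X[of s t] assms
    by (intro norm_triangle_mono) (auto simp: norm_tensor w_double intro!: mult_mono)
  finally show ?thesis by (simp add: algebra_simps)
qed

lemma XX_continuous:
  assumes r: "0 \<le> r" "r \<le> T" shows "continuous_on {r..T} (XX r)"
proof -
  \<comment> \<open>Freezing the path before \<open>r\<close> extends it to the whole interval,
    where the Hoelder criterion for continuity is stated.\<close>
  have "continuous_on {0..T} (\<lambda>t. XX r (max r t))"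
  proof (rule holder_path_continuous[OF w \<beta>, of "2 * w 0 T powr \<beta>"])
    fix u v assume uv: "0 \<le> u" "u \<le> v" "v \<le> T"
    have 1: "w (max r u) (max r v) \<le> w u v"
    proof (cases "v \<le> r")
      case True
      then show ?thesis using uv r superadditive_diag[OF w_super, of r] w_nonneg[of u v] by (simp add: max_absorb1)
    next
      case False
      then show ?thesis using uv r by (intro w_mono) auto
    qed
    then have 2: "w (max r u) (max r v) powr \<beta> \<le> w u v powr \<beta>"
      using uv r \<beta> by (intro powr_mono2 w_nonneg) auto
    have 3: "w (max r u) (max r v) powr \<beta> \<le> w 0 T powr \<beta>" "w r (max r u) powr \<beta> \<le> w 0 T powr \<beta>"
      using uv r \<beta> by (auto intro!: w_powr_mono)
    have "norm (XX r (max r v) - XX r (max r u)) \<le>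
      (w (max r u) (max r v) powr \<beta> + w r (max r u) powr \<beta>) * w (max r u) (max r v) powr \<beta>"
      using uv r by (intro XX_increment) auto
    also have "\<dots> \<le> (2 * w 0 T powr \<beta>) * w u v powr \<beta>"
      using 2 3 by (intro mult_mono) auto
    finally show "norm (XX r (max r v) - XX r (max r u)) \<le> 2 * w 0 T powr \<beta> * w u v powr \<beta>" .
  qed auto
  then have "continuous_on {r..T} (\<lambda>t. XX r (max r t))" using r by (auto intro: continuous_on_subset)
  then show ?thesis by (rule continuous_on_eq) auto
qed

section \<open>The Euler scheme on uniform grids and the defect of its expansion\<close>

definition grid :: "nat \<Rightarrow> nat \<Rightarrow> real" where "grid m i = T * real i / real m"

lemma grid_0: "grid m 0 = 0" by (simp add: grid_def)
lemma grid_end: "0 < m \<Longrightarrow> grid m m = T" by (simp add: grid_def)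
lemma grid_le_iff: "0 < m \<Longrightarrow> grid m i \<le> grid m j \<longleftrightarrow> i \<le> j"
  using T by (simp add: grid_def divide_le_cancel)
lemma grid_nonneg: "0 \<le> grid m i" using T by (simp add: grid_def)
lemma grid_le_T: "0 < m \<Longrightarrow> i \<le> m \<Longrightarrow> grid m i \<le> T"
  using grid_le_iff[of m i m] grid_end by simp

lemma grid_cell:
  assumes m: "0 < m" and t: "0 \<le> t" "t \<le> T"
  obtains i where "i < m" "grid m i \<le> t" "t \<le> grid m (Suc i)"
proof -
  have "\<exists>i\<le>k. grid m i \<le> t \<and> t \<le> grid m (Suc i)" if "t \<le> grid m (Suc k)" for k
    using that
  proof (induction k)
    case 0
    then show ?case using t by (auto simp: grid_0)
  next
    case (Suc k)
    then show ?case by (cases "grid m (Suc k) \<le> t") (auto intro: le_SucI)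
  qed
  from this[of "m - 1"] obtain i where "i \<le> m - 1" "grid m i \<le> t" "t \<le> grid m (Suc i)"
    using m t grid_end[OF m] by auto
  then show ?thesis using m by (intro that[of i]) auto
qed

text \<open>A property of a full path instead of a recursion over grid values, since
  \<open>A\<close> takes whole paths; after the first \<open>k\<close> cells the path is
  unconstrained. The formula is imposed at all points of a cell and so interpolates between grid
  points.\<close>

definition euler :: "nat \<Rightarrow> (real \<Rightarrow> real ^ 'n) \<Rightarrow> nat \<Rightarrow> bool" where
  "euler m Z k \<longleftrightarrow> Z \<in> paths T \<and> Z 0 = \<xi> \<and>
     (\<forall>i<k. \<forall>t. grid m i \<le> t \<and> t \<le> grid m (Suc i) \<longrightarrow>
       Z t = Z (grid m i) + blinfun_apply (\<sigma> (Z (grid m i) + A Z (grid m i))) (X t - X (grid m i))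
         + G (Z (grid m i) + A Z (grid m i)) (XX (grid m i) t))"

lemma euler_exists:
  assumes m: "0 < m" shows "k \<le> m \<Longrightarrow> \<exists>Z. euler m Z k"
proof (induction k)
  case 0
  have "const_path T \<xi> \<in> paths T"
    unfolding paths_def const_path_def by (auto intro: continuous_on_eq[of _ "\<lambda>_. \<xi>"])
  then show ?case using T by (intro exI[of _ "const_path T \<xi>"]) (auto simp: euler_def const_path_def)
next
  case (Suc k)
  then obtain Z where Z: "euler m Z k" by auto
  then have Zp: "Z \<in> paths T" "Z 0 = \<xi>" by (auto simp: euler_def)
  define g where "g = grid m k"
  have g: "0 \<le> g" "g \<le> T" using grid_nonneg grid_le_T[OF m, of k] Suc.prems by (auto simp: g_def)
  define y where "y = Z g + A Z g"
  define F where "F t = Z g + blinfun_apply (\<sigma> y) (X t - X g) + G y (XX g t)" for t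
  define Z2 where "Z2 t = (if t \<le> g then Z t else if t \<le> T then F t else 0)" for t
  have Fg: "F g = Z g" using g by (simp add: F_def XX_refl G_zero)
  have linG: "bounded_linear (G y)"
  proof
    show "\<exists>K. \<forall>M. norm (G y M) \<le> norm M * K" using norm_G[of y] by (intro exI[of _ B]) (simp add: mult.commute)
  qed (simp_all add: second_order_def tensor_app_def scaleR_add_left sum.distrib scaleR_sum_right)
  have contF: "continuous_on {g..T} F"
    unfolding F_def
    by (intro continuous_intros bounded_linear.continuous_on[OF linG] XX_continuous g continuous_on_subset[OF X_continuous])
       (use g in auto)
  have Z2: "Z2 t = Z t" if "t \<le> g" for t using that by (simp add: Z2_def)
  have Z2F: "Z2 t = F t" if "g \<le> t" "t \<le> T" for t using that Fg by (cases "t = g") (auto simp: Z2_def)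
  have "continuous_on ({0..g} \<union> {g..T}) Z2"
  proof (rule continuous_on_closed_Un)
    show "continuous_on {0..g} Z2"
      by (rule continuous_on_eq[OF paths_continuous[OF Zp(1)]]) (use g Z2 in auto)
    show "continuous_on {g..T} Z2"
      by (rule continuous_on_eq[OF contF]) (use Z2F in auto)
  qed auto
  moreover have "{0..g} \<union> {g..T} = {0..T}" using g by auto
  ultimately have Z2p: "Z2 \<in> paths T"
    using paths_outside[OF Zp(1)] g unfolding paths_def by (auto simp: Z2_def)
  have Z20: "Z2 0 = \<xi>" using Z2[of 0] g Zp by simp
  \<comment> \<open>\<open>A_Lip\<close> on the horizon \<open>g\<close> with \<open>c = 0\<close>:
    changing the path after \<open>g\<close> does not affect \<open>A\<close> on
    \<open>[0,g]\<close>, so the earlier cells stay valid.\<close>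
  have A2: "A Z2 u = A Z u" if "0 \<le> u" "u \<le> g" for u
  proof -
    have "norm (A Z2 u - A Z u) \<le> KA * 0"
      by (rule A_Lip[OF Z2p Z20 Zp g]) (use that Z2 in auto)
    then show ?thesis by simp
  qed
  have "euler m Z2 (Suc k)"
    unfolding euler_def
  proof (intro conjI allI impI Z2p Z20)
    fix i t assume i: "i < Suc k" and t: "grid m i \<le> t \<and> t \<le> grid m (Suc i)"
    have gi: "grid m i \<le> g" unfolding g_def grid_le_iff[OF m] using i by simp
    show "Z2 t = Z2 (grid m i) + blinfun_apply (\<sigma> (Z2 (grid m i) + A Z2 (grid m i))) (X t - X (grid m i))
         + G (Z2 (grid m i) + A Z2 (grid m i)) (XX (grid m i) t)"
    proof (cases "i = k")
      case True
      have "grid m (Suc k) \<le> T" using grid_le_T[OF m, of "Suc k"] Suc.prems by simp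
      then have "Z2 t = F t" using t True by (intro Z2F) (auto simp: g_def)
      then show ?thesis using True Z2[of g] A2[of g] g by (simp add: F_def y_def flip: g_def)
    next
      case False
      then have "grid m (Suc i) \<le> g" unfolding g_def grid_le_iff[OF m] using i by simp
      then have "Z2 t = Z t" using t by (intro Z2) auto
      moreover have "Z t = Z (grid m i) + blinfun_apply (\<sigma> (Z (grid m i) + A Z (grid m i))) (X t - X (grid m i))
         + G (Z (grid m i) + A Z (grid m i)) (XX (grid m i) t)"
        using Z i t False unfolding euler_def by (metis less_SucE)
      ultimately show ?thesis using Z2[OF gi] A2[OF grid_nonneg gi] by simp
    qed
  qed
  then show ?case by blast
qed

definition J :: "(real \<Rightarrow> real ^ 'n) \<Rightarrow> real \<Rightarrow> real \<Rightarrow> real ^ 'n" where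
  "J Z s t = Z t - Z s - blinfun_apply (\<sigma> (Z s + A Z s)) (X t - X s) - G (Z s + A Z s) (XX s t)"

lemma J_refl: "0 \<le> s \<Longrightarrow> s \<le> T \<Longrightarrow> J Z s s = 0"
  by (simp add: J_def XX_refl G_zero)

text \<open>By Chen's relation and \<open>G_tensor\<close> the cross term is \<open>D y\<close>
  applied to \<open>\<sigma> y (X u - X s)\<close>, and the definition of \<open>J\<close> expresses
  that increment through \<open>y' - y\<close>. The increment of \<open>A\<close> has no counterpart
  in the expansion and is left over; it produces the \<open>V\<close> term.\<close>

lemma J_defect:
  assumes "0 \<le> s" "s \<le> u" "u \<le> t" "t \<le> T"
    and y: "y = Z s + A Z s" and y': "y' = Z u + A Z u"
  shows "J Z s t - J Z s u - J Z u t =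
    blinfun_apply (\<sigma> y' - \<sigma> y - D y (y' - y)) (X t - X u)
    + blinfun_apply (D y (G y (XX s u) + J Z s u + (A Z u - A Z s))) (X t - X u)
    + (G y' (XX u t) - G y (XX u t))"
proof -
  interpret D: bounded_linear "D y" by (rule linear_D)
  have yy: "G y (XX s u) + J Z s u + (A Z u - A Z s) = (y' - y) - blinfun_apply (\<sigma> y) (X u - X s)"
    by (simp add: J_def y y')
  have "G y (XX s t) = G y (XX s u) + G y (XX u t) + blinfun_apply (D y (blinfun_apply (\<sigma> y) (X u - X s))) (X t - X u)"
    using chen[of s u t] assms(1-4) by (simp add: G_add G_tensor)
  moreover have "blinfun_apply (\<sigma> y) (X t - X s) = blinfun_apply (\<sigma> y) (X u - X s) + blinfun_apply (\<sigma> y) (X t - X u)"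
    by (simp flip: blinfun.add_right)
  ultimately show ?thesis
    unfolding yy by (simp add: J_def D.diff minus_blinfun.rep_eq flip: y y')
qed

text \<open>Orders in \<open>W\<close>: the Taylor remainder gives
  \<open>(1 + \<theta>) * \<beta> + \<beta>\<close> and the Hoelder bound on \<open>G\<close> gives
  \<open>\<theta> * \<beta> + 2 * \<beta>\<close>, both equal to \<open>a\<close>. The term with
  \<open>XX s u\<close> gives \<open>3 * \<beta>\<close>, which is at least \<open>a\<close>, and
  \<open>W \<le> 1\<close>. The powers of \<open>M\<close> are rounded up to 2 and 1, as
  \<open>M \<ge> 1\<close>.\<close>

lemma J_defect_le:
  assumes st: "0 \<le> s" "s \<le> u" "u \<le> t" "t \<le> T" and W: "w s t \<le> W" "W \<le> 1"
    and y: "norm (Z u + A Z u - (Z s + A Z s)) \<le> M * W powr \<beta>" and j: "norm (J Z s u) \<le> j"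
    and v: "norm (A Z u - A Z s) \<le> v"
  shows "norm (J Z s t - J Z s u - J Z u t) \<le> (B * M ^ 2 + B * B + B * M) * W powr a + B * W powr \<beta> * (j + v)"
proof -
  define Wb where "Wb = W powr \<beta>"
  have wsu: "0 \<le> w s u" "w s u \<le> W" and wut: "0 \<le> w u t" "w u t \<le> W"
    using w_nonneg[of s u] w_nonneg[of u t] w_mono[of s s u t] w_mono[of s u t t] st W by auto
  have W0: "0 \<le> W" using wsu by simp
  have Wb: "0 \<le> Wb" "Wb \<le> 1" using W0 W \<beta> by (auto simp: Wb_def powr_le1)
  have "1 * 1 \<le> (18 * B) * (1 + CA)" using B CA by (intro mult_mono) auto
  then have M1: "1 \<le> M" by (simp add: M)
  define y0 where "y0 = Z s + A Z s"
  define y1 where "y1 = Z u + A Z u"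
  have yy: "norm (y1 - y0) \<le> M * Wb" using y by (simp add: y0_def y1_def Wb_def)
  have Xut: "norm (X t - X u) \<le> Wb"
    using X[of u t] st wut \<beta> powr_mono2[of \<beta> "w u t" W] by (simp add: Wb_def)
  have XXsu: "norm (XX s u) \<le> Wb * Wb" and XXut: "norm (XX u t) \<le> Wb * Wb"
    using XX[of s u] XX[of u t] st wsu wut \<beta> powr_mono2[of "2 * \<beta>" "w s u" W] powr_mono2[of "2 * \<beta>" "w u t" W]
    by (auto simp: Wb_def simp flip: powr_add)
  have Wa: "W powr a = Wb powr \<theta> * (Wb * Wb)"
    by (simp add: Wb_def a(1) powr_powr distrib_right powr_add[symmetric] algebra_simps)
  have cube: "Wb * Wb * Wb \<le> W powr a"
  proof -
    have "Wb powr 1 \<le> Wb powr \<theta>" using Wb \<theta> by (intro powr_mono') auto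
    then have "Wb \<le> Wb powr \<theta>" using Wb by simp
    then have "Wb * (Wb * Wb) \<le> Wb powr \<theta> * (Wb * Wb)" using Wb by (intro mult_right_mono) auto
    then show ?thesis unfolding Wa by (simp only: mult.assoc)
  qed
  have "norm (blinfun_apply (\<sigma> y1 - \<sigma> y0 - D y0 (y1 - y0)) (X t - X u)) \<le>
      norm (\<sigma> y1 - \<sigma> y0 - D y0 (y1 - y0)) * norm (X t - X u)" by (rule norm_blinfun)
  also have "\<dots> \<le> (B * (M * Wb) powr (1 + \<theta>)) * Wb"
  proof (intro mult_mono Xut)
    show "norm (\<sigma> y1 - \<sigma> y0 - D y0 (y1 - y0)) \<le> B * (M * Wb) powr (1 + \<theta>)"
      using yy B \<theta> by (intro order_trans[OF taylor] mult_left_mono powr_mono2) auto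
  qed (use B in auto)
  also have "(M * Wb) powr (1 + \<theta>) = M powr (1 + \<theta>) * (Wb powr \<theta> * Wb)"
    using M1 Wb by (simp add: powr_mult powr_add)
  also have "B * (M powr (1 + \<theta>) * (Wb powr \<theta> * Wb)) * Wb = B * M powr (1 + \<theta>) * W powr a"
    by (simp add: Wa algebra_simps)
  also have "\<dots> \<le> B * M ^ 2 * W powr a"
  proof -
    have "M powr (1 + \<theta>) \<le> M powr 2" using M1 \<theta> by (intro powr_mono) auto
    also have "\<dots> = M ^ 2" using M1 by simp
    finally show ?thesis using B by (intro mult_right_mono mult_left_mono) auto
  qed
  finally have 1: "norm (blinfun_apply (\<sigma> y1 - \<sigma> y0 - D y0 (y1 - y0)) (X t - X u)) \<le> B * M ^ 2 * W powr a" .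
  have "norm (G y0 (XX s u) + J Z s u + (A Z u - A Z s)) \<le> B * (Wb * Wb) + j + v"
    using order_trans[OF norm_G[of y0 "XX s u"]] XXsu B j v by (intro norm_triangle_mono) auto
  then have "norm (blinfun_apply (D y0 (G y0 (XX s u) + J Z s u + (A Z u - A Z s))) (X t - X u)) \<le>
      B * (B * (Wb * Wb) + j + v) * Wb"
    using Xut B Wb order_trans[OF norm_ge_zero j] order_trans[OF norm_ge_zero v]
    by (intro order_trans[OF norm_D_apply] mult_mono mult_left_mono) auto
  also have "\<dots> = B * B * (Wb * Wb * Wb) + B * Wb * (j + v)" by (simp add: algebra_simps)
  also have "\<dots> \<le> B * B * W powr a + B * Wb * (j + v)"
    using cube B by (intro add_right_mono mult_left_mono) auto
  finally have 2: "norm (blinfun_apply (D y0 (G y0 (XX s u) + J Z s u + (A Z u - A Z s))) (X t - X u)) \<le>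
      B * B * W powr a + B * Wb * (j + v)" .
  have "norm (G y1 (XX u t) - G y0 (XX u t)) \<le> B * norm (y1 - y0) powr \<theta> * norm (XX u t)" by (rule holder_G)
  also have "\<dots> \<le> B * (M * Wb) powr \<theta> * (Wb * Wb)"
    using yy B \<theta> XXut by (intro mult_mono mult_left_mono powr_mono2) auto
  also have "(M * Wb) powr \<theta> = M powr \<theta> * Wb powr \<theta>" using M1 Wb by (simp add: powr_mult)
  also have "B * (M powr \<theta> * Wb powr \<theta>) * (Wb * Wb) = B * M powr \<theta> * W powr a" by (simp add: Wa)
  also have "\<dots> \<le> B * M * W powr a"
  proof -
    have "M powr \<theta> \<le> M powr 1" using M1 \<theta> by (intro powr_mono) auto
    then show ?thesis using B M1 by (intro mult_right_mono mult_left_mono) auto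
  qed
  finally have 3: "norm (G y1 (XX u t) - G y0 (XX u t)) \<le> B * M * W powr a" .
  have "norm (J Z s t - J Z s u - J Z u t) \<le> B * M ^ 2 * W powr a + (B * B * W powr a + B * Wb * (j + v)) + B * M * W powr a"
    unfolding J_defect[OF st y0_def y1_def] using 1 2 3 by (intro norm_triangle_mono)
  then show ?thesis by (simp add: Wb_def algebra_simps)
qed

end

section \<open>A priori bounds along an Euler path\<close>

locale euler_path = davie \<sigma> B \<theta> \<beta> CA M a h L L' \<epsilon>\<^sub>1 \<epsilon>\<^sub>2 T KA w X XX A \<xi>
  for \<sigma> :: "real ^ 'n \<Rightarrow> (real ^ 'd) \<Rightarrow>\<^sub>L (real ^ 'n)" and B \<theta> \<beta> CA M a h L L' \<epsilon>\<^sub>1 \<epsilon>\<^sub>2 T KA w X XX A \<xi> +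
  fixes m :: nat and Z :: "real \<Rightarrow> real ^ 'n"
  assumes m: "0 < m" and euler: "euler m Z m" and fine: "\<And>i. i < m \<Longrightarrow> w (grid m i) (grid m (Suc i)) \<le> h"
begin

lemma Z: "Z \<in> paths T" "Z 0 = \<xi>"
  using euler by (auto simp: euler_def)

definition V :: "real \<Rightarrow> real \<Rightarrow> real" where "V s t = enn2real (total_var (A Z) s t)"

lemma V:
  "superadditive 0 T V"
  "0 \<le> s \<Longrightarrow> s \<le> t \<Longrightarrow> t \<le> T \<Longrightarrow> norm (A Z t - A Z s) \<le> V s t"
  "0 \<le> s \<Longrightarrow> s \<le> t \<Longrightarrow> t \<le> T \<Longrightarrow> V s t \<le> CA * sup_var Z s t"
proof -
  have "total_var (A Z) 0 T < \<infinity>" using A_tv[OF Z, of 0 T] T by (auto simp: order_le_less_trans)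
  from superadditive_total_var[OF this]
  show "superadditive 0 T V" "0 \<le> s \<Longrightarrow> s \<le> t \<Longrightarrow> t \<le> T \<Longrightarrow> norm (A Z t - A Z s) \<le> V s t"
    unfolding V_def by auto
  assume st: "0 \<le> s" "s \<le> t" "t \<le> T"
  have "0 \<le> sup_var Z s t" using st by (intro sup_var_nonneg paths_continuous[OF Z(1)]) auto
  then show "V s t \<le> CA * sup_var Z s t"
    unfolding V_def using enn2real_mono[OF A_tv[OF Z st]] CA by simp
qed

text \<open>Both points are expanded from the same left grid point, so the difference is explicit:
  \<open>B\<close> from the first level and \<open>2 * B\<close> from the second, since
  \<open>w \<le> h \<le> 1\<close> on a cell.\<close>

lemma cell_increment:
  assumes i: "i < m" and st: "grid m i \<le> s" "s \<le> t" "t \<le> grid m (Suc i)"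
  shows "norm (Z t - Z s) \<le> 3 * B * w s t powr \<beta>"
proof -
  define g where "g = grid m i"
  have g: "0 \<le> g" "g \<le> s" "t \<le> T" "grid m (Suc i) \<le> T"
    using grid_nonneg st grid_le_T[OF m, of "Suc i"] i by (auto simp: g_def)
  define y where "y = Z g + A Z g"
  have Zr: "Z r = Z g + blinfun_apply (\<sigma> y) (X r - X g) + G y (XX g r)" if "g \<le> r" "r \<le> grid m (Suc i)" for r
    using euler i that unfolding euler_def g_def y_def by blast
  have 1: "w s t powr \<beta> \<le> 1" and 2: "w g s powr \<beta> \<le> 1"
  proof -
    have "w s t \<le> 1" "w g s \<le> 1"
      using w_mono[of g s t "grid m (Suc i)"] w_mono[of g g s "grid m (Suc i)"] fine[OF i] g st h unfolding g_def by auto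
    then show "w s t powr \<beta> \<le> 1" "w g s powr \<beta> \<le> 1"
      using w_nonneg[of s t] w_nonneg[of g s] g st \<beta> by (auto intro!: powr_le1)
  qed
  have "Z t - Z s = blinfun_apply (\<sigma> y) (X t - X s) + G y (XX g t - XX g s)"
    using Zr[of s] Zr[of t] st g unfolding g_def[symmetric] by (simp add: G_diff blinfun.diff_right)
  also have "norm \<dots> \<le> B * w s t powr \<beta> + B * (2 * w s t powr \<beta>)"
  proof (rule norm_triangle_mono)
    show "norm (blinfun_apply (\<sigma> y) (X t - X s)) \<le> B * w s t powr \<beta>"
      using X[of s t] g st B by (intro order_trans[OF norm_apply] mult_left_mono) auto
    have "norm (XX g t - XX g s) \<le> (w s t powr \<beta> + w g s powr \<beta>) * w s t powr \<beta>"
      using g st by (intro XX_increment) auto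
    also have "\<dots> \<le> 2 * w s t powr \<beta>" using 1 2 by (intro mult_right_mono) auto
    finally show "norm (G y (XX g t - XX g s)) \<le> B * (2 * w s t powr \<beta>)"
      using B by (intro order_trans[OF norm_G] mult_left_mono) auto
  qed
  finally show ?thesis by (simp add: algebra_simps)
qed

text \<open>Two partial cells at the ends cost \<open>3 * B\<close> each, and the span between grid
  points costs \<open>R\<close>.\<close>

lemma span_increment:
  assumes st: "0 \<le> s" "s \<le> t" "t \<le> T" and "0 \<le> R"
    and R: "\<And>p q. p \<le> q \<Longrightarrow> q \<le> m \<Longrightarrow> s \<le> grid m p \<Longrightarrow> grid m q \<le> t \<Longrightarrow> norm (Z (grid m q) - Z (grid m p)) \<le> R"
  shows "norm (Z t - Z s) \<le> 6 * B * w s t powr \<beta> + R"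
proof -
  obtain i where i: "i < m" "grid m i \<le> s" "s \<le> grid m (Suc i)" by (rule grid_cell[OF m, of s]) (use st in auto)
  obtain j where j: "j < m" "grid m j \<le> t" "t \<le> grid m (Suc j)" by (rule grid_cell[OF m, of t]) (use st in auto)
  have B0: "0 \<le> B * w s t powr \<beta>" using B by simp
  show ?thesis
  proof (cases "t \<le> grid m (Suc i)")
    case True
    then show ?thesis using cell_increment[OF i(1,2) st(2) True] B0 \<open>0 \<le> R\<close> by linarith
  next
    case False
    then have "grid m (Suc i) < grid m (Suc j)" using j by simp
    then have "i < j" using grid_le_iff[OF m, of "Suc j" "Suc i"] by simp
    then have ij: "grid m (Suc i) \<le> grid m j" unfolding grid_le_iff[OF m] by simp
    have 1: "norm (Z (grid m (Suc i)) - Z s) \<le> 3 * B * w s t powr \<beta>"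
    proof -
      have "norm (Z (grid m (Suc i)) - Z s) \<le> 3 * B * w s (grid m (Suc i)) powr \<beta>"
        by (rule cell_increment[OF i order_refl])
      also have "\<dots> \<le> 3 * B * w s t powr \<beta>"
        using st i j ij B \<beta> by (intro mult_left_mono w_powr_mono) auto
      finally show ?thesis .
    qed
    have 2: "norm (Z t - Z (grid m j)) \<le> 3 * B * w s t powr \<beta>"
    proof -
      have "norm (Z t - Z (grid m j)) \<le> 3 * B * w (grid m j) t powr \<beta>"
        by (rule cell_increment[OF j(1) order_refl j(2,3)])
      also have "\<dots> \<le> 3 * B * w s t powr \<beta>"
        using st i j ij B \<beta> by (intro mult_left_mono w_powr_mono) auto
      finally show ?thesis .
    qed
    have 3: "norm (Z (grid m j) - Z (grid m (Suc i))) \<le> R"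
      using i j \<open>i < j\<close> by (intro R) auto
    have "Z t - Z s = (Z t - Z (grid m j)) + (Z (grid m j) - Z (grid m (Suc i))) + (Z (grid m (Suc i)) - Z s)" by simp
    also have "norm \<dots> \<le> 3 * B * w s t powr \<beta> + R + 3 * B * w s t powr \<beta>"
      by (intro norm_triangle_mono 1 2 3)
    finally show ?thesis by (simp add: algebra_simps)
  qed
qed

abbreviation P where "P p q \<equiv> norm (J Z (grid m p) (grid m q)) \<le>
  L * w (grid m p) (grid m q) powr a + L' * V (grid m p) (grid m q) * w (grid m p) (grid m q) powr \<beta>"

text \<open>The oscillation \<open>S\<close> enters its own estimate through
  \<open>V \<le> CA * S\<close>. The condition \<open>L' * CA * h powr \<beta> \<le> 1 / 2\<close>
  turns that contribution into \<open>S / 2\<close>. With \<open>3 * B\<close> for grid points and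
  \<open>6 * B\<close> for the end cells this gives
  \<open>S \<le> 9 * B * W powr \<beta> + S / 2\<close>; hence the 18. The bound \<open>P\<close> is
  presupposed inside \<open>[s,t]\<close> only, so the lemma can be used within the
  induction.\<close>

lemma sup_var_bound:
  assumes st: "0 \<le> s" "s \<le> t" "t \<le> T" "w s t \<le> h"
    and P: "\<And>p q. p \<le> q \<Longrightarrow> q \<le> m \<Longrightarrow> s \<le> grid m p \<Longrightarrow> grid m q \<le> t \<Longrightarrow> P p q"
  shows "sup_var Z s t \<le> 18 * B * w s t powr \<beta>"
proof -
  define W where "W = w s t"
  define S where "S = sup_var Z s t"
  have W: "0 \<le> W" "W \<le> h" "W \<le> 1" using st w_nonneg[of s t] h by (auto simp: W_def)
  have Wb: "0 \<le> W powr \<beta>" "W powr \<beta> \<le> 1" "W powr \<beta> \<le> h powr \<beta>"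
    using W \<beta> by (auto intro!: powr_le1 powr_mono2)
  have S0: "0 \<le> S" unfolding S_def using st by (intro sup_var_nonneg paths_continuous[OF Z(1)]) auto
  have LWa: "L * W powr a \<le> W powr \<beta>"
  proof -
    have "W powr a = W powr \<beta> * W powr ((1 + \<theta>) * \<beta>)"
      by (simp add: a(1) powr_add[symmetric] algebra_simps)
    also have "\<dots> \<le> W powr \<beta> * h powr \<beta>"
    proof (intro mult_left_mono)
      have "W powr ((1 + \<theta>) * \<beta>) \<le> W powr \<beta>" using W \<beta> \<theta> by (intro powr_mono') auto
      then show "W powr ((1 + \<theta>) * \<beta>) \<le> h powr \<beta>" using Wb by linarith
    qed auto
    finally have "L * W powr a \<le> L * (W powr \<beta> * h powr \<beta>)" using L by (intro mult_left_mono)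
    also have "\<dots> = W powr \<beta> * (L * h powr \<beta>)" by simp
    also have "\<dots> \<le> W powr \<beta> * 1" by (intro mult_left_mono hL) auto
    finally show ?thesis by simp
  qed
  have LVW: "L' * V u v * W powr \<beta> \<le> S / 2" if "s \<le> u" "u \<le> v" "v \<le> t" for u v
  proof -
    have "V u v \<le> V s t" using that st by (intro superadditive_mono[OF V(1)]) auto
    also have "\<dots> \<le> CA * S" unfolding S_def by (rule V(3)[OF st(1-3)])
    finally have "L' * V u v * W powr \<beta> \<le> L' * (CA * S) * h powr \<beta>"
      using L Wb S0 CA by (intro mult_mono mult_left_mono) auto
    also have "\<dots> = (L' * CA * h powr \<beta>) * S" by simp
    also have "\<dots> \<le> 1 / 2 * S" by (intro mult_right_mono hL S0)
    finally show ?thesis by simp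
  qed
  have "norm (Z (grid m q) - Z (grid m p)) \<le> 3 * B * W powr \<beta> + S / 2"
    if pq: "p \<le> q" "q \<le> m" "s \<le> grid m p" "grid m q \<le> t" for p q
  proof -
    let ?u = "grid m p" and ?v = "grid m q"
    have uv: "0 \<le> ?u" "?u \<le> ?v" "?v \<le> T" using pq st grid_le_iff[OF m] grid_nonneg by auto
    have wuv: "w ?u ?v powr \<beta> \<le> W powr \<beta>" "w ?u ?v powr (2 * \<beta>) \<le> W powr \<beta> * 1" "w ?u ?v powr a \<le> W powr a"
    proof -
      show 1: "w ?u ?v powr \<beta> \<le> W powr \<beta>" unfolding W_def using pq uv st \<beta> by (intro w_powr_mono) auto
      then show "w ?u ?v powr (2 * \<beta>) \<le> W powr \<beta> * 1"
        unfolding w_double using Wb by (intro mult_mono) auto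
      show "w ?u ?v powr a \<le> W powr a" unfolding W_def using pq uv st a by (intro w_powr_mono) auto
    qed
    define y where "y = Z ?u + A Z ?u"
    have "norm (J Z ?u ?v) \<le> L * w ?u ?v powr a + L' * V ?u ?v * w ?u ?v powr \<beta>" using pq by (rule P)
    also have "\<dots> \<le> L * W powr a + L' * V ?u ?v * W powr \<beta>"
      using wuv L superadditiveD(2)[OF V(1) uv(1,2) order_refl uv(3)] by (intro add_mono mult_left_mono) auto
    also have "\<dots> \<le> W powr \<beta> + S / 2" using pq uv by (intro add_mono LWa LVW) auto
    finally have j: "norm (J Z ?u ?v) \<le> W powr \<beta> + S / 2" .
    have "Z ?v - Z ?u = J Z ?u ?v + blinfun_apply (\<sigma> y) (X ?v - X ?u) + G y (XX ?u ?v)"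
      by (simp add: J_def y_def)
    also have "norm \<dots> \<le> (W powr \<beta> + S / 2) + B * W powr \<beta> + B * W powr \<beta>"
    proof (intro norm_triangle_mono j)
      show "norm (blinfun_apply (\<sigma> y) (X ?v - X ?u)) \<le> B * W powr \<beta>"
        using X[OF uv] wuv(1) B by (intro order_trans[OF norm_apply] mult_left_mono) auto
      show "norm (G y (XX ?u ?v)) \<le> B * W powr \<beta>"
        using XX[OF uv] wuv(2) B by (intro order_trans[OF norm_G] mult_left_mono) auto
    qed
    also have "\<dots> \<le> 3 * B * W powr \<beta> + S / 2"
      using mult_right_mono[OF B Wb(1)] by (simp add: algebra_simps)
    finally show ?thesis .
  qed
  note R = this
  have "S \<le> 9 * B * W powr \<beta> + S / 2"
    unfolding S_def
  proof (rule sup_var_le[OF st(2)])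
    fix u v assume uv: "s \<le> u" "u \<le> v" "v \<le> t"
    have "norm (Z v - Z u) \<le> 6 * B * w u v powr \<beta> + (3 * B * W powr \<beta> + S / 2)"
      using uv st B S0 by (intro span_increment R) auto
    also have "\<dots> \<le> 6 * B * W powr \<beta> + (3 * B * W powr \<beta> + S / 2)"
      unfolding W_def using uv st B \<beta> by (intro add_right_mono mult_left_mono w_powr_mono) auto
    finally show "norm (Z v - Z u) \<le> 9 * B * W powr \<beta> + sup_var Z s t / 2" by (simp add: S_def algebra_simps)
  qed
  then show ?thesis by (simp add: S_def W_def)
qed

text \<open>The hypothesis on \<open>[i,k]\<close> bounds the oscillation of \<open>Z\<close> there
  by \<open>sup_var_bound\<close>, hence the increment of \<open>Z + A Z\<close> by
  \<open>M * W powr \<beta>\<close>, independently of \<open>L\<close> and \<open>L'\<close>. The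
  bound of \<open>J_defect_le\<close> is then affine in \<open>L\<close> and \<open>L'\<close> with
  small slopes, and the last two conditions of \<open>davie_constants\<close> close the
  step.\<close>

lemma grid_J:
  assumes "i \<le> j" "j \<le> m" "w (grid m i) (grid m j) \<le> h"
  shows "P i j"
proof -
  have gm: "0 \<le> grid m i" "grid m i \<le> grid m j" "grid m j \<le> T" if "i \<le> j" "j \<le> m" for i j
    using that grid_nonneg grid_le_iff[OF m] grid_le_T[OF m] by auto
  show ?thesis
  \<comment> \<open>The guard \<open>i \<le> m\<close> is there because
    \<open>discrete_sewing\<close> asks for \<open>J i i = 0\<close> at all \<open>i\<close>, also
    where the grid has left \<open>[0,T]\<close>.\<close>
  proof (rule discrete_sewing[where J = "\<lambda>i j. if i \<le> m then J Z (grid m i) (grid m j) else 0" and n = m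
        and w = "\<lambda>i j. w (grid m i) (grid m j)" and V = "\<lambda>i j. V (grid m i) (grid m j)" and h = h
        and a = a and b = \<beta> and L = L and L' = L' and \<epsilon>\<^sub>1 = \<epsilon>\<^sub>1 and \<epsilon>\<^sub>2 = \<epsilon>\<^sub>2 and i = i and j = j, simplified if_P[OF order_trans[OF assms(1,2)]]], goal_cases)
    case (1 i j) then show ?case using gm by (intro w_nonneg) auto
  next
    case (2 i k j) then show ?case using gm[of i k] gm[of k j] superadditiveD(1)[OF w_super] by simp
  next
    case (3 i j) then show ?case using gm[of i j] superadditiveD(2)[OF V(1)] by simp
  next
    case (4 i k j) then show ?case using gm[of i k] gm[of k j] superadditiveD(1)[OF V(1)] by simp
  next
    case (13 i) then show ?case using gm[of i i] by (simp add: J_refl)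
  next
    case (14 i)
    then have i: "grid m i \<le> grid m (Suc i)" unfolding grid_le_iff[OF m] by simp
    have "Z (grid m (Suc i)) = Z (grid m i) + blinfun_apply (\<sigma> (Z (grid m i) + A Z (grid m i))) (X (grid m (Suc i)) - X (grid m i))
         + G (Z (grid m i) + A Z (grid m i)) (XX (grid m i) (grid m (Suc i)))"
      using euler 14 i unfolding euler_def by blast
    then show ?case by (simp add: J_def)
  next
    case (15 i k j)
    let ?s = "grid m i" and ?u = "grid m k" and ?t = "grid m j"
    have s: "0 \<le> ?s" "?s \<le> ?u" "?u \<le> ?t" "?t \<le> T" using 15(1-3) gm[of i k] gm[of k j] by auto
    define W where "W = w ?s ?t"
    have W: "0 \<le> W" "W \<le> h" "W \<le> 1" using 15(4) h s w_nonneg[of ?s ?t] by (auto simp: W_def)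
    have Wb: "0 \<le> W powr \<beta>" "W powr \<beta> \<le> h powr \<beta>" using W \<beta> by (auto intro!: powr_mono2)
    have wsu: "w ?s ?u \<le> W" unfolding W_def using s by (intro w_mono) auto
    have Pk: "P p q" if "i \<le> p" "p \<le> q" "q \<le> k" for p q
      using 15(5)[OF that] that 15(1-3) by simp
    have "sup_var Z ?s ?u \<le> 18 * B * w ?s ?u powr \<beta>"
    proof (rule sup_var_bound)
      fix p q assume "p \<le> q" "q \<le> m" "?s \<le> grid m p" "grid m q \<le> ?u"
      then show "P p q" unfolding grid_le_iff[OF m] by (intro Pk)
    qed (use s wsu W in auto)
    also have "\<dots> \<le> 18 * B * W powr \<beta>"
      using wsu w_nonneg[of ?s ?u] s B \<beta> by (intro mult_left_mono powr_mono2) auto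
    finally have S: "sup_var Z ?s ?u \<le> 18 * B * W powr \<beta>" .
    have Vu: "V ?s ?u \<le> CA * sup_var Z ?s ?u" using s by (intro V(3)) auto
    have Z': "norm (Z ?u - Z ?s) \<le> sup_var Z ?s ?u"
      using s by (intro le_sup_var paths_continuous[OF Z(1)]) auto
    have A': "norm (A Z ?u - A Z ?s) \<le> V ?s ?u" using s by (intro V(2)) auto
    have V0: "0 \<le> V ?s ?u" "V ?s ?u \<le> V ?s ?t" using superadditiveD[OF V(1) s] by auto
    have "Z ?u + A Z ?u - (Z ?s + A Z ?s) = (Z ?u - Z ?s) + (A Z ?u - A Z ?s)" by simp
    also have "norm \<dots> \<le> sup_var Z ?s ?u + CA * sup_var Z ?s ?u"
      using Z' order_trans[OF A' Vu] by (rule norm_triangle_mono)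
    also have "\<dots> = (1 + CA) * sup_var Z ?s ?u" by (simp add: algebra_simps)
    also have "\<dots> \<le> (1 + CA) * (18 * B * W powr \<beta>)" using S CA by (intro mult_left_mono) auto
    finally have Y: "norm (Z ?u + A Z ?u - (Z ?s + A Z ?s)) \<le> M * W powr \<beta>" by (simp add: M algebra_simps)
    have "norm (J Z ?s ?u) \<le> L * w ?s ?u powr a + L' * V ?s ?u * w ?s ?u powr \<beta>" using 15 by (intro Pk) auto
    also have "\<dots> \<le> L * W powr a + L' * V ?s ?t * W powr \<beta>"
      using wsu w_nonneg[of ?s ?u] s L V0 \<beta> a by (intro add_mono mult_left_mono mult_mono powr_mono2) auto
    finally have jj: "norm (J Z ?s ?u) \<le> L * W powr a + L' * V ?s ?t * W powr \<beta>" .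
    have "norm (J Z ?s ?t - J Z ?s ?u - J Z ?u ?t) \<le> (B * M ^ 2 + B * B + B * M) * W powr a +
        B * W powr \<beta> * ((L * W powr a + L' * V ?s ?t * W powr \<beta>) + V ?s ?t)"
      using W Y jj order_trans[OF A' V0(2)] by (intro J_defect_le[OF s]) (auto simp: W_def)
    also have "\<dots> = (B * M ^ 2 + B * B + B * M + B * W powr \<beta> * L) * W powr a + (B + B * W powr \<beta> * L') * (V ?s ?t * W powr \<beta>)"
      by (simp add: algebra_simps)
    also have "\<dots> \<le> (B * M ^ 2 + B * B + B * M + B * h powr \<beta> * L) * W powr a + (B + B * h powr \<beta> * L') * (V ?s ?t * W powr \<beta>)"
      using Wb B L V0 by (intro add_mono mult_right_mono add_left_mono mult_left_mono) auto
    also have "\<dots> \<le> (\<epsilon>\<^sub>1 * L) * W powr a + (\<epsilon>\<^sub>2 * L') * (V ?s ?t * W powr \<beta>)"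
      using V0 Wb by (intro add_mono mult_right_mono hL) auto
    finally show ?case using 15(1-3) by (simp add: W_def algebra_simps)
  qed (use assms \<beta> a L \<epsilon>0 \<epsilon> in auto)
qed

lemma sup_var_local:
  assumes "0 \<le> s" "s \<le> t" "t \<le> T" "w s t \<le> h"
  shows "sup_var Z s t \<le> 18 * B * w s t powr \<beta>"
proof (rule sup_var_bound[OF assms])
  fix p q assume pq: "p \<le> q" "q \<le> m" "s \<le> grid m p" "grid m q \<le> t"
  then have "w (grid m p) (grid m q) \<le> w s t"
    using assms grid_le_iff[OF m] by (intro w_mono) auto
  then show "P p q" using pq assms by (intro grid_J) auto
qed

end

subsection \<open>Passage to the limit\<close>

context davie begin

lemma w_continuous: "0 \<le> s \<Longrightarrow> t \<le> T \<Longrightarrow> continuous_on {s..t} (w s)"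
  using w unfolding control_def
  by (elim conjE) (rule continuous_on_compose2[of _ "\<lambda>(s, t). w s t" _ "\<lambda>u. (s, u)", simplified], assumption,
    auto intro!: continuous_intros)

text \<open>An interval is cut into at most \<open>1 + w 0 T / h\<close> pieces on which the local bound applies.\<close>

lemma local_to_global:
  fixes Z :: "real \<Rightarrow> 'b::real_normed_vector"
  assumes c: "0 \<le> c"
    and loc: "\<And>s t. 0 \<le> s \<Longrightarrow> s \<le> t \<Longrightarrow> t \<le> T \<Longrightarrow> w s t \<le> h \<Longrightarrow> norm (Z t - Z s) \<le> c * w s t powr \<beta>"
    and st: "0 \<le> s" "s \<le> t" "t \<le> T"
  shows "norm (Z t - Z s) \<le> c * (1 + w 0 T / h) * w s t powr \<beta>"
proof -
  have pieces: "norm (Z t - Z s) \<le> real n * (c * h powr \<beta>)" if "0 \<le> s" "s \<le> t" "w s t \<le> real n * h" for n s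
    using that
  proof (induction n arbitrary: s)
    case 0
    then have "w s t = 0" using w_nonneg[of s t] st by simp
    then show ?case using loc[of s t] 0 st h by simp
  next
    case (Suc n)
    show ?case
    proof (cases "w s t \<le> h")
      case True
      have "norm (Z t - Z s) \<le> c * w s t powr \<beta>" using Suc.prems True st by (intro loc) auto
      also have "\<dots> \<le> c * h powr \<beta>"
        using True w_nonneg[of s t] Suc.prems st c \<beta> by (intro mult_left_mono powr_mono2) auto
      also have "\<dots> \<le> real (Suc n) * (c * h powr \<beta>)" using c by (simp add: algebra_simps)
      finally show ?thesis .
    next
      case False
      have "w s s = 0" using superadditive_diag[OF w_super, of s] Suc.prems st by simp
      \<comment> \<open>Cut off a piece of weight exactly \<open>h\<close>; superadditivity lowers
        the weight of the rest by at least \<open>h\<close>, which bounds the number of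
        pieces.\<close>
      then obtain u where u: "s \<le> u" "u \<le> t" "w s u = h"
        using IVT'[of "w s" s h t] False h Suc.prems st w_continuous[of s t] by auto
      have "w u t \<le> w s t - h" using superadditiveD(1)[OF w_super, of s u t] u Suc.prems st by simp
      then have 1: "norm (Z t - Z u) \<le> real n * (c * h powr \<beta>)"
        using Suc.prems u by (intro Suc.IH) (auto simp: algebra_simps)
      have 2: "norm (Z u - Z s) \<le> c * h powr \<beta>" using loc[of s u] u Suc.prems st by simp
      have "Z t - Z s = (Z t - Z u) + (Z u - Z s)" by simp
      also have "norm \<dots> \<le> real n * (c * h powr \<beta>) + c * h powr \<beta>" by (rule norm_triangle_mono[OF 1 2])
      finally show ?thesis by (simp add: algebra_simps)
    qed
  qed
  have wT: "w s t \<le> w 0 T" using st by (intro w_mono) auto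
  have w0: "0 \<le> w s t" using st by (intro w_nonneg) auto
  show ?thesis
  proof (cases "w s t \<le> h")
    case True
    have "c * w s t powr \<beta> * 1 \<le> c * w s t powr \<beta> * (1 + w 0 T / h)"
      using wT w0 h c by (intro mult_left_mono) auto
    then show ?thesis using loc[OF st True] by (simp add: mult_ac)
  next
    case False
    define n where "n = nat \<lceil>w s t / h\<rceil>"
    have 0: "0 \<le> w s t / h" using w0 h by simp
    have n: "w s t / h \<le> real n" "real n \<le> 1 + w s t / h" using 0 unfolding n_def by linarith+
    have "norm (Z t - Z s) \<le> real n * (c * h powr \<beta>)"
      using n(1) h st by (intro pieces) (auto simp: pos_divide_le_eq)
    also have "\<dots> \<le> (1 + w 0 T / h) * (c * w s t powr \<beta>)"
    proof (intro mult_mono mult_left_mono)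
      have "w s t / h \<le> w 0 T / h" using wT h by (intro divide_right_mono) auto
      then show "real n \<le> 1 + w 0 T / h" using n(2) by linarith
      show "h powr \<beta> \<le> w s t powr \<beta>" using False h \<beta> by (intro powr_mono2) auto
    qed (use c wT w0 h in auto)
    finally show ?thesis by (simp add: mult_ac)
  qed
qed

lemma grid_above:
  assumes "0 < m" "0 \<le> s" "s \<le> T"
  shows "\<exists>p. p \<le> m \<and> s \<le> grid m p \<and> grid m p \<le> s + T / real m"
proof -
  obtain i where i: "i < m" "grid m i \<le> s" "s \<le> grid m (Suc i)" by (rule grid_cell[OF assms])
  have "grid m (Suc i) = grid m i + T / real m" by (simp add: grid_def algebra_simps add_divide_distrib)
  then show ?thesis using i by (intro exI[of _ "Suc i"]) auto
qed

lemma grid_below: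
  assumes "0 < m" "0 \<le> s" "s \<le> T"
  shows "\<exists>p. p \<le> m \<and> grid m p \<le> s \<and> s - T / real m \<le> grid m p"
proof -
  obtain i where i: "i < m" "grid m i \<le> s" "s \<le> grid m (Suc i)" by (rule grid_cell[OF assms])
  have "grid m (Suc i) = grid m i + T / real m" by (simp add: grid_def algebra_simps add_divide_distrib)
  then show ?thesis using i by (intro exI[of _ i]) auto
qed

lemma isCont_\<sigma>: "isCont \<sigma> y"
  using derivative[of y] by (rule has_derivative_continuous)

lemma tendsto_G:
  assumes y: "(y \<longlongrightarrow> y0) F" and M: "(Mx \<longlongrightarrow> M0) F"
  shows "((\<lambda>n. G (y n) (Mx n)) \<longlongrightarrow> G y0 M0) F"
proof -
  have eq: "G (y n) (Mx n) - G y0 M0 = (G (y n) (Mx n) - G y0 (Mx n)) + G y0 (Mx n - M0)" for n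
    by (simp add: G_diff)
  have "((\<lambda>n. B * norm (y n - y0) powr \<theta> * norm (Mx n) + B * norm (Mx n - M0)) \<longlongrightarrow>
      B * norm (y0 - y0) powr \<theta> * norm M0 + B * norm (M0 - M0)) F"
    by (intro tendsto_intros y M tendsto_powr') (use \<theta> in auto)
  then have "((\<lambda>n. B * norm (y n - y0) powr \<theta> * norm (Mx n) + B * norm (Mx n - M0)) \<longlongrightarrow> 0) F" by simp
  then have "((\<lambda>n. G (y n) (Mx n) - G y0 M0) \<longlongrightarrow> 0) F"
  proof (rule Lim_null_comparison[rotated])
    show "\<forall>\<^sub>F n in F. norm (G (y n) (Mx n) - G y0 M0) \<le> B * norm (y n - y0) powr \<theta> * norm (Mx n) + B * norm (Mx n - M0)"
      unfolding eq by (intro always_eventually allI norm_triangle_mono holder_G norm_G)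
  qed
  then show ?thesis by (simp add: LIM_zero_iff)
qed

text \<open>Chen's relation over \<open>s \<le> sn n \<le> tn n \<le> t\<close> writes
  \<open>XX (sn n) (tn n)\<close> as \<open>XX s t\<close> minus two short pieces and two cross
  terms, all of which tend to 0. The approximation comes from inside \<open>[s,t]\<close> so that
  the controls on \<open>[sn n, tn n]\<close> are at most those on \<open>[s,t]\<close>.\<close>

lemma tendsto_XX:
  fixes sn tn :: "nat \<Rightarrow> real"
  assumes st: "0 \<le> s" "s \<le> t" "t \<le> T"
    and n: "eventually (\<lambda>n. s \<le> sn n \<and> sn n \<le> tn n \<and> tn n \<le> t) sequentially"
    and lim: "sn \<longlonglongrightarrow> s" "tn \<longlonglongrightarrow> t"
  shows "(\<lambda>n. XX (sn n) (tn n)) \<longlonglongrightarrow> XX s t" "(\<lambda>n. X (sn n)) \<longlonglongrightarrow> X s" "(\<lambda>n. X (tn n)) \<longlonglongrightarrow> X t"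
proof -
  show Xs: "(\<lambda>n. X (sn n)) \<longlonglongrightarrow> X s"
    by (rule continuous_on_tendsto_compose[OF X_continuous lim(1)]) (use st n in \<open>auto elim: eventually_mono\<close>)
  show Xt: "(\<lambda>n. X (tn n)) \<longlonglongrightarrow> X t"
    by (rule continuous_on_tendsto_compose[OF X_continuous lim(2)]) (use st n in \<open>auto elim: eventually_mono\<close>)
  have small: "f \<longlonglongrightarrow> 0"
    if f: "eventually (\<lambda>n. 0 \<le> un n \<and> un n \<le> vn n \<and> vn n \<le> T \<and> f n = XX (un n) (vn n)) sequentially"
      and uv: "(\<lambda>n. vn n - un n) \<longlonglongrightarrow> 0" for un vn :: "nat \<Rightarrow> real" and f
  proof (rule tendstoI)
    fix e :: real assume "0 < e"
    obtain d where d: "0 < d" "\<And>u v. 0 \<le> u \<Longrightarrow> u \<le> v \<Longrightarrow> v \<le> T \<Longrightarrow> v - u < d \<Longrightarrow> 1 * w u v powr (2 * \<beta>) < e"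
      by (rule control_powr_small[OF w, of "2 * \<beta>" 1, OF _ _ \<open>0 < e\<close>]) (use \<beta> in \<open>auto intro: that\<close>)
    have "\<forall>\<^sub>F n in sequentially. vn n - un n < d" using order_tendstoD(2)[OF uv d(1)] .
    with f show "\<forall>\<^sub>F n in sequentially. dist (f n) 0 < e"
    proof eventually_elim
      case (elim n)
      then show ?case using d(2)[of "un n" "vn n"] XX[of "un n" "vn n"] by simp
    qed
  qed
  have 1: "(\<lambda>n. XX s (sn n)) \<longlonglongrightarrow> 0"
    by (rule small[of "\<lambda>_. s" sn]) (use n st lim(1) in \<open>auto elim!: eventually_mono simp: LIM_zero\<close>)
  have 2: "(\<lambda>n. XX (tn n) t) \<longlonglongrightarrow> 0"
  proof (rule small[of tn "\<lambda>_. t"])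
    show "(\<lambda>n. t - tn n) \<longlonglongrightarrow> 0" using tendsto_diff[OF tendsto_const[of t] lim(2)] by simp
  qed (use n st in \<open>auto elim!: eventually_mono\<close>)
  have "(\<lambda>n. XX s t - XX s (sn n) - XX (tn n) t - tensor (X (sn n) - X s) (X t - X (sn n))
      - tensor (X (tn n) - X (sn n)) (X t - X (tn n))) \<longlonglongrightarrow>
      XX s t - 0 - 0 - tensor (X s - X s) (X t - X s) - tensor (X t - X s) (X t - X t)"
    by (intro tendsto_intros 1 2 Xs Xt tensor.tendsto)
  then have "(\<lambda>n. XX s t - XX s (sn n) - XX (tn n) t - tensor (X (sn n) - X s) (X t - X (sn n))
      - tensor (X (tn n) - X (sn n)) (X t - X (tn n))) \<longlonglongrightarrow> XX s t"
    by (simp add: tensor.zero_left tensor.zero_right)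
  then show "(\<lambda>n. XX (sn n) (tn n)) \<longlonglongrightarrow> XX s t"
  proof (rule Lim_transform_eventually)
    show "\<forall>\<^sub>F n in sequentially. XX s t - XX s (sn n) - XX (tn n) t - tensor (X (sn n) - X s) (X t - X (sn n))
      - tensor (X (tn n) - X (sn n)) (X t - X (tn n)) = XX (sn n) (tn n)"
      using n
    proof eventually_elim
      case (elim n)
      then show ?case using chen[of s "sn n" t] chen[of "sn n" "tn n" t] st by simp
    qed
  qed
qed

end

lemma subdivision_telescope:
  fixes Z :: "real \<Rightarrow> 'a::ab_group_add"
  shows "subdivision s t m p \<Longrightarrow> (\<Sum>i<m. Z (p (Suc i)) - Z (p i)) = Z t - Z s"
  by (simp add: sum_lessThan_telescope[of "\<lambda>i. Z (p i)"] subdivision_def)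

context davie begin

text \<open>The Euler paths on finer and finer grids form an equicontinuous family.  The total variation of
  the correction term enters the estimate of \<open>J\<close> as a control, so the bound on sums of \<open>J\<close> over
  subdivisions survives the limit.\<close>

lemma solution_exists:
  obtains Z where "Z \<in> paths T" "Z 0 = \<xi>"
    "\<And>s t. 0 \<le> s \<Longrightarrow> s \<le> t \<Longrightarrow> t \<le> T \<Longrightarrow> w s t \<le> h \<Longrightarrow> norm (Z t - Z s) \<le> 18 * B * w s t powr \<beta>"
    "\<And>s t. 0 \<le> s \<Longrightarrow> s \<le> t \<Longrightarrow> t \<le> T \<Longrightarrow> w s t \<le> h \<Longrightarrow>
      norm (J Z s t) \<le> (L + L' * (CA * (18 * B))) * w s t powr (2 * \<beta>)"
    "\<And>t. 0 \<le> t \<Longrightarrow> t \<le> T \<Longrightarrow>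
      mesh_limit (\<lambda>u v. blinfun_apply (\<sigma> (Z u + A Z u)) (X v - X u) + G (Z u + A Z u) (XX u v)) 0 t (Z t - \<xi>)"
proof -
  obtain d where d: "0 < d" "\<And>u v. 0 \<le> u \<Longrightarrow> u \<le> v \<Longrightarrow> v \<le> T \<Longrightarrow> v - u < d \<Longrightarrow> w u v < h"
    by (rule control_uniformly_small[OF w h(1)]) (rule that)
  obtain m0 :: nat where m0: "T / d < real m0" using reals_Archimedean2 by blast
  \<comment> \<open>The offset \<open>m0\<close> makes every grid, from the first on, fine enough
    for \<open>w \<le> h\<close> on its cells.\<close>
  define mm where "mm n = m0 + Suc n" for n
  have mm: "0 < mm n" for n by (simp add: mm_def)
  have fine: "w (grid (mm n) i) (grid (mm n) (Suc i)) \<le> h" if "i < mm n" for n i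
  proof -
    have "T / d < real (mm n)" using m0 by (simp add: mm_def)
    then have "T / real (mm n) < d" using d mm[of n] by (simp add: field_simps)
    moreover have "grid (mm n) (Suc i) - grid (mm n) i = T / real (mm n)"
      by (simp add: grid_def algebra_simps add_divide_distrib)
    ultimately have "w (grid (mm n) i) (grid (mm n) (Suc i)) < h"
      using that grid_le_T[OF mm, of "Suc i" n] grid_nonneg[of "mm n" i] grid_le_iff[OF mm, of n i "Suc i"]
      by (intro d(2)) auto
    then show ?thesis by simp
  qed
  have "\<exists>Z. euler (mm n) Z (mm n)" for n by (rule euler_exists[OF mm order_refl])
  then have "\<exists>Zs. \<forall>n. euler (mm n) (Zs n) (mm n)" by (intro choice allI)
  then obtain Zs where Zs: "\<And>n. euler (mm n) (Zs n) (mm n)" by blast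
  have ep: "euler_path \<sigma> B \<theta> \<beta> CA M a h L L' \<epsilon>\<^sub>1 \<epsilon>\<^sub>2 T KA w X XX A \<xi> (mm n) (Zs n)" for n
    by unfold_locales (use mm Zs fine in auto)
  note Zsp = euler_path.Z[OF ep]
  define V where "V n = euler_path.V A (Zs n)" for n
  note V = euler_path.V[OF ep, folded V_def]
  have sv: "sup_var (Zs n) s t \<le> 18 * B * w s t powr \<beta>" if "0 \<le> s" "s \<le> t" "t \<le> T" "w s t \<le> h" for n s t
    using euler_path.sup_var_local[OF ep that] .
  have le_sv: "norm (Zs n t - Zs n s) \<le> sup_var (Zs n) s t" if "0 \<le> s" "s \<le> t" "t \<le> T" for n s t
    using that by (intro le_sup_var paths_continuous[OF Zsp(1)]) auto
  have loc: "norm (Zs n t - Zs n s) \<le> 18 * B * w s t powr \<beta>" if "0 \<le> s" "s \<le> t" "t \<le> T" "w s t \<le> h" for n s t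
    using le_sv[OF that(1-3)] sv[OF that] by (rule order_trans)
  define K where "K = 18 * B * (1 + w 0 T / h)"
  have wT: "0 \<le> w 0 T" using T by (intro w_nonneg) auto
  have K0: "0 \<le> K" using wT h B by (simp add: K_def)
  have glob: "norm (Zs n t - Zs n s) \<le> K * w s t powr \<beta>" if "0 \<le> s" "s \<le> t" "t \<le> T" for n s t
    unfolding K_def using loc B that by (intro local_to_global) auto
  have "\<exists>g k. continuous_on {0..T} g \<and> strict_mono (k :: nat \<Rightarrow> nat) \<and>
    (\<forall>e>0. \<exists>N. \<forall>n x. N \<le> n \<and> x \<in> {0..T} \<longrightarrow> norm (Zs (k n) x - g x) < e)"
  proof (rule Arzela_Ascoli[of "{0..T}" Zs "norm \<xi> + K * w 0 T powr \<beta>"])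
    fix n x assume x: "x \<in> {0..T}"
    have "norm (Zs n x - Zs n 0) \<le> K * w 0 x powr \<beta>" using x by (intro glob) auto
    also have "\<dots> \<le> K * w 0 T powr \<beta>" using x K0 \<beta> by (intro mult_left_mono w_powr_mono) auto
    finally show "norm (Zs n x) \<le> norm \<xi> + K * w 0 T powr \<beta>"
      using Zsp(2)[of n] norm_triangle_ineq2[of "Zs n x" "Zs n 0"] by simp
  next
    fix x e :: real assume x: "x \<in> {0..T}" and "0 < e"
    obtain r where r: "0 < r" "\<And>u v. 0 \<le> u \<Longrightarrow> u \<le> v \<Longrightarrow> v \<le> T \<Longrightarrow> v - u < r \<Longrightarrow> K * w u v powr \<beta> < e"
      by (rule control_powr_small[OF w \<beta> K0 \<open>0 < e\<close>]) (rule that)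
    show "\<exists>d. 0 < d \<and> (\<forall>n y. y \<in> {0..T} \<and> norm (x - y) < d \<longrightarrow> norm (Zs n x - Zs n y) < e)"
    proof (intro exI[of _ r] conjI allI impI r(1))
      fix n y assume y: "y \<in> {0..T} \<and> norm (x - y) < r"
      show "norm (Zs n x - Zs n y) < e"
      proof (cases "x \<le> y")
        case True
        then have "norm (Zs n y - Zs n x) < e"
          using x y by (intro order_le_less_trans[OF glob] r(2)) auto
        then show ?thesis by (simp add: norm_minus_commute)
      next
        case False
        then show ?thesis using x y by (intro order_le_less_trans[OF glob] r(2)) auto
      qed
    qed
  qed auto
  then obtain g k where g: "continuous_on {0..T} g" and k: "strict_mono (k :: nat \<Rightarrow> nat)"
    and gk: "\<forall>e>0. \<exists>N. \<forall>n x. N \<le> n \<and> x \<in> {0..T} \<longrightarrow> norm (Zs (k n) x - g x) < e" by blast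
  define Z where "Z t = (if t \<in> {0..T} then g t else 0)" for t
  have Zp: "Z \<in> paths T"
    unfolding paths_def Z_def using g by (auto intro: continuous_on_eq)
  have conv: "\<forall>\<^sub>F n in sequentially. \<forall>x. 0 \<le> x \<and> x \<le> T \<longrightarrow> norm (Zs (k n) x - Z x) < e" if "0 < e" for e
    using gk[rule_format, OF that] unfolding eventually_sequentially Z_def by auto
  have Zlim: "(\<lambda>n. Zs (k n) (sn n)) \<longlonglongrightarrow> Z s"
    if "0 \<le> s" "s \<le> T" "sn \<longlonglongrightarrow> s" "\<forall>\<^sub>F n in sequentially. 0 \<le> sn n \<and> sn n \<le> T" for sn s
  proof -
    have 1: "(\<lambda>n. Z (sn n)) \<longlonglongrightarrow> Z s"
      by (rule continuous_on_tendsto_compose[OF paths_continuous[OF Zp order_refl order_refl] that(3)])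
         (use that in \<open>auto elim: eventually_mono\<close>)
    have 2: "(\<lambda>n. Zs (k n) (sn n) - Z (sn n)) \<longlonglongrightarrow> 0"
    proof (rule tendstoI)
      fix e :: real assume "0 < e"
      from conv[OF this] that(4) show "\<forall>\<^sub>F n in sequentially. dist (Zs (k n) (sn n) - Z (sn n)) 0 < e"
        by eventually_elim auto
    qed
    from tendsto_add[OF 2 1] show ?thesis by simp
  qed
  have "(\<lambda>n. Zs (k n) 0) \<longlonglongrightarrow> Z 0" using T by (intro Zlim) auto
  then have Z0: "Z 0 = \<xi>" using Zsp(2) LIMSEQ_unique[OF _ tendsto_const] by simp
  have convA: "\<forall>\<^sub>F n in sequentially. \<forall>x. 0 \<le> x \<and> x \<le> T \<longrightarrow> norm (A (Zs (k n)) x - A Z x) < e" if "0 < e" for e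
  proof -
    \<comment> \<open>\<open>KA\<close> carries no sign condition, hence the absolute value; the 1
      avoids a zero denominator.\<close>
    define e' where "e' = e / (\<bar>KA\<bar> + 1)"
    have e': "0 < e'" using that by (simp add: e'_def)
    have "KA * e' \<le> \<bar>KA\<bar> * e'" using e' by (intro mult_right_mono) auto
    also have "\<dots> < e" using that by (simp add: e'_def field_simps)
    finally have KA: "KA * e' < e" .
    from conv[OF e'] show ?thesis
    proof eventually_elim
      case (elim n)
      show ?case
      proof (intro allI impI)
        fix x assume x: "0 \<le> x \<and> x \<le> T"
        have "norm (A (Zs (k n)) x - A Z x) \<le> KA * e'"
          by (rule A_Lip[OF Zsp Zp Z0, of T]) (use x T elim in \<open>auto intro: less_imp_le\<close>)
        then show "norm (A (Zs (k n)) x - A Z x) < e" using KA by linarith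
      qed
    qed
  qed
  note AZp = A_path[OF Zp Z0]
  have Alim: "(\<lambda>n. A (Zs (k n)) (sn n)) \<longlonglongrightarrow> A Z s"
    if "0 \<le> s" "s \<le> T" "sn \<longlonglongrightarrow> s" "\<forall>\<^sub>F n in sequentially. 0 \<le> sn n \<and> sn n \<le> T" for sn s
  proof -
    have 1: "(\<lambda>n. A Z (sn n)) \<longlonglongrightarrow> A Z s"
      by (rule continuous_on_tendsto_compose[OF paths_continuous[OF AZp order_refl order_refl] that(3)])
         (use that in \<open>auto elim: eventually_mono\<close>)
    have 2: "(\<lambda>n. A (Zs (k n)) (sn n) - A Z (sn n)) \<longlonglongrightarrow> 0"
    proof (rule tendstoI)
      fix e :: real assume "0 < e"
      from convA[OF this] that(4) show "\<forall>\<^sub>F n in sequentially. dist (A (Zs (k n)) (sn n) - A Z (sn n)) 0 < e"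
        by eventually_elim auto
    qed
    from tendsto_add[OF 2 1] show ?thesis by simp
  qed
  have kn: "n \<le> k n" for n using k by (rule seq_suble)
  have mesh0: "(\<lambda>n. T / real (mm (k n))) \<longlonglongrightarrow> 0"
  proof (rule tendsto_sandwich[of "\<lambda>_. 0"])
    have "T / real (mm (k n)) \<le> T * inverse (real (Suc n))" for n
      unfolding divide_inverse using T kn[of n] by (intro mult_left_mono le_imp_inverse_le) (auto simp: mm_def)
    then show "\<forall>\<^sub>F n in sequentially. T / real (mm (k n)) \<le> T * inverse (real (Suc n))" by simp
    show "(\<lambda>n. T * inverse (real (Suc n))) \<longlonglongrightarrow> 0"
      using tendsto_mult_right_zero[OF LIMSEQ_inverse_real_of_nat, of T] by simp
  qed (use T in auto)
  \<comment> \<open>The grid bound reaches arbitrary \<open>s\<close> and \<open>t\<close> through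
    grid points inside \<open>[s,t]\<close>. Since nothing ensures that \<open>V (k n) s t\<close>
    converges, the bound is kept for each \<open>n\<close> on the approximations \<open>f n\<close>
    instead of being passed to the limit.\<close>
  have Jlim: "\<exists>f. f \<longlonglongrightarrow> J Z s t \<and>
      (\<forall>\<^sub>F n in sequentially. norm (f n) \<le> L * w s t powr a + L' * V (k n) s t * w s t powr \<beta>)"
    if st: "0 \<le> s" "s \<le> t" "t \<le> T" "w s t \<le> h" for s t
  proof (cases "s = t")
    case True
    have "0 \<le> V (k n) s t" for n using superadditiveD(2)[OF V(1), of s t t] st by simp
    then show ?thesis
      using True st L by (intro exI[of _ "\<lambda>_. 0"]) (auto simp: J_refl intro!: add_nonneg_nonneg mult_nonneg_nonneg)
  next
    case False
    then have "s < t" using st by simp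
    have "\<forall>n. \<exists>p. p \<le> mm (k n) \<and> s \<le> grid (mm (k n)) p \<and> grid (mm (k n)) p \<le> s + T / real (mm (k n))"
      using st by (intro allI grid_above mm) auto
    then obtain p where p: "\<forall>n. p n \<le> mm (k n) \<and> s \<le> grid (mm (k n)) (p n) \<and> grid (mm (k n)) (p n) \<le> s + T / real (mm (k n))"
      by (elim exE[OF choice])
    have "\<forall>n. \<exists>q. q \<le> mm (k n) \<and> grid (mm (k n)) q \<le> t \<and> t - T / real (mm (k n)) \<le> grid (mm (k n)) q"
      using st by (intro allI grid_below mm) auto
    then obtain q where q: "\<forall>n. q n \<le> mm (k n) \<and> grid (mm (k n)) (q n) \<le> t \<and> t - T / real (mm (k n)) \<le> grid (mm (k n)) (q n)"
      by (elim exE[OF choice])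
    define sn where "sn n = grid (mm (k n)) (p n)" for n
    define tn where "tn n = grid (mm (k n)) (q n)" for n
    have sn: "s \<le> sn n" "sn n \<le> s + T / real (mm (k n))" and tn: "tn n \<le> t" "t - T / real (mm (k n)) \<le> tn n" for n
      using p q by (auto simp: sn_def tn_def)
    have "(\<lambda>n. s + T / real (mm (k n))) \<longlonglongrightarrow> s + 0" "(\<lambda>n. t - T / real (mm (k n))) \<longlonglongrightarrow> t - 0"
      by (intro tendsto_intros mesh0)+
    then have up: "(\<lambda>n. s + T / real (mm (k n))) \<longlonglongrightarrow> s" "(\<lambda>n. t - T / real (mm (k n))) \<longlonglongrightarrow> t" by simp_all
    have slim: "sn \<longlonglongrightarrow> s" by (rule tendsto_sandwich[OF _ _ tendsto_const up(1)]) (use sn in auto)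
    have tlim: "tn \<longlonglongrightarrow> t" by (rule tendsto_sandwich[OF _ _ up(2) tendsto_const]) (use tn in auto)
    have ev: "\<forall>\<^sub>F n in sequentially. s \<le> sn n \<and> sn n \<le> tn n \<and> tn n \<le> t"
    proof -
      have "s < (s + t) / 2" "(s + t) / 2 < t" using \<open>s < t\<close> by auto
      from order_tendstoD(2)[OF slim this(1)] order_tendstoD(1)[OF tlim this(2)]
      show ?thesis
      proof eventually_elim
        case (elim n)
        then show ?case using sn(1)[of n] tn(1)[of n] by simp
      qed
    qed
    have evs: "\<forall>\<^sub>F n in sequentially. 0 \<le> sn n \<and> sn n \<le> T" and evt: "\<forall>\<^sub>F n in sequentially. 0 \<le> tn n \<and> tn n \<le> T"
      using ev st by (auto elim!: eventually_mono)
    note XL = tendsto_XX[OF st(1-3) ev slim tlim]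
    have Ys: "(\<lambda>n. Zs (k n) (sn n) + A (Zs (k n)) (sn n)) \<longlonglongrightarrow> Z s + A Z s"
      using st slim evs by (intro tendsto_add Zlim Alim) auto
    have "(\<lambda>n. J (Zs (k n)) (sn n) (tn n)) \<longlonglongrightarrow> J Z s t"
      unfolding J_def using st slim tlim evs evt
      by (intro tendsto_diff Zlim blinfun.tendsto isCont_tendsto_compose[OF isCont_\<sigma>] Ys tendsto_G XL) auto
    moreover have "\<forall>\<^sub>F n in sequentially. norm (J (Zs (k n)) (sn n) (tn n)) \<le>
        L * w s t powr a + L' * V (k n) s t * w s t powr \<beta>"
      using ev
    proof eventually_elim
      case (elim n)
      have ww: "w (sn n) (tn n) \<le> w s t" "0 \<le> w (sn n) (tn n)" using elim st by (auto intro!: w_mono w_nonneg)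
      have VV: "V (k n) (sn n) (tn n) \<le> V (k n) s t" "0 \<le> V (k n) (sn n) (tn n)"
        using elim st superadditive_mono[OF V(1), of s "sn n" "tn n" t] superadditiveD(2)[OF V(1), of "sn n" "tn n" "tn n"] by auto
      have "norm (J (Zs (k n)) (sn n) (tn n)) \<le> L * w (sn n) (tn n) powr a + L' * V (k n) (sn n) (tn n) * w (sn n) (tn n) powr \<beta>"
        unfolding sn_def tn_def V_def
      proof (rule euler_path.grid_J[OF ep])
        show "p n \<le> q n" using elim unfolding sn_def tn_def grid_le_iff[OF mm] by simp
        show "q n \<le> mm (k n)" using q by simp
        show "w (grid (mm (k n)) (p n)) (grid (mm (k n)) (q n)) \<le> h" using ww st unfolding sn_def tn_def by simp
      qed
      also have "\<dots> \<le> L * w s t powr a + L' * V (k n) s t * w s t powr \<beta>"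
        using ww VV L a \<beta> by (intro add_mono mult_left_mono mult_mono powr_mono2) auto
      finally show ?case .
    qed
    ultimately show ?thesis by blast
  qed
  have Zloc: "norm (Z t - Z s) \<le> 18 * B * w s t powr \<beta>" if "0 \<le> s" "s \<le> t" "t \<le> T" "w s t \<le> h" for s t
  proof (rule tendsto_upperbound)
    show "(\<lambda>n. norm (Zs (k n) t - Zs (k n) s)) \<longlonglongrightarrow> norm (Z t - Z s)"
      using that by (intro tendsto_norm tendsto_diff Zlim) auto
  qed (use loc[OF that] in auto)
  \<comment> \<open>The remainder norm asks for order \<open>2 * \<beta>\<close> only, so here
    \<open>V\<close> may be replaced by its bound of order \<open>w powr \<beta>\<close>.\<close>
  have JR: "norm (J Z s t) \<le> (L + L' * (CA * (18 * B))) * w s t powr (2 * \<beta>)"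
    if st: "0 \<le> s" "s \<le> t" "t \<le> T" "w s t \<le> h" for s t
  proof -
    obtain f where f: "f \<longlonglongrightarrow> J Z s t" "\<forall>\<^sub>F n in sequentially. norm (f n) \<le> L * w s t powr a + L' * V (k n) s t * w s t powr \<beta>"
      using Jlim[OF st] by blast
    have bd: "L * w s t powr a + L' * V (k n) s t * w s t powr \<beta> \<le> (L + L' * (CA * (18 * B))) * w s t powr (2 * \<beta>)" for n
    proof -
      have "V (k n) s t \<le> CA * (18 * B * w s t powr \<beta>)"
        using V(3)[OF st(1-3), of "k n"] mult_left_mono[OF sv[OF st, of "k n"] CA] by simp
      then have "L' * V (k n) s t * w s t powr \<beta> \<le> L' * (CA * (18 * B * w s t powr \<beta>)) * w s t powr \<beta>"
        using L by (intro mult_right_mono mult_left_mono) auto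
      also have "\<dots> = L' * (CA * (18 * B)) * w s t powr (2 * \<beta>)" unfolding w_double by (simp only: mult_ac)
      finally have 2: "L' * V (k n) s t * w s t powr \<beta> \<le> L' * (CA * (18 * B)) * w s t powr (2 * \<beta>)" .
      have "w s t powr a \<le> w s t powr (2 * \<beta>)"
        using w_nonneg[OF st(1-3)] st(4) h a \<theta> \<beta> by (intro powr_mono') auto
      then have "L * w s t powr a \<le> L * w s t powr (2 * \<beta>)" using L by (intro mult_left_mono)
      with 2 show ?thesis unfolding distrib_right by linarith
    qed
    show ?thesis
    proof (rule tendsto_upperbound[OF tendsto_norm[OF f(1)]])
      show "\<forall>\<^sub>F n in sequentially. norm (f n) \<le> (L + L' * (CA * (18 * B))) * w s t powr (2 * \<beta>)"
        using f(2) by eventually_elim (rule order_trans[OF _ bd])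
    qed auto
  qed
  \<comment> \<open>A bound on the total mass of \<open>V n\<close>, uniform in \<open>n\<close>,
    which superadditivity needs in the final sum.\<close>
  define VT where "VT = CA * (K * w 0 T powr \<beta>)"
  have VT0: "0 \<le> VT" using CA K0 by (simp add: VT_def)
  have VT: "V n 0 T \<le> VT" for n
  proof -
    have "sup_var (Zs n) 0 T \<le> K * w 0 T powr \<beta>"
    proof (rule sup_var_le)
      fix u v assume uv: "0 \<le> u" "u \<le> v" "v \<le> T"
      have "norm (Zs n v - Zs n u) \<le> K * w u v powr \<beta>" by (rule glob[OF uv])
      also have "\<dots> \<le> K * w 0 T powr \<beta>" using uv K0 \<beta> by (intro mult_left_mono w_powr_mono) auto
      finally show "norm (Zs n v - Zs n u) \<le> K * w 0 T powr \<beta>" .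
    qed (use T in simp)
    then show ?thesis unfolding VT_def using V(3)[of 0 T n] T mult_left_mono[OF _ CA] by (meson less_imp_le order_refl order_trans)
  qed
  have lim: "mesh_limit (\<lambda>u v. blinfun_apply (\<sigma> (Z u + A Z u)) (X v - X u) + G (Z u + A Z u) (XX u v)) 0 t (Z t - \<xi>)"
    (is "mesh_limit ?\<Xi> 0 t _")
    if t: "0 \<le> t" "t \<le> T" for t
    unfolding mesh_limit_def
  proof (intro allI impI)
    fix e :: real assume "0 < e"
    define \<eta> where "\<eta> = e / (4 * (L * w 0 T + 1))"
    define \<eta>' where "\<eta>' = e / (4 * (L' * VT + 1))"
    have Lw: "0 \<le> L * w 0 T" "0 \<le> L' * VT" using L wT VT0 by auto
    have \<eta>: "0 < \<eta>" "L * w 0 T * \<eta> \<le> e / 4" and \<eta>': "0 < \<eta>'" "L' * VT * \<eta>' \<le> e / 4"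
    proof -
      have 1: "c * (e / (4 * (c + 1))) \<le> e / 4" if "0 \<le> c" for c :: real
        using that \<open>0 < e\<close> by (simp add: field_simps)
      show "0 < \<eta>" "0 < \<eta>'" using Lw \<open>0 < e\<close> by (auto simp: \<eta>_def \<eta>'_def)
      show "L * w 0 T * \<eta> \<le> e / 4" unfolding \<eta>_def by (rule 1[OF Lw(1)])
      show "L' * VT * \<eta>' \<le> e / 4" unfolding \<eta>'_def by (rule 1[OF Lw(2)])
    qed
    obtain d1 where d1: "0 < d1" "\<And>u v. 0 \<le> u \<Longrightarrow> u \<le> v \<Longrightarrow> v \<le> T \<Longrightarrow> v - u < d1 \<Longrightarrow> 1 * w u v powr (a - 1) < \<eta>"
      by (rule control_powr_small[OF w _ _ \<eta>(1), of "a - 1" 1]) (use a in \<open>auto intro: that\<close>)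
    obtain d2 where d2: "0 < d2" "\<And>u v. 0 \<le> u \<Longrightarrow> u \<le> v \<Longrightarrow> v \<le> T \<Longrightarrow> v - u < d2 \<Longrightarrow> 1 * w u v powr \<beta> < \<eta>'"
      by (rule control_powr_small[OF w _ _ \<eta>'(1), of \<beta> 1]) (use \<beta> in \<open>auto intro: that\<close>)
    define \<delta> where "\<delta> = min d (min d1 d2)"
    show "\<exists>\<delta>>0. \<forall>m p. subdivision 0 t m p \<and> (\<forall>i<m. p (Suc i) - p i < \<delta>) \<longrightarrow>
        norm ((\<Sum>i<m. ?\<Xi> (p i) (p (Suc i))) - (Z t - \<xi>)) < e"
    proof (intro exI[of _ \<delta>] conjI allI impI)
      show "0 < \<delta>" using d d1 d2 by (simp add: \<delta>_def)
      fix m p assume *: "subdivision 0 t m p \<and> (\<forall>i<m. p (Suc i) - p i < \<delta>)"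
      then have p: "subdivision 0 t m p" and mesh: "\<And>i. i < m \<Longrightarrow> p (Suc i) - p i < \<delta>" by auto
      have pi: "0 \<le> p i" "p i \<le> p (Suc i)" "p (Suc i) \<le> T" if "i < m" for i
        using subdivision_range[OF p, of i] subdivision_range[OF p, of "Suc i"] subdivision_mono[OF p, of i "Suc i"] that t by auto
      have wh: "w (p i) (p (Suc i)) \<le> h" if "i < m" for i
        using d(2)[OF pi[OF that]] mesh[OF that] by (auto simp: \<delta>_def)
      have wa: "w (p i) (p (Suc i)) powr a \<le> \<eta> * w (p i) (p (Suc i))" if "i < m" for i
      proof -
        have "w (p i) (p (Suc i)) powr (a - 1) \<le> \<eta>"
          using d1(2)[OF pi[OF that]] mesh[OF that] by (auto simp: \<delta>_def)
        then have "w (p i) (p (Suc i)) powr (a - 1) * w (p i) (p (Suc i)) \<le> \<eta> * w (p i) (p (Suc i))"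
          using w_nonneg[OF pi[OF that]] by (rule mult_right_mono)
        moreover have "w (p i) (p (Suc i)) powr (a - 1) * w (p i) (p (Suc i)) = w (p i) (p (Suc i)) powr a"
          using w_nonneg[OF pi[OF that]] by (cases "w (p i) (p (Suc i)) = 0") (auto simp: powr_diff)
        ultimately show ?thesis by simp
      qed
      have wb: "w (p i) (p (Suc i)) powr \<beta> \<le> \<eta>'" if "i < m" for i
        using d2(2)[OF pi[OF that]] mesh[OF that] by (auto simp: \<delta>_def)
      \<comment> \<open>The index \<open>n\<close> is chosen after the subdivision, so the
        approximation error may depend on its number \<open>m\<close> of cells.\<close>
      define e1 where "e1 = e / (4 * (real m + 1))"
      have e1: "0 < e1" "real m * e1 \<le> e / 4" using \<open>0 < e\<close> by (auto simp: e1_def field_simps)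
      have "\<forall>\<^sub>F n in sequentially. \<forall>i\<in>{..<m}. norm (J Z (p i) (p (Suc i))) \<le>
          L * w (p i) (p (Suc i)) powr a + L' * V (k n) (p i) (p (Suc i)) * w (p i) (p (Suc i)) powr \<beta> + e1"
      proof (rule eventually_ball_finite)
        show "\<forall>i\<in>{..<m}. \<forall>\<^sub>F n in sequentially. norm (J Z (p i) (p (Suc i))) \<le>
          L * w (p i) (p (Suc i)) powr a + L' * V (k n) (p i) (p (Suc i)) * w (p i) (p (Suc i)) powr \<beta> + e1"
        proof
          fix i assume "i \<in> {..<m}"
          then have i: "i < m" by simp
          obtain f where f: "f \<longlonglongrightarrow> J Z (p i) (p (Suc i))" "\<forall>\<^sub>F n in sequentially. norm (f n) \<le>
              L * w (p i) (p (Suc i)) powr a + L' * V (k n) (p i) (p (Suc i)) * w (p i) (p (Suc i)) powr \<beta>"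
            using Jlim[OF pi[OF i] wh[OF i]] by blast
          from f(2) tendstoD[OF f(1) e1(1)] show "\<forall>\<^sub>F n in sequentially. norm (J Z (p i) (p (Suc i))) \<le>
              L * w (p i) (p (Suc i)) powr a + L' * V (k n) (p i) (p (Suc i)) * w (p i) (p (Suc i)) powr \<beta> + e1"
          proof eventually_elim
            case (elim n)
            then show ?case using norm_triangle_ineq2[of "J Z (p i) (p (Suc i))" "f n"]
              by (simp add: dist_norm norm_minus_commute)
          qed
        qed
      qed simp
      then obtain n where n: "\<forall>i\<in>{..<m}. norm (J Z (p i) (p (Suc i))) \<le>
          L * w (p i) (p (Suc i)) powr a + L' * V (k n) (p i) (p (Suc i)) * w (p i) (p (Suc i)) powr \<beta> + e1"
        by (auto dest: eventually_happens)
      have "(\<Sum>i<m. ?\<Xi> (p i) (p (Suc i))) - (Z t - \<xi>) = - (\<Sum>i<m. J Z (p i) (p (Suc i)))"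
        unfolding J_def sum_subtractf sum.distrib using subdivision_telescope[OF p, of Z] Z0
        by (simp add: sum_subtractf algebra_simps)
      then have "norm ((\<Sum>i<m. ?\<Xi> (p i) (p (Suc i))) - (Z t - \<xi>)) = norm (\<Sum>i<m. J Z (p i) (p (Suc i)))" by simp
      also have "\<dots> \<le> (\<Sum>i<m. L * (\<eta> * w (p i) (p (Suc i))) + L' * V (k n) (p i) (p (Suc i)) * \<eta>' + e1)"
      proof (rule sum_norm_le)
        fix i assume "i \<in> {..<m}"
        then have i: "i < m" by simp
        have "0 \<le> V (k n) (p i) (p (Suc i))"
          using superadditiveD(2)[OF V(1) pi(1,2)[OF i] order_refl pi(3)[OF i]] .
        then have "L * w (p i) (p (Suc i)) powr a + L' * V (k n) (p i) (p (Suc i)) * w (p i) (p (Suc i)) powr \<beta> + e1 \<le>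
          L * (\<eta> * w (p i) (p (Suc i))) + L' * V (k n) (p i) (p (Suc i)) * \<eta>' + e1"
          using L wa[OF i] wb[OF i] by (intro add_mono mult_left_mono) auto
        then show "norm (J Z (p i) (p (Suc i))) \<le> L * (\<eta> * w (p i) (p (Suc i))) + L' * V (k n) (p i) (p (Suc i)) * \<eta>' + e1"
          using n i by force
      qed
      also have "\<dots> = L * \<eta> * (\<Sum>i<m. w (p i) (p (Suc i))) + L' * \<eta>' * (\<Sum>i<m. V (k n) (p i) (p (Suc i))) + real m * e1"
        by (simp add: sum.distrib sum_distrib_left mult_ac)
      also have "\<dots> \<le> L * \<eta> * w 0 T + L' * \<eta>' * VT + real m * e1"
      proof (intro add_mono mult_left_mono order_refl)
        show "(\<Sum>i<m. w (p i) (p (Suc i))) \<le> w 0 T"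
          using superadditive_sum[OF w_super p] w_mono[of 0 0 t T] t by simp
        show "(\<Sum>i<m. V (k n) (p i) (p (Suc i))) \<le> VT"
          using superadditive_sum[OF V(1) p, of "k n"] superadditive_mono[OF V(1), of 0 0 t T "k n"] VT[of "k n"] t by simp
      qed (use L \<eta> \<eta>' in auto)
      also have "\<dots> \<le> e / 4 + e / 4 + e / 4"
        using \<eta>(2) \<eta>'(2) e1(2) by (simp add: mult_ac)
      also have "\<dots> < e" using \<open>0 < e\<close> by simp
      finally show "norm ((\<Sum>i<m. ?\<Xi> (p i) (p (Suc i))) - (Z t - \<xi>)) < e" .
    qed
  qed
  show ?thesis by (rule that[OF Zp Z0 Zloc JR lim])
qed

end

section \<open>Norm bounds for the solution, and the theorem\<close>

lemma mesh_limit_cong: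
  assumes "mesh_limit \<Xi> s t I" "\<And>u v. s \<le> u \<Longrightarrow> u \<le> v \<Longrightarrow> v \<le> t \<Longrightarrow> \<Xi> u v = \<Theta> u v"
  shows "mesh_limit \<Theta> s t I"
proof -
  have "(\<Sum>i<m. \<Theta> (p i) (p (Suc i))) = (\<Sum>i<m. \<Xi> (p i) (p (Suc i)))" if p: "subdivision s t m p" for m p
  proof (rule sum.cong)
    fix i assume "i \<in> {..<m}"
    then show "\<Theta> (p i) (p (Suc i)) = \<Xi> (p i) (p (Suc i))"
      using subdivision_range[OF p, of i] subdivision_range[OF p, of "Suc i"] subdivision_mono[OF p, of i "Suc i"]
      by (intro assms(2)[symmetric]) auto
  qed simp
  then show ?thesis using assms(1) unfolding mesh_limit_def by simp
qed

lemma control_scale: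
  assumes "control T \<omega>" "0 \<le> c" shows "control T (\<lambda>s t. c * \<omega> s t)"
  unfolding control_def
proof (intro conjI allI impI)
  have "continuous_on {(s, t). 0 \<le> s \<and> s \<le> t \<and> t \<le> T} (\<lambda>x. c * (case x of (s, t) \<Rightarrow> \<omega> s t))"
    using assms(1) by (intro continuous_intros) (auto simp: control_def)
  then show "continuous_on {(s, t). 0 \<le> s \<and> s \<le> t \<and> t \<le> T} (\<lambda>(s, t). c * \<omega> s t)"
    by (simp add: case_prod_unfold)
  show "0 \<le> c * \<omega> s t" if "0 \<le> s \<and> s \<le> t \<and> t \<le> T" for s t
    using assms that by (auto simp: control_def)
  show "c * \<omega> s u + c * \<omega> u t \<le> c * \<omega> s t" if "0 \<le> s \<and> s \<le> u \<and> u \<le> t \<and> t \<le> T" for s u t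
    using assms that by (auto simp: control_def simp flip: distrib_left intro!: mult_left_mono)
qed

text \<open>The four summands of \<open>K\<close> before the division by \<open>h\<close> belong to
  \<open>Z\<close>, \<open>Z'\<close>, \<open>A_tilde Z\<close> and the remainder. All of them carry
  the factor \<open>F = 1 + w 0 T / h\<close> of \<open>local_to_global\<close>, which is at most
  \<open>E / h\<close>; this explains the denominator and the exponent 1 of the bracket.\<close>

lemma (in reflected_rde) solution_bounds:
  fixes CA q M a h L L' \<epsilon>\<^sub>1 \<epsilon>\<^sub>2 :: real
  defines "q \<equiv> (1 + \<kappa>') / (1 - \<kappa>')"
  defines "CA \<equiv> \<rho>'' * (1 + q) + q"
  assumes dc: "davie_constants \<sigma> B \<theta> \<beta> CA M a h L L' \<epsilon>\<^sub>1 \<epsilon>\<^sub>2"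
  defines "K \<equiv> (18 * B + B * ((1 + CA) * (18 * B)) + CA * (18 * B) +
      (L + L' * (CA * (18 * B)) + B + (18 * B + B) * h powr (- \<beta>))) / h"
  shows "\<exists>Z Z'. (Z, Z') \<in> P2 \<and>
        holder T \<omega> \<beta> Z + holder T \<omega> \<beta> Z' + var_holder T \<omega> \<beta> (At Z) + holder2 T \<omega> (2 * \<beta>) (remainder X Z Z')
        \<le> ennreal (K * (1 + (1 + rough_norm3 T \<omega> \<beta> X XX) powr (1 / \<beta>) * \<omega> 0 T) powr 1
              * rough_norm3 T \<omega> \<beta> X XX powr 1)"
proof -
  define R where "R = rough_norm T \<omega> \<beta> X XX"
  \<comment> \<open>The factor becomes \<open>R\<close> under \<open>powr \<beta>\<close> and
    \<open>R ^ 2\<close> under \<open>powr (2 * \<beta>)\<close>, which matches the square root in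
    \<open>rough_norm\<close>.\<close>
  define w where "w s t = R powr (1 / \<beta>) * \<omega> s t" for s t
  have ctl: "control T \<omega>" using rough by (simp add: rough_path_def)
  have R0: "0 \<le> R" by (simp add: R_def rough_norm_def)
  have \<omega>0: "0 \<le> \<omega> s t" if "0 \<le> s" "s \<le> t" "t \<le> T" for s t using ctl that by (auto simp: control_def)
  have w\<beta>: "w s t powr \<beta> = R * \<omega> s t powr \<beta>" and w2\<beta>: "w s t powr (2 * \<beta>) = R ^ 2 * \<omega> s t powr (2 * \<beta>)"
    if "0 \<le> s" "s \<le> t" "t \<le> T" for s t
  proof -
    have "R powr 2 = R ^ 2" using R0 by (cases "R = 0") auto
    then show "w s t powr \<beta> = R * \<omega> s t powr \<beta>" "w s t powr (2 * \<beta>) = R ^ 2 * \<omega> s t powr (2 * \<beta>)"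
      using \<omega>0[OF that] R0 \<beta> by (auto simp: w_def powr_mult powr_powr)
  qed
  have X_le: "norm (X v - X u) \<le> w u v powr \<beta>" if "0 \<le> u" "u \<le> v" "v \<le> T" for u v
  proof -
    have "norm (X v - X u) \<le> enn2real (holder T \<omega> \<beta> X) * \<omega> u v powr \<beta>" by (rule rough_path_increments(1)[OF rough that])
    also have "\<dots> \<le> R * \<omega> u v powr \<beta>" by (intro mult_right_mono) (auto simp: R_def rough_norm_def)
    finally show ?thesis by (simp add: w\<beta>[OF that])
  qed
  have XX_le: "norm (XX u v) \<le> w u v powr (2 * \<beta>)" if "0 \<le> u" "u \<le> v" "v \<le> T" for u v
  proof -
    let ?x = "enn2real (holder2 T \<omega> (2 * \<beta>) XX)"
    have "norm (XX u v) \<le> ?x * \<omega> u v powr (2 * \<beta>)" by (rule rough_path_increments(2)[OF rough that])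
    also have "?x = sqrt ?x ^ 2" by simp
    also have "sqrt ?x ^ 2 * \<omega> u v powr (2 * \<beta>) \<le> R ^ 2 * \<omega> u v powr (2 * \<beta>)"
      by (intro mult_right_mono power_mono) (auto simp: R_def rough_norm_def)
    finally show ?thesis by (simp add: w2\<beta>[OF that])
  qed
  define KA where "KA = \<rho>' * (1 + (1 + \<kappa>) / (1 - \<kappa>)) + (1 + \<kappa>) / (1 - \<kappa>)"
  interpret dc: davie_constants \<sigma> B \<theta> \<beta> CA M a h L L' \<epsilon>\<^sub>1 \<epsilon>\<^sub>2 by (rule dc)
  interpret dv: davie \<sigma> B \<theta> \<beta> CA M a h L L' \<epsilon>\<^sub>1 \<epsilon>\<^sub>2 T KA w X XX At \<xi>
  proof
    show "0 < T" by (rule T)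
    show "control T w" unfolding w_def using ctl by (rule control_scale) simp
    show "norm (X v - X u) \<le> w u v powr \<beta>" if "0 \<le> u" "u \<le> v" "v \<le> T" for u v by (rule X_le[OF that])
    show "norm (XX u v) \<le> w u v powr (2 * \<beta>)" if "0 \<le> u" "u \<le> v" "v \<le> T" for u v by (rule XX_le[OF that])
    show "XX s t = XX s u + XX u t + tensor (X u - X s) (X t - X u)" if "0 \<le> s" "s \<le> u" "u \<le> t" "t \<le> T" for s u t
      using rough that unfolding rough_path_def by blast
    show "At x \<in> paths T" if "x \<in> paths T" "x 0 = \<xi>" for x by (rule A_tilde_path[OF that])
    show "norm (At x u - At y u) \<le> KA * c" if "x \<in> paths T" "x 0 = \<xi>" "y \<in> paths T" "y 0 = \<xi>" "0 \<le> t" "t \<le> T"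
      "\<And>u. 0 \<le> u \<Longrightarrow> u \<le> t \<Longrightarrow> norm (x u - y u) \<le> c" "0 \<le> u" "u \<le> t" for x y t c u
      unfolding KA_def by (rule A_tilde_Lip[OF that])
    show "total_var (At x) s t \<le> ennreal (CA * sup_var x s t)" if "x \<in> paths T" "x 0 = \<xi>" "0 \<le> s" "s \<le> t" "t \<le> T" for x s t
      unfolding CA_def q_def by (rule A_tilde_total_var[OF that])
  qed
  obtain Z where Zp: "Z \<in> paths T" and Z0: "Z 0 = \<xi>"
    and loc: "\<And>s t. 0 \<le> s \<Longrightarrow> s \<le> t \<Longrightarrow> t \<le> T \<Longrightarrow> w s t \<le> h \<Longrightarrow> norm (Z t - Z s) \<le> 18 * B * w s t powr \<beta>"
    and Jle: "\<And>s t. 0 \<le> s \<Longrightarrow> s \<le> t \<Longrightarrow> t \<le> T \<Longrightarrow> w s t \<le> h \<Longrightarrow>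
      norm (dv.J Z s t) \<le> (L + L' * (CA * (18 * B))) * w s t powr (2 * \<beta>)"
    and int: "\<And>t. 0 \<le> t \<Longrightarrow> t \<le> T \<Longrightarrow>
      mesh_limit (\<lambda>u v. blinfun_apply (\<sigma> (Z u + At Z u)) (X v - X u) + G (Z u + At Z u) (XX u v)) 0 t (Z t - \<xi>)"
    by (rule dv.solution_exists) (rule that)
  note AZp = A_tilde_path[OF Zp Z0]
  define Y where "Y t = Z t + At Z t" for t
  define Z' where "Z' t = (if t \<in> {0..T} then \<sigma> (Y t) else 0)" for t
  define F where "F = 1 + w 0 T / h"
  have h: "0 < h" "h \<le> 1" by (rule dc.h)+
  have wT: "0 \<le> w 0 T" using dv.w_nonneg[of 0 T] T by simp
  have F: "1 \<le> F" using wT h by (simp add: F_def)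
  have CA: "0 \<le> CA" by (rule dc.CA)
  have glob: "norm (Z t - Z s) \<le> 18 * B * F * w s t powr \<beta>" if "0 \<le> s" "s \<le> t" "t \<le> T" for s t
    unfolding F_def using loc B by (intro dv.local_to_global[OF _ _ that]) auto
  have sv: "sup_var Z s t \<le> 18 * B * F * w s t powr \<beta>" if st: "0 \<le> s" "s \<le> t" "t \<le> T" for s t
  proof (rule sup_var_le[OF st(2)])
    fix u v assume uv: "s \<le> u" "u \<le> v" "v \<le> t"
    have "norm (Z v - Z u) \<le> 18 * B * F * w u v powr \<beta>" using uv st by (intro glob) auto
    also have "\<dots> \<le> 18 * B * F * w s t powr \<beta>"
      using uv st B F \<beta> by (intro mult_left_mono dv.w_powr_mono) auto
    finally show "norm (Z v - Z u) \<le> 18 * B * F * w s t powr \<beta>" .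
  qed
  have tv: "total_var (At Z) s t \<le> ennreal (CA * (18 * B) * F * w s t powr \<beta>)" if st: "0 \<le> s" "s \<le> t" "t \<le> T" for s t
  proof (rule order_trans[OF dv.A_tv[OF Zp Z0 st]], rule ennreal_leI)
    show "CA * sup_var Z s t \<le> CA * (18 * B) * F * w s t powr \<beta>"
      using mult_left_mono[OF sv[OF st] CA] by (simp add: mult_ac)
  qed
  have Ainc: "norm (At Z t - At Z s) \<le> CA * (18 * B) * F * w s t powr \<beta>" if st: "0 \<le> s" "s \<le> t" "t \<le> T" for s t
    using order_trans[OF norm_le_total_var[OF st(2)] tv[OF st]] B F CA by (simp add: ennreal_le_iff)
  have Z'inc: "norm (Z' t - Z' s) \<le> B * ((1 + CA) * (18 * B)) * F * w s t powr \<beta>" if st: "0 \<le> s" "s \<le> t" "t \<le> T" for s t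
  proof -
    have "Y t - Y s = (Z t - Z s) + (At Z t - At Z s)" by (simp add: Y_def)
    also have "norm \<dots> \<le> 18 * B * F * w s t powr \<beta> + CA * (18 * B) * F * w s t powr \<beta>"
      by (rule norm_triangle_mono[OF glob[OF st] Ainc[OF st]])
    finally have "B * norm (Y t - Y s) \<le> B * (18 * B * F * w s t powr \<beta> + CA * (18 * B) * F * w s t powr \<beta>)"
      using B by (intro mult_left_mono) auto
    moreover have "norm (Z' t - Z' s) \<le> B * norm (Y t - Y s)" using Lip_\<sigma>[of "Y t" "Y s"] st by (simp add: Z'_def)
    ultimately show ?thesis by (simp add: algebra_simps)
  qed
  \<comment> \<open>The terms before the last treat \<open>w s t \<le> h\<close>, where the
    remainder is \<open>J\<close> plus the second level term. On longer intervals only increments of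
    order \<beta> are at hand; \<open>1 \<le> h powr (- \<beta>) * w s t powr \<beta>\<close> raises
    them to order \<open>2 * \<beta>\<close>, at the cost of the last term.\<close>
  define c2 where "c2 = L + L' * (CA * (18 * B)) + B + (18 * B + B) * h powr (- \<beta>)"
  have LL: "0 \<le> L + L' * (CA * (18 * B))" using dc.L CA B by simp
  have Rinc: "norm (remainder X Z Z' s t) \<le> c2 * F * w s t powr (2 * \<beta>)" if st: "0 \<le> s" "s \<le> t" "t \<le> T" for s t
  proof (cases "w s t \<le> h")
    case True
    have "remainder X Z Z' s t = dv.J Z s t + G (Y s) (XX s t)"
      using st by (simp add: remainder_def dv.J_def Z'_def Y_def)
    also have "norm \<dots> \<le> (L + L' * (CA * (18 * B))) * w s t powr (2 * \<beta>) + B * w s t powr (2 * \<beta>)"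
      using XX_le[OF st] B by (intro norm_triangle_mono Jle[OF st True] order_trans[OF norm_G] mult_left_mono) auto
    also have "\<dots> = (L + L' * (CA * (18 * B)) + B) * w s t powr (2 * \<beta>)" by (simp add: algebra_simps)
    also have "\<dots> \<le> (c2 * F) * w s t powr (2 * \<beta>)"
    proof (rule mult_right_mono)
      have "0 \<le> (18 * B + B) * h powr (- \<beta>)" using B by simp
      then have "(L + L' * (CA * (18 * B)) + B) * 1 \<le> c2 * F"
        using F LL B unfolding c2_def by (intro mult_mono) auto
      then show "L + L' * (CA * (18 * B)) + B \<le> c2 * F" by simp
    qed simp
    finally show ?thesis .
  next
    case False
    have "remainder X Z Z' s t = (Z t - Z s) - blinfun_apply (\<sigma> (Y s)) (X t - X s)"
      using st by (simp add: remainder_def Z'_def)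
    also have "norm \<dots> \<le> norm (Z t - Z s) + norm (blinfun_apply (\<sigma> (Y s)) (X t - X s))"
      by (rule norm_triangle_ineq4)
    also have "\<dots> \<le> 18 * B * F * w s t powr \<beta> + B * w s t powr \<beta>"
    proof (rule add_mono[OF glob[OF st]])
      show "norm (blinfun_apply (\<sigma> (Y s)) (X t - X s)) \<le> B * w s t powr \<beta>"
        using X_le[OF st] B by (intro order_trans[OF norm_apply] mult_left_mono) auto
    qed
    also have "\<dots> \<le> 18 * B * F * w s t powr \<beta> + B * F * w s t powr \<beta>"
      using mult_left_mono[OF F, of B] B by (intro add_left_mono mult_right_mono) auto
    also have "\<dots> = (18 * B + B) * F * w s t powr \<beta> * 1" by (simp add: algebra_simps)
    also have "\<dots> \<le> (18 * B + B) * F * w s t powr \<beta> * (h powr (- \<beta>) * w s t powr \<beta>)"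
    proof (rule mult_left_mono)
      have "h powr \<beta> \<le> w s t powr \<beta>" using False h \<beta> by (intro powr_mono2) auto
      then have "h powr (- \<beta>) * h powr \<beta> \<le> h powr (- \<beta>) * w s t powr \<beta>" by (intro mult_left_mono) auto
      then show "1 \<le> h powr (- \<beta>) * w s t powr \<beta>" using h by (simp add: powr_minus)
    qed (use B F in auto)
    also have "\<dots> = ((18 * B + B) * h powr (- \<beta>)) * F * w s t powr (2 * \<beta>)"
      unfolding dv.w_double by (simp only: mult_ac)
    also have "\<dots> \<le> c2 * F * w s t powr (2 * \<beta>)"
      using LL B F unfolding c2_def by (intro mult_right_mono) auto
    finally show ?thesis .
  qed
  have c20: "0 \<le> c2" using LL B by (simp add: c2_def)
  have conv: "c * F * w s t powr \<beta> = (c * F * R) * \<omega> s t powr \<beta>" if "0 \<le> s" "s \<le> t" "t \<le> T" for c s t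
    by (simp add: w\<beta>[OF that])
  have hZ: "holder T \<omega> \<beta> Z \<le> ennreal (18 * B * F * R)"
    by (rule holder_le) (use B F R0 glob conv in auto)
  have hZ': "holder T \<omega> \<beta> Z' \<le> ennreal (B * ((1 + CA) * (18 * B)) * F * R)"
    by (rule holder_le) (use B F R0 CA Z'inc conv in auto)
  have hA: "var_holder T \<omega> \<beta> (At Z) \<le> ennreal (CA * (18 * B) * F * R)"
    by (rule var_holder_le) (use B F R0 CA tv conv in auto)
  have hR: "holder2 T \<omega> (2 * \<beta>) (remainder X Z Z') \<le> ennreal (c2 * F * R ^ 2)"
    by (rule holder2_le) (use c20 F R0 Rinc w2\<beta> in \<open>auto simp: mult.assoc\<close>)
  have Z'p: "Z' \<in> paths T"
  proof -
    have cY: "continuous_on {0..T} Y"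
      unfolding Y_def by (intro continuous_intros paths_continuous[OF Zp] paths_continuous[OF AZp]) auto
    have c\<sigma>: "continuous_on UNIV \<sigma>" using dv.isCont_\<sigma> by (intro continuous_at_imp_continuous_on) auto
    have "continuous_on {0..T} (\<lambda>t. \<sigma> (Y t))"
      by (rule continuous_on_compose2[OF c\<sigma> cY]) simp
    then have "continuous_on {0..T} Z'" by (rule continuous_on_eq) (simp add: Z'_def)
    then show ?thesis unfolding paths_def by (auto simp: Z'_def)
  qed
  have P2: "(Z, Z') \<in> P2"
    unfolding P2_solutions_def mem_Collect_eq prod.case
  proof (intro conjI ballI)
    have "holder T \<omega> \<beta> Z < \<infinity>" "holder T \<omega> \<beta> Z' < \<infinity>" "holder2 T \<omega> (2 * \<beta>) (remainder X Z Z') < \<infinity>"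
      using order_le_less_trans[OF hZ] order_le_less_trans[OF hZ'] order_le_less_trans[OF hR] by auto
    then show "(Z, Z') \<in> controlled_paths T \<omega> \<beta> X"
      using Zp Z'p by (simp add: controlled_paths_def holder_paths_def)
    fix t assume t: "t \<in> {0..T}"
    then show "Z' t = \<sigma> (Z t + At Z t)" by (simp add: Z'_def Y_def)
    have "total_var (At Z) 0 T < \<infinity>" using order_le_less_trans[OF tv[of 0 T]] T by auto
    then show "has_rough_integral \<sigma> X XX Z Z' (At Z) 0 t (Z t - \<xi>)"
    proof (rule has_rough_integral_iff[OF X_continuous, THEN iffD2])
      show "mesh_limit (\<lambda>u v. blinfun_apply (\<sigma> (Z u + At Z u)) (X v - X u) +
        tensor_app (\<lambda>a b. blinfun_apply (D (Z u + At Z u) (blinfun_apply (Z' u) a)) b) (XX u v)) 0 t (Z t - \<xi>)"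
        by (rule mesh_limit_cong[OF int]) (use t in \<open>auto simp: second_order_def Z'_def Y_def\<close>)
    qed (use t in auto)
  qed
  define R3 where "R3 = rough_norm3 T \<omega> \<beta> X XX"
  have "{1..3::nat} = {1, 2, 3}" by auto
  then have R3_eq: "R3 = R + R ^ 2 + R ^ 3" by (simp add: R3_def rough_norm3_def R_def)
  \<comment> \<open>The bounds on \<open>Z\<close>, \<open>Z'\<close> and \<open>A_tilde Z\<close>
    are linear in \<open>R\<close>, that on the remainder is quadratic; \<open>R3\<close> dominates
    both, so its first power suffices.\<close>
  have R3: "R \<le> R3" "R ^ 2 \<le> R3" "0 \<le> R3" using R0 by (auto simp: R3_eq)
  define E where "E = 1 + (1 + R3) powr (1 / \<beta>) * \<omega> 0 T"
  have \<omega>T: "0 \<le> \<omega> 0 T" using \<omega>0[of 0 T] T by simp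
  have E0: "0 < E" unfolding E_def using \<omega>T by (intro add_pos_nonneg) auto
  have FE: "F \<le> E / h"
  proof -
    have "R powr (1 / \<beta>) \<le> (1 + R3) powr (1 / \<beta>)" using R3 R0 \<beta> by (intro powr_mono2) auto
    then have "w 0 T \<le> (1 + R3) powr (1 / \<beta>) * \<omega> 0 T" unfolding w_def using \<omega>T by (rule mult_right_mono)
    then have "h + w 0 T \<le> E" using h by (simp add: E_def)
    moreover have "F * h = h + w 0 T" using h by (simp add: F_def distrib_right)
    ultimately show ?thesis using h by (simp only: pos_le_divide_eq)
  qed
  define K' where "K' = 18 * B + B * ((1 + CA) * (18 * B)) + CA * (18 * B) + c2"
  have "18 * B * F * R + B * ((1 + CA) * (18 * B)) * F * R + CA * (18 * B) * F * R + c2 * F * R ^ 2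
    \<le> 18 * B * F * R3 + B * ((1 + CA) * (18 * B)) * F * R3 + CA * (18 * B) * F * R3 + c2 * F * R3"
    using R3 B F CA c20 by (intro add_mono mult_left_mono) auto
  also have "\<dots> = K' * F * R3" by (simp add: K'_def algebra_simps)
  also have "\<dots> \<le> K' * (E / h) * R3"
    using FE R3 B CA c20 by (intro mult_right_mono mult_left_mono) (auto simp: K'_def)
  also have "\<dots> = K * E powr 1 * R3 powr 1"
  proof -
    have "K = K' / h" by (simp only: K_def K'_def c2_def)
    then show ?thesis using E0 R3 by simp
  qed
  finally have final: "18 * B * F * R + B * ((1 + CA) * (18 * B)) * F * R + CA * (18 * B) * F * R + c2 * F * R ^ 2
    \<le> K * E powr 1 * R3 powr 1" .
  have "holder T \<omega> \<beta> Z + holder T \<omega> \<beta> Z' + var_holder T \<omega> \<beta> (At Z) + holder2 T \<omega> (2 * \<beta>) (remainder X Z Z')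
    \<le> ennreal (18 * B * F * R) + ennreal (B * ((1 + CA) * (18 * B)) * F * R) + ennreal (CA * (18 * B) * F * R) + ennreal (c2 * F * R ^ 2)"
    by (intro add_mono hZ hZ' hA hR)
  also have "\<dots> = ennreal (18 * B * F * R + B * ((1 + CA) * (18 * B)) * F * R + CA * (18 * B) * F * R + c2 * F * R ^ 2)"
    using B F R0 CA c20 by (simp add: ennreal_plus)
  also have "\<dots> \<le> ennreal (K * E powr 1 * R3 powr 1)" by (rule ennreal_leI[OF final])
  finally show ?thesis using P2 unfolding E_def R3_def by blast
qed

lemma (in reflected_rde) P2_to_P1_properties:
  assumes "(Z, Z') \<in> P2" "(Y, \<Phi>) = P2_to_P1 T C N (Z, Z')"
  shows "(\<forall>t\<in>{0..T}. Y t = Z t + C Y t + \<Phi> t *\<^sub>R e) \<and> (\<forall>t\<in>{0..T}. Z' t = \<sigma> (Y t))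
    \<and> (\<forall>t\<in>{0..T}. \<Phi> t = ell T N (\<lambda>s. Z s + C Y s) t) \<and> (Y, \<Phi>) \<in> P1"
proof -
  have eqs: "Y = (\<lambda>t. Z t + At Z t)" "\<Phi> = Lt Z" using assms(2) by (simp_all add: P2_to_P1_def)
  note s = P2_structure[OF assms(1), folded eqs]
  have "(\<forall>t\<in>{0..T}. Y t = Z t + C Y t + \<Phi> t *\<^sub>R e) \<and> (\<forall>t\<in>{0..T}. Z' t = \<sigma> (Y t))"
    using s(7) unfolding P1_solution_via_def prod.case by blast
  moreover have "\<forall>t\<in>{0..T}. \<Phi> t = ell T N (\<lambda>s. Z s + C Y s) t" using fun_cong[OF s(5)] by blast
  ultimately show ?thesis using P1I[OF s(7)] by blast
qed

theorem theorem5p20: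
  fixes \<beta> \<gamma> \<rho>'' \<kappa>' :: real
    and \<sigma> :: "real ^ 'n \<Rightarrow> (real ^ 'd) \<Rightarrow>\<^sub>L (real ^ 'n)"
    and N :: 'n
  assumes "1/3 < \<beta>" "\<beta> \<le> 1/2" "\<gamma> > 1 / \<beta>"
    and "\<sigma> \<in> Lip_class (\<gamma> - 1)"
    and "0 < \<rho>''" "0 < \<kappa>'" "\<kappa>' < 1"
  shows "\<exists>K \<kappa>\<^sub>1 \<kappa>\<^sub>2 \<kappa>\<^sub>3 :: real. 0 < K \<and> 0 < \<kappa>\<^sub>1 \<and> 0 < \<kappa>\<^sub>2 \<and> 0 < \<kappa>\<^sub>3 \<and>
    (\<forall>(T::real) (\<omega> :: real \<Rightarrow> real \<Rightarrow> real) (X :: real \<Rightarrow> real ^ 'd) (XX :: real \<Rightarrow> real \<Rightarrow> real ^ 'd ^ 'd)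
      (\<xi> :: real ^ 'n) (C :: (real \<Rightarrow> real ^ 'n) \<Rightarrow> (real \<Rightarrow> real ^ 'n)) (\<rho>'::real) (\<kappa>::real).
      0 < T \<and> rough_path T \<omega> \<beta> X XX
      \<and> (\<forall>x\<in>paths T. C x \<in> paths T \<and> total_var (C x) 0 T < \<infinity>)
      \<and> continuous_mapping T C \<and> adapted T C
      \<and> (\<forall>x\<in>paths T. \<exists>!y. y \<in> paths T \<and> y = (\<lambda>t. x t + C y t))
      \<and> Lip_cond T \<rho>' (C_tilde T C) \<and> BV_cond T \<rho>'' (C_tilde T C)
      \<and> Lip_cond T \<kappa> (\<lambda>x t. C_tilde T C x t $ N) \<and> \<kappa> < 1
      \<and> BV_cond T \<kappa>' (\<lambda>x t. C_tilde T C x t $ N)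
      \<and> (\<forall>\<eta>. \<eta> = \<xi> + C_init T C \<eta> \<longrightarrow> \<eta> $ N \<ge> 0)
      \<longrightarrow>
      (\<exists>Z Z'. (Z, Z') \<in> P2_solutions T \<omega> \<beta> X XX \<sigma> \<xi> C N \<and>
        holder T \<omega> \<beta> Z + holder T \<omega> \<beta> Z' + var_holder T \<omega> \<beta> (A_tilde T C N Z)
          + holder2 T \<omega> (2 * \<beta>) (remainder X Z Z')
        \<le> ennreal (K * (1 + (1 + rough_norm3 T \<omega> \<beta> X XX) powr \<kappa>\<^sub>1 * \<omega> 0 T) powr \<kappa>\<^sub>2
              * rough_norm3 T \<omega> \<beta> X XX powr \<kappa>\<^sub>3))
      \<and> (\<forall>Z Z' Y \<Phi>. (Z, Z') \<in> P2_solutions T \<omega> \<beta> X XX \<sigma> \<xi> C N \<and> (Y, \<Phi>) = P2_to_P1 T C N (Z, Z')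
          \<longrightarrow> (\<forall>t\<in>{0..T}. Y t = Z t + C Y t + \<Phi> t *\<^sub>R axis N 1)
            \<and> (\<forall>t\<in>{0..T}. Z' t = \<sigma> (Y t))
            \<and> (\<forall>t\<in>{0..T}. \<Phi> t = ell T N (\<lambda>s. Z s + C Y s) t)
            \<and> (Y, \<Phi>) \<in> P1_solutions T \<omega> \<beta> X XX \<sigma> \<xi> C N)
      \<and> (\<forall>S W. P1_solution_via T \<omega> \<beta> X XX \<sigma> \<xi> C N S W \<longrightarrow> W \<in> P2_solutions T \<omega> \<beta> X XX \<sigma> \<xi> C N)
      \<and> (\<forall>Y \<Phi>\<^sub>1 \<Phi>\<^sub>2 W\<^sub>1 W\<^sub>2. P1_solution_via T \<omega> \<beta> X XX \<sigma> \<xi> C N (Y, \<Phi>\<^sub>1) W\<^sub>1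
            \<and> P1_solution_via T \<omega> \<beta> X XX \<sigma> \<xi> C N (Y, \<Phi>\<^sub>2) W\<^sub>2 \<longrightarrow> W\<^sub>1 = W\<^sub>2)
      \<and> (\<forall>W\<in>P2_solutions T \<omega> \<beta> X XX \<sigma> \<xi> C N.
            P1_to_P2 T \<omega> \<beta> X XX \<sigma> \<xi> C N (P2_to_P1 T C N W) = W)
      \<and> (\<forall>S\<in>P1_solutions T \<omega> \<beta> X XX \<sigma> \<xi> C N.
            P2_to_P1 T C N (P1_to_P2 T \<omega> \<beta> X XX \<sigma> \<xi> C N S) = S)
      \<and> ((\<exists>\<^sub>\<le>\<^sub>1S. S \<in> P1_solutions T \<omega> \<beta> X XX \<sigma> \<xi> C N)
          \<longleftrightarrow> (\<exists>\<^sub>\<le>\<^sub>1W. W \<in> P2_solutions T \<omega> \<beta> X XX \<sigma> \<xi> C N)))"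
proof -
  have \<beta>: "0 < \<beta>" using assms by simp
  have "2 \<le> 1 / \<beta>" using assms \<beta> by (simp add: field_simps)
  then have \<gamma>: "1 < \<gamma> - 1" using assms by linarith
  obtain B \<theta> where vf: "vector_field \<sigma> B \<theta>" and \<theta>: "\<theta> = \<gamma> - 1 - 1 \<or> \<theta> = 1"
    by (rule Lip_class_vector_field[OF assms(4) \<gamma>]) (rule that)
  interpret vf: vector_field \<sigma> B \<theta> by (rule vf)
  \<comment> \<open>In the first case the product is \<open>\<gamma> * \<beta>\<close>, in the
    second \<open>3 * \<beta>\<close>: the lower bounds on \<gamma> and \<beta> match the two kinds
    of Hoelder exponent.\<close>
  have a: "1 < (2 + \<theta>) * \<beta>"
    using \<theta>
  proof
    assume "\<theta> = \<gamma> - 1 - 1"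
    then show ?thesis using assms(3) \<beta> by (simp add: field_simps)
  next
    assume "\<theta> = 1"
    then show ?thesis using assms(1) by simp
  qed
  define q where "q = (1 + \<kappa>') / (1 - \<kappa>')"
  define CA where "CA = \<rho>'' * (1 + q) + q"
  have q: "0 \<le> q" using assms by (simp add: q_def)
  have CA: "0 \<le> CA" using assms q by (simp add: CA_def)
  \<comment> \<open>Fixed before \<open>T\<close>, \<omega>, \<open>X\<close>, \<xi> and
    \<open>C\<close> are introduced, which is the uniformity claimed for \<open>K\<close>.\<close>
  obtain M h L L' \<epsilon>\<^sub>1 \<epsilon>\<^sub>2 where dc: "davie_constants \<sigma> B \<theta> \<beta> CA M ((2 + \<theta>) * \<beta>) h L L' \<epsilon>\<^sub>1 \<epsilon>\<^sub>2"
    using vf.davie_constants_exist[OF \<beta> a CA] by blast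
  interpret dc: davie_constants \<sigma> B \<theta> \<beta> CA M "(2 + \<theta>) * \<beta>" h L L' \<epsilon>\<^sub>1 \<epsilon>\<^sub>2 by (rule dc)
  define K where "K = (18 * B + B * ((1 + CA) * (18 * B)) + CA * (18 * B) +
      (L + L' * (CA * (18 * B)) + B + (18 * B + B) * h powr (- \<beta>))) / h"
  have "0 < K"
    unfolding K_def using vf.B CA dc.L dc.h by (intro divide_pos_pos add_pos_nonneg add_nonneg_nonneg mult_nonneg_nonneg) auto
  show ?thesis
  proof (rule exI[of _ K], rule exI[of _ "1 / \<beta>"], rule exI[of _ 1], rule exI[of _ 1], intro conjI, goal_cases)
    case 1
    show ?case by fact
  next
    case 2
    show ?case using \<beta> by simp
  next
    case 5
    show ?case
    proof (intro allI impI, goal_cases)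
      case (1 T \<omega> X XX \<xi> C \<rho>' \<kappa>)
      interpret R: reflected_rde T C N \<xi> \<rho>' \<rho>'' \<kappa> \<kappa>' \<sigma> B \<theta> \<omega> \<beta> X XX
        by unfold_locales (use 1 assms \<beta> in blast)+
      show ?case
      proof (intro conjI, goal_cases)
        case 1
        show ?case
          using R.solution_bounds[OF dc[unfolded CA_def q_def]] unfolding K_def CA_def q_def .
      next
        case 2
        show ?case by (intro allI impI R.P2_to_P1_properties) blast+
      next
        case 3
        show ?case by (intro allI impI R.P1_via_P2)
      next
        case 4
        show ?case by (intro allI impI R.P1_controlled_path_unique) blast+
      next
        case 5
        show ?case by (intro ballI R.P1_to_P2_eq R.P2_to_P1_via)
      next
        case 6
        show ?case
        proof
          fix S assume "S \<in> R.P1"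
          then obtain W where W: "R.via S W" by (rule R.P1E)
          show "P2_to_P1 T C N (P1_to_P2 T \<omega> \<beta> X XX \<sigma> \<xi> C N S) = S"
            unfolding R.P1_to_P2_eq[OF W] by (rule R.P2_to_P1_eq[OF W])
        qed
      next
        case 7
        show ?case by (rule R.P1_P2_uniqueness)
      qed
    qed
  qed simp_all
qed

end
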